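(* Fix positive integers $d$ and $p$. The function $\mathrm{gnd}(d,p;V)$ of $V \in \mathbb{Z}_{\ge 0}$ is a quasi-polynomial of degree $pd$, having period dividing $\operatorname{lcm}(1,2,\dots,d)$, non-negative $h$-vector, and volume given by the normalized volume of $S_1$. The function $\mathrm{nd}(d,p;V)$ of $V \in \mathbb{Z}_{\ge 0}$ is a quasi-polynomial of degree $pd$.
   Context: A vector $h \in \mathbb{R}^{p(d+1)}$ is indexed as $h = (h_0, h_1, \dots, h_{p(d+1)-1})$, and we write $h_{r,j} := h_{jp+r}$ for $0 \le r \le p-1$ and $0 \le j \le d$. Put $h(z) := \sum_i h_i z^i$ and define $L_h : \mathbb{Z}_{\ge 0} \to \mathbb{R}$ by $\sum_{n \ge 0} L_h(n) z^n := h(z)/(1-z^p)^{d+1}$; equivalently, $L_h(tp+r) = \sum_{j=0}^d h_{r,j}\binom{t+d-j}{d}$ for $t \ge 0$, $0 \le r \le p-1$. For $N \in \mathbb{Z}_{\ge 0}$, let $C_N := \{h \in \mathbb{R}^{p(d+1)} : L_h(n+1) \ge L_h(n) \text{ for all integers } n \ge N\}$, let $C_{\mathrm{END}} := \bigcup_{N \ge 0} C_N$, and let $\overline{C_{\mathrm{END}}}$ be its topological closure. Every $h \in C_{\mathrm{END}}$ satisfies the volume equalities $\sum_{j=0}^d h_{r+1,j} = \sum_{j=0}^d h_{r,j}$ for $0 \le r \le p-2$; the volume of a vector $h$ satisfying them is $\sum_{j=0}^d h_{0,j}$. The first-level inequalities are $$\sum_{j=0}^d j\,h_{r+1,j} \le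 \sum_{j=0}^d j\,h_{r,j} \ \ (0 \le r \le p-2), \qquad \sum_{j=0}^d j\,h_{0,j} \le \sum_{j=0}^d (j+1)\,h_{p-1,j}.$$ A vector $h \in C_{\mathrm{END}}$ is generic if it satisfies the volume equalities, strictly satisfies the first-level inequalities, and has all positive entries. For $V \in \mathbb{Z}_{\ge 0}$, $\mathrm{nd}(d,p;V)$ denotes the number of vectors of volume $V$ in $C_{\mathrm{END}} \cap \mathbb{Z}_{\ge 0}^{p(d+1)}$, and $\mathrm{gnd}(d,p;V)$ denotes the number of generic vectors of volume $V$ in $C_{\mathrm{END}} \cap \mathbb{Z}_{\ge 0}^{p(d+1)}$. $S_1$ is the rational polytope $S_1 := \overline{C_{\mathrm{END}}} \cap \{h \in \mathbb{R}_{\ge 0}^{p(d+1)} : \sum_{j=0}^d h_{0,j} = 1\}$, which has dimension $pd$. Its normalized volume is meant in the usual sense of Ehrhart theory: $(pd)!$ times its $pd$-dimensional volume, measured relative to the lattice of integer vectors parallel to its affine hull. A quasi-polynomial of period dividing $m$ is a function that agrees with a polynomial (a constituent) on each residue class modulo $m$; its degree is the maximal degree of its constituents. The $h$-vector of a quasi-polynomial of degree $D$ and period dividing $m$ is the vector of coefficients of the numerator when its generating function is written with denominator $(1-z^m)^{D+1}$, and its volume is the sum of the $h$-vector entries whose index is congruent to $0$ modulo $m$ (the entries for the $0$-th constituent).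
   Formalization: gnd(d,p;V) is shown quasi-polynomial for V ≥ 1, as gnd(d,p;0)=0 is not the constituent's value; its h-vector, for m = lcm(1,…,d), is that of the actual counts (an entry at index m(pd+1) may occur), and its volume is m^{pd} times the normalized volume of S_1. *)

theory Defs
  imports
    "HOL-Analysis.Analysis"
    "HOL-Computational_Algebra.Computational_Algebra"
begin

text \<open>
  As in \<^const>\<open>Euclidean_space\<close>, a vector of \<open>\<real>\<^sup>n\<close> is a function \<open>nat \<Rightarrow> real\<close> that vanishes at
  all indices \<open>\<ge> n\<close>. Throughout, \<open>h\<close> lives in \<open>\<real>\<^sup>n\<close> with \<open>n = p * (d + 1)\<close>.
\<close>

subsection \<open>The cone of eventually nondecreasing functions\<close>

definition hh :: "nat \<Rightarrow> (nat \<Rightarrow> real) \<Rightarrow> nat \<Rightarrow> nat \<Rightarrow> real" where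
  "hh p h r j = h (j * p + r)"

definition L :: "nat \<Rightarrow> nat \<Rightarrow> (nat \<Rightarrow> real) \<Rightarrow> nat \<Rightarrow> real" where
  "L d p h n =
     fps_nth ((\<Sum>i<p * (d + 1). fps_const (h i) * fps_X ^ i) / (1 - fps_X ^ p) ^ (d + 1)) n"

definition C :: "nat \<Rightarrow> nat \<Rightarrow> nat \<Rightarrow> (nat \<Rightarrow> real) set" where
  "C d p N = {h \<in> topspace (Euclidean_space (p * (d + 1))). \<forall>n\<ge>N. L d p h (n + 1) \<ge> L d p h n}"

definition C_END :: "nat \<Rightarrow> nat \<Rightarrow> (nat \<Rightarrow> real) set" where
  "C_END d p = (\<Union>N. C d p N)"

definition volume_equalities :: "nat \<Rightarrow> nat \<Rightarrow> (nat \<Rightarrow> real) \<Rightarrow> bool" where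
  "volume_equalities d p h \<longleftrightarrow>
     (\<forall>r. r + 1 < p \<longrightarrow> (\<Sum>j\<le>d. hh p h (r + 1) j) = (\<Sum>j\<le>d. hh p h r j))"

definition vol :: "nat \<Rightarrow> nat \<Rightarrow> (nat \<Rightarrow> real) \<Rightarrow> real" where
  "vol d p h = (\<Sum>j\<le>d. hh p h 0 j)"

definition strict_first_level :: "nat \<Rightarrow> nat \<Rightarrow> (nat \<Rightarrow> real) \<Rightarrow> bool" where
  "strict_first_level d p h \<longleftrightarrow>
     (\<forall>r. r + 1 < p \<longrightarrow>
        (\<Sum>j\<le>d. real j * hh p h (r + 1) j) < (\<Sum>j\<le>d. real j * hh p h r j)) \<and>
     (\<Sum>j\<le>d. real j * hh p h 0 j) < (\<Sum>j\<le>d. real (j + 1) * hh p h (p - 1) j)"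

definition generic :: "nat \<Rightarrow> nat \<Rightarrow> (nat \<Rightarrow> real) \<Rightarrow> bool" where
  "generic d p h \<longleftrightarrow> h \<in> C_END d p \<and> volume_equalities d p h \<and> strict_first_level d p h \<and>
     (\<forall>i<p * (d + 1). 0 < h i)"

definition nd :: "nat \<Rightarrow> nat \<Rightarrow> nat \<Rightarrow> nat" where
  "nd d p V = card {h \<in> C_END d p. (\<forall>i. h i \<in> \<nat>) \<and> vol d p h = real V}"

definition gnd :: "nat \<Rightarrow> nat \<Rightarrow> nat \<Rightarrow> nat" where
  "gnd d p V = card {h \<in> C_END d p. (\<forall>i. h i \<in> \<nat>) \<and> generic d p h \<and> vol d p h = real V}"

definition S1 :: "nat \<Rightarrow> nat \<Rightarrow> (nat \<Rightarrow> real) set" where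
  "S1 d p = (Euclidean_space (p * (d + 1)) closure_of C_END d p) \<inter>
     {h. (\<forall>i. 0 \<le> h i) \<and> vol d p h = 1}"

subsection \<open>Normalized volume\<close>

text \<open>The type \<open>nat \<Rightarrow> real\<close> is not an instance of \<^class>\<open>real_vector\<close>, so \<open>affine hull\<close> is
  unavailable.\<close>

definition aff_hull :: "(nat \<Rightarrow> real) set \<Rightarrow> (nat \<Rightarrow> real) set" where
  "aff_hull S = {(\<lambda>i. \<Sum>l<m. u l * x l i) | (m::nat) u x. (\<forall>l<m. x l \<in> S) \<and> (\<Sum>l<m. u l) = 1}"

definition parallel_lattice :: "(nat \<Rightarrow> real) set \<Rightarrow> (nat \<Rightarrow> real) set" where
  "parallel_lattice S =
     {v. (\<exists>x\<in>aff_hull S. \<exists>y\<in>aff_hull S. v = (\<lambda>i. x i - y i)) \<and> (\<forall>i. v i \<in> \<int>)}"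

text \<open>\<open>x0\<close> and \<open>b 0, \<dots>, b (k - 1)\<close> give affine coordinates on the affine hull of \<open>S\<close> (which is
  therefore \<open>k\<close>-dimensional), and the \<open>b l\<close> form a basis of the parallel lattice.\<close>

definition lattice_chart ::
  "nat \<Rightarrow> (nat \<Rightarrow> real) set \<Rightarrow> (nat \<Rightarrow> real) \<Rightarrow> (nat \<Rightarrow> nat \<Rightarrow> real) \<Rightarrow> bool" where
  "lattice_chart k S x0 b \<longleftrightarrow>
     bij_betw (\<lambda>c i. x0 i + (\<Sum>l<k. c l * b l i)) ({..<k} \<rightarrow>\<^sub>E UNIV) (aff_hull S) \<and>
     (\<lambda>c i. \<Sum>l<k. c l * b l i) ` ({..<k} \<rightarrow>\<^sub>E \<int>) = parallel_lattice S"

text \<open>\<open>k!\<close> times the \<open>k\<close>-dimensional Lebesgue measure of \<open>S\<close> in the coordinates of a lattice chart.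
  Two charts differ by a translation and an integer matrix of determinant \<open>\<plusminus>1\<close>, so the value
  does not depend on the chart.\<close>

definition has_normalized_volume :: "nat \<Rightarrow> (nat \<Rightarrow> real) set \<Rightarrow> real \<Rightarrow> bool" where
  "has_normalized_volume k S v \<longleftrightarrow>
     (\<exists>x0 b. lattice_chart k S x0 b \<and>
        v = fact k * measure (\<Pi>\<^sub>M l\<in>{..<k}. lborel)
              {c \<in> {..<k} \<rightarrow>\<^sub>E UNIV. (\<lambda>i. x0 i + (\<Sum>l<k. c l * b l i)) \<in> S})"

subsection \<open>Quasi-polynomials\<close>

text \<open>\<open>f\<close> agrees on \<open>A\<close> with a quasi-polynomial of degree \<open>D\<close> and period dividing \<open>m\<close>; the
  polynomial \<open>q r\<close> is the constituent on the residue class of \<open>r\<close>.\<close>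

definition quasi_polynomial_on :: "nat set \<Rightarrow> nat \<Rightarrow> nat \<Rightarrow> (nat \<Rightarrow> real) \<Rightarrow> bool" where
  "quasi_polynomial_on A m D f \<longleftrightarrow> 0 < m \<and>
     (\<exists>q :: nat \<Rightarrow> real poly. (\<forall>n\<in>A. f n = poly (q (n mod m)) (real n)) \<and>
        Max ((\<lambda>r. degree (q r)) ` {..<m}) = D)"

text \<open>The \<open>h\<close>-vector is the coefficient vector of the numerator polynomial \<open>h\<close>. If \<open>f\<close> is
  quasi-polynomial on all of \<open>nat\<close>, then \<open>h\<close> has degree \<open>< m * (D + 1)\<close>; if the value \<open>f 0\<close> is
  exceptional (as for the number of interior lattice points of a dilated polytope), an entry of
  index \<open>m * (D + 1)\<close> occurs as well.\<close>

definition has_h_vector :: "(nat \<Rightarrow> real) \<Rightarrow> nat \<Rightarrow> nat \<Rightarrow> real poly \<Rightarrow> bool" where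
  "has_h_vector f m D h \<longleftrightarrow> Abs_fps f = fps_of_poly h / (1 - fps_X ^ m) ^ (D + 1)"

text \<open>The volume scales with the chosen period: for the counting function of the (interior) lattice
  points of the dilates \<open>V * P\<close> of a \<open>D\<close>-dimensional rational polytope \<open>P\<close>, it is the normalized
  volume of \<open>m * P\<close>, that is \<open>m ^ D\<close> times that of \<open>P\<close>.\<close>

definition h_vector_volume :: "nat \<Rightarrow> real poly \<Rightarrow> real" where
  "h_vector_volume m h = (\<Sum>i | i \<le> degree h \<and> m dvd i. coeff h i)"

end

(* Rewrite membership in the closure of C_END in terms of the row sums and first moments of h. Its
   nonnegative part is a rational cone; on an extreme ray every row is a lattice point or lies on a
   segment between two of the points (1, a) and (1, b) and has an integral mean, so that it has
   denominator at most b - a <= d. Triangulate by linear programming with a generic cost and push a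
   generic vector towards (or away from) the interior: the lattice points of the cone (or of its
   interior) become a disjoint union of half-open simplicial cones, whose Hilbert series have
   nonnegative numerators over powers of 1 - z^m. The leading coefficient is the volume because it
   is the density of lattice points. For nd, C_END is cut out by lexicographic conditions; by
   inclusion-exclusion its lattice points are counted by closed cones, all of them nonzero, so that
   the quasi-polynomial is correct at 0 as well. *)

theory Submission
  imports Defs "HOL-Library.Function_Algebras"
begin

text \<open>Within a residue class modulo p the increments of \<open>L\<close> are polynomials, so
  \<open>C_END\<close> is governed by signs of leading coefficients. Strict first-level inequalities
  already fix these signs, whence \<open>gnd\<close> counts the interior points of one polyhedral
  cone. In \<open>C_END\<close> itself ties are broken by lower coefficients; the set is in general
  not closed, and \<open>nd\<close> has to be assembled from many cones. The generators are all
  taken at the height m = lcm(1, ..., d), so the simplicial pieces share one denominator and their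
  numerators count the lattice points of half-open parallelepipeds. For interior points the
  numerator is only known to have degree at most m (pd + 1), hence the restriction to V \<ge> 1. For
  \<open>nd\<close> the value at 0 must be right too. Equality in all rows at once would leave only
  the cone {0}, whose count is 1 at 0 and 0 elsewhere, which is no quasi-polynomial. This is why the
  complementary conditions, rows with eventually decreasing steps, are counted: they never hold in
  all rows together. That the degree of \<open>nd\<close> is not smaller than pd follows from
  \<open>gnd\<close> being a lower bound.\<close>

section \<open>Pointwise vector space structure on functions\<close>

instantiation "fun" :: (type, real_vector) real_vector
begin

definition scaleR_fun :: "real \<Rightarrow> ('a \<Rightarrow> 'b) \<Rightarrow> 'a \<Rightarrow> 'b" where
  "scaleR_fun c f = (\<lambda>x. c *\<^sub>R f x)"

instance
  by standard (auto simp: scaleR_fun_def fun_eq_iff scaleR_add_right scaleR_add_left)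

end

lemma scaleR_fun_apply [simp]: "(c *\<^sub>R f) x = c *\<^sub>R f x"
  by (simp add: scaleR_fun_def)

lemma sum_fun_apply: "(\<Sum>i\<in>I. f i) x = (\<Sum>i\<in>I. f i x)"
  by (induction I rule: infinite_finite_induct) auto

lemma linear_funI:
  fixes f :: "'a::real_vector \<Rightarrow> real"
  assumes "\<And>x y. f (x + y) = f x + f y" "\<And>c x. f (c *\<^sub>R x) = c * f x"
  shows "linear f"
  using assms by (intro linearI) auto

subsection \<open>Generic points\<close>

text \<open>For infinitesimal e > 0 the sign of \<open>a + e * b\<close> is the lexicographic sign
  of the pair (a, b). All perturbation arguments below reduce to this.\<close>

lemma eventually_at_right_affine_pos:
  fixes a b :: real
  assumes "a > 0 \<or> a = 0 \<and> b > 0"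
  shows "\<forall>\<^sub>F e in at_right 0. a + e * b > 0"
proof (cases "a > 0")
  case True
  have "((\<lambda>e. a + e * b) \<longlongrightarrow> a + 0 * b) (at_right 0)"
    by (intro tendsto_intros)
  with True show ?thesis by (auto dest: order_tendstoD)
next
  case False
  with assms show ?thesis
    using eventually_mono[OF eventually_at_right_less[of "0::real"], of "\<lambda>e. 0 < e * b"] by auto
qed

lemma eventually_at_right_affine_neg:
  fixes a b :: real
  assumes "a < 0 \<or> a = 0 \<and> b < 0"
  shows "\<forall>\<^sub>F e in at_right 0. a + e * b < 0"
  using eventually_at_right_affine_pos[of "-a" "-b"] assms
  by (auto elim!: eventually_mono)

text \<open>The functionals are treated one at a time: a small move along some \<open>v\<close> with
  \<open>f v \<noteq> 0\<close> makes \<open>f\<close> nonzero and, being small, spoils neither the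
  earlier inequations nor the positivity on \<open>P\<close>.\<close>

lemma exists_generic_point:
  fixes F P :: "('v::real_vector \<Rightarrow> real) set"
  assumes "finite F" and F: "\<And>f. f \<in> F \<Longrightarrow> linear f \<and> (\<exists>v. f v \<noteq> 0)"
    and P: "finite P" "\<And>f. f \<in> P \<Longrightarrow> linear f \<and> f w0 > 0"
  shows "\<exists>w. (\<forall>f\<in>F. f w \<noteq> 0) \<and> (\<forall>f\<in>P. f w > 0)"
  using assms(1,2)
proof (induction F rule: finite_induct)
  case empty
  show ?case using P by auto
next
  case (insert f F)
  obtain w where w: "\<And>f. f \<in> F \<Longrightarrow> f w \<noteq> 0" "\<And>f. f \<in> P \<Longrightarrow> f w > 0"
    using insert by blast
  obtain v where v: "f v \<noteq> 0" using insert.prems by blast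
  have eq: "g (w + e *\<^sub>R v) = g w + e * g v" if "linear g" for g :: "'v \<Rightarrow> real" and e :: real
    using that by (simp add: linear_add linear_cmul)
  have nz: "\<forall>\<^sub>F e in at_right 0. g (w + e *\<^sub>R v) \<noteq> 0" if "linear g" "g w \<noteq> 0 \<or> g v \<noteq> 0" for g :: "'v \<Rightarrow> real"
  proof -
    have "(g w > 0 \<or> g w = 0 \<and> g v > 0) \<or> (g w < 0 \<or> g w = 0 \<and> g v < 0)"
      using that(2) by linarith
    then show ?thesis
      using eventually_at_right_affine_pos[of "g w" "g v"] eventually_at_right_affine_neg[of "g w" "g v"]
      by (auto simp: eq[OF that(1)] elim!: eventually_mono)
  qed
  have "\<forall>\<^sub>F e in at_right 0. (\<forall>g\<in>insert f F. g (w + e *\<^sub>R v) \<noteq> 0) \<and> (\<forall>g\<in>P. g (w + e *\<^sub>R v) > 0)"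
  proof (intro eventually_conj eventually_ball_finite ballI)
    fix g assume "g \<in> P"
    then show "\<forall>\<^sub>F e in at_right 0. g (w + e *\<^sub>R v) > 0"
      using P w eventually_at_right_affine_pos[of "g w" "g v"] by (simp add: eq)
  qed (use insert P w v nz in auto)
  then show ?case
    using eventually_happens'[OF trivial_limit_at_right_real] by blast
qed

subsection \<open>Finitely generated cones\<close>

text \<open>Meant for finite \<open>G\<close>: a sum over an infinite set is 0 by convention, so the
  value would then be {0}.\<close>

definition fcone :: "'a::real_vector set \<Rightarrow> 'a set" where
  "fcone G = {\<Sum>g\<in>G. l g *\<^sub>R g | l. \<forall>g\<in>G. 0 \<le> l g}"

lemma fcone_subset_span: "fcone G \<subseteq> span G"
  by (auto simp: fcone_def intro!: span_sum intro: span_scale span_base)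

lemma fcone_zero: "0 \<in> fcone G"
  unfolding fcone_def by (rule CollectI, rule exI[of _ "\<lambda>_. 0"]) simp

lemma fcone_add:
  assumes "x \<in> fcone G" "y \<in> fcone G"
  shows "x + y \<in> fcone G"
proof -
  obtain l k where "x = (\<Sum>g\<in>G. l g *\<^sub>R g)" "y = (\<Sum>g\<in>G. k g *\<^sub>R g)"
    and "\<forall>g\<in>G. 0 \<le> l g" "\<forall>g\<in>G. 0 \<le> k g"
    using assms by (auto simp: fcone_def)
  then show ?thesis unfolding fcone_def
    by (intro CollectI exI[of _ "\<lambda>g. l g + k g"]) (simp add: scaleR_add_left sum.distrib)
qed

lemma fcone_scaleR:
  assumes "x \<in> fcone G" "0 \<le> c"
  shows "c *\<^sub>R x \<in> fcone G"
proof -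
  obtain l where "x = (\<Sum>g\<in>G. l g *\<^sub>R g)" "\<forall>g\<in>G. 0 \<le> l g"
    using assms by (auto simp: fcone_def)
  then show ?thesis unfolding fcone_def using assms(2)
    by (intro CollectI exI[of _ "\<lambda>g. c * l g"]) (simp add: scaleR_sum_right)
qed

lemma fcone_base:
  assumes "finite G" "g \<in> G"
  shows "g \<in> fcone G"
  unfolding fcone_def
proof (intro CollectI exI[of _ "\<lambda>h. of_bool (h = g)"] conjI)
  show "g = (\<Sum>h\<in>G. of_bool (h = g) *\<^sub>R h)"
    using assms sum.remove[of G g "\<lambda>h. of_bool (h = g) *\<^sub>R h"] by simp
qed simp

lemma fcone_sum:
  assumes "\<And>i. i \<in> I \<Longrightarrow> f i \<in> fcone G"
  shows "(\<Sum>i\<in>I. f i) \<in> fcone G"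
  using assms by (induction I rule: infinite_finite_induct) (auto simp: fcone_zero fcone_add)

lemma fcone_minimal:
  assumes "\<And>g. g \<in> H \<Longrightarrow> g \<in> fcone G"
  shows "fcone H \<subseteq> fcone G"
  by (auto simp: fcone_def[of H] intro!: fcone_sum intro: fcone_scaleR assms)

lemma fcone_mono:
  assumes "finite G" "H \<subseteq> G"
  shows "fcone H \<subseteq> fcone G"
  using assms by (intro fcone_minimal fcone_base) auto

lemma fcone_linear_nonneg:
  fixes f :: "'a::real_vector \<Rightarrow> real"
  assumes "linear f" "\<And>g. g \<in> G \<Longrightarrow> 0 \<le> f g" "x \<in> fcone G"
  shows "0 \<le> f x"
  using assms by (auto simp: fcone_def linear_sum linear_cmul intro!: sum_nonneg mult_nonneg_nonneg)

text \<open>One step of the double description method.\<close>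

lemma fcone_halfspace:
  fixes a :: "'a::real_vector \<Rightarrow> real"
  assumes "finite G" "linear a"
  shows "{x \<in> fcone G. 0 \<le> a x} =
    fcone ({g \<in> G. 0 \<le> a g} \<union> (\<lambda>(g, h). a g *\<^sub>R h - a h *\<^sub>R g) ` ({g \<in> G. 0 < a g} \<times> {g \<in> G. a g < 0}))"
    (is "?L = fcone ?H")
proof (intro equalityI subsetI)
  have finH: "finite ?H" using assms by simp
  fix x assume "x \<in> fcone ?H"
  have H: "g \<in> fcone G \<and> 0 \<le> a g" if "g \<in> ?H" for g
  proof -
    have "a g *\<^sub>R h - a h *\<^sub>R g \<in> fcone G" if "g \<in> G" "h \<in> G" "0 < a g" "a h < 0" for g h
      using fcone_add[OF fcone_scaleR[OF fcone_base[of G h], of "a g"] fcone_scaleR[OF fcone_base[of G g], of "- a h"]]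
        that assms(1) by simp
    then show ?thesis using that assms
      by (auto simp: fcone_base linear_diff linear_cmul)
  qed
  show "x \<in> ?L"
    using \<open>x \<in> fcone ?H\<close> fcone_minimal[of ?H G] H fcone_linear_nonneg[OF assms(2), of ?H x] by blast
next
  fix x assume x: "x \<in> ?L"
  have finH: "finite ?H" using assms by simp
  obtain l where l: "x = (\<Sum>g\<in>G. l g *\<^sub>R g)" "\<And>g. g \<in> G \<Longrightarrow> 0 \<le> l g"
    using x by (auto simp: fcone_def)
  define P where "P = {g \<in> G. 0 < a g}"
  define N where "N = {g \<in> G. a g < 0}"
  define Z where "Z = {g \<in> G. a g = 0}"
  have fin: "finite P" "finite N" "finite Z" using assms by (auto simp: P_def N_def Z_def)
  have split: "sum f G = sum f P + sum f N + sum f Z" for f :: "'a \<Rightarrow> 'b::comm_monoid_add"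
  proof -
    have "G = P \<union> N \<union> Z" by (auto simp: P_def N_def Z_def)
    moreover have "sum f (P \<union> N \<union> Z) = sum f (P \<union> N) + sum f Z"
      using fin by (intro sum.union_disjoint) (auto simp: P_def N_def Z_def)
    moreover have "sum f (P \<union> N) = sum f P + sum f N"
      using fin by (intro sum.union_disjoint) (auto simp: P_def N_def Z_def)
    ultimately show ?thesis by simp
  qed
  define sP where "sP = (\<Sum>g\<in>P. l g * a g)"
  define sN where "sN = (\<Sum>g\<in>N. l g * - a g)"
  have sPN: "sN \<le> sP"
  proof -
    have "a x = (\<Sum>g\<in>G. l g * a g)" using assms(2) by (simp add: l linear_sum linear_cmul)
    also have "\<dots> = sP - sN + (\<Sum>g\<in>Z. l g * a g)"
      by (simp add: split sP_def sN_def sum_negf)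
    also have "(\<Sum>g\<in>Z. l g * a g) = 0" by (intro sum.neutral) (auto simp: Z_def)
    finally show ?thesis using x by simp
  qed
  have sN0: "0 \<le> sN" unfolding sN_def by (intro sum_nonneg mult_nonneg_nonneg) (auto simp: N_def l(2))
  have PH: "g \<in> fcone ?H" if "g \<in> P \<union> Z" for g
    using that by (intro fcone_base finH) (auto simp: P_def Z_def)
  show "x \<in> fcone ?H"
  proof (cases "sP = 0")
    case True
    then have "sN = 0" using sPN sN0 by simp
    then have "\<forall>g\<in>N. l g * - a g = 0" unfolding sN_def
      using fin by (subst (asm) sum_nonneg_eq_0_iff) (auto simp: N_def l(2) mult_nonneg_nonpos)
    then have "(\<Sum>g\<in>N. l g *\<^sub>R g) = 0"
      by (intro sum.neutral) (auto simp: N_def)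
    then have "x = (\<Sum>g\<in>P. l g *\<^sub>R g) + (\<Sum>g\<in>Z. l g *\<^sub>R g)" by (simp add: l(1) split)
    then show ?thesis
      using PH l(2) by (auto intro!: fcone_add fcone_sum fcone_scaleR simp: P_def Z_def)
  next
    case False
    then have sP: "sP > 0" using sPN sN0 by simp
    \<comment> \<open>With these weights the mixed vectors reproduce the whole \<open>N\<close> part
      of \<open>x\<close> and use up the share \<open>sN / sP\<close> of its \<open>P\<close> part.
      Since \<open>sN \<le> sP\<close>, what remains of the \<open>P\<close> part has nonnegative
      coefficients.\<close>
    have "(\<Sum>g\<in>P. \<Sum>h\<in>N. (l g * l h / sP) *\<^sub>R (a g *\<^sub>R h - a h *\<^sub>R g)) =
        (\<Sum>g\<in>P. \<Sum>h\<in>N. (l g * a g / sP) *\<^sub>R (l h *\<^sub>R h)) + (\<Sum>g\<in>P. \<Sum>h\<in>N. (l h * - a h / sP) *\<^sub>R (l g *\<^sub>R g))"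
      by (simp add: sum.distrib[symmetric] scaleR_diff_right algebra_simps)
    also have "(\<Sum>g\<in>P. \<Sum>h\<in>N. (l g * a g / sP) *\<^sub>R (l h *\<^sub>R h)) = (sP / sP) *\<^sub>R (\<Sum>h\<in>N. l h *\<^sub>R h)"
      unfolding sP_def by (simp only: scaleR_sum_right[symmetric] scaleR_sum_left[symmetric] sum_divide_distrib)
    also have "(\<Sum>g\<in>P. \<Sum>h\<in>N. (l h * - a h / sP) *\<^sub>R (l g *\<^sub>R g)) = (sN / sP) *\<^sub>R (\<Sum>h\<in>P. l h *\<^sub>R h)"
      unfolding sN_def
      by (subst sum.swap) (simp only: scaleR_sum_right[symmetric] scaleR_sum_left[symmetric] sum_divide_distrib)
    finally have "x = (\<Sum>g\<in>P. \<Sum>h\<in>N. (l g * l h / sP) *\<^sub>R (a g *\<^sub>R h - a h *\<^sub>R g))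
        + (1 - sN / sP) *\<^sub>R (\<Sum>g\<in>P. l g *\<^sub>R g) + (\<Sum>g\<in>Z. l g *\<^sub>R g)"
      using sP by (simp add: l(1) split algebra_simps)
    moreover have "a g *\<^sub>R h - a h *\<^sub>R g \<in> fcone ?H" if "g \<in> P" "h \<in> N" for g h
      using that by (intro fcone_base finH) (auto simp: P_def N_def)
    ultimately show ?thesis
      using PH l(2) sPN sP
      by (auto intro!: fcone_add fcone_sum fcone_scaleR divide_nonneg_nonneg mult_nonneg_nonneg simp: P_def N_def Z_def)
  qed
qed

text \<open>In a representing subset of least cardinality, a linear dependence could be subtracted
  until the first coefficient reaches 0, which would give a smaller subset.\<close>

lemma caratheodory_fcone:
  assumes "finite G" "x \<in> fcone G"
  obtains S where "S \<subseteq> G" "independent S" "x \<in> fcone S"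
proof -
  obtain S where S: "S \<subseteq> G" "x \<in> fcone S" and min: "\<And>T. T \<subseteq> G \<Longrightarrow> x \<in> fcone T \<Longrightarrow> card S \<le> card T"
    using ex_has_least_nat[of "\<lambda>S. S \<subseteq> G \<and> x \<in> fcone S" G card] assms by auto
  have fS: "finite S" using S(1) assms(1) finite_subset by blast
  obtain l where l: "x = (\<Sum>g\<in>S. l g *\<^sub>R g)" "\<And>g. g \<in> S \<Longrightarrow> 0 \<le> l g"
    using S(2) by (auto simp: fcone_def)
  have "independent S"
  proof
    assume "dependent S"
    then obtain u where u: "\<exists>g\<in>S. u g \<noteq> 0" "(\<Sum>g\<in>S. u g *\<^sub>R g) = 0"
      using fS by (auto simp: dependent_finite)
    have "\<exists>u. (\<exists>g\<in>S. 0 < u g) \<and> (\<Sum>g\<in>S. u g *\<^sub>R g) = 0"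
    proof (cases "\<exists>g\<in>S. 0 < u g")
      case False
      with u have "\<exists>g\<in>S. 0 < - u g" by force
      moreover have "(\<Sum>g\<in>S. (- u g) *\<^sub>R g) = 0" using u(2) by (simp add: sum_negf)
      ultimately show ?thesis by (intro exI[of _ "\<lambda>g. - u g"]) simp
    qed (use u in blast)
    then obtain u where u: "\<exists>g\<in>S. 0 < u g" "(\<Sum>g\<in>S. u g *\<^sub>R g) = 0" by blast
    define T where "T = {g \<in> S. 0 < u g}"
    have T: "finite T" "T \<noteq> {}" using fS u by (auto simp: T_def)
    define t where "t = Min ((\<lambda>g. l g / u g) ` T)"
    have "t \<in> (\<lambda>g. l g / u g) ` T"
      unfolding t_def using T by (intro Min_in) auto
    then obtain h where h: "h \<in> T" "t = l h / u h" by blast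
    have tle: "t \<le> l g / u g" if "g \<in> T" for g
      unfolding t_def using T that by (intro Min_le) auto
    have t0: "0 \<le> t" using h l(2) by (auto simp: T_def)
    have nn: "0 \<le> l g - t * u g" if "g \<in> S" for g
    proof (cases "g \<in> T")
      case True
      then show ?thesis using tle[OF True] by (simp add: T_def field_simps)
    next
      case False
      then have "t * u g \<le> 0" using t0 that by (auto simp: T_def mult_nonneg_nonpos)
      then show ?thesis using l(2)[OF that] by simp
    qed
    have z: "l h - t * u h = 0" using h by (simp add: T_def)
    have "x = (\<Sum>g\<in>S. (l g - t * u g) *\<^sub>R g)"
    proof -
      have "(\<Sum>g\<in>S. (l g - t * u g) *\<^sub>R g) = (\<Sum>g\<in>S. l g *\<^sub>R g) - t *\<^sub>R (\<Sum>g\<in>S. u g *\<^sub>R g)"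
        by (simp add: scaleR_diff_left sum_subtractf scaleR_sum_right)
      then show ?thesis using u l by simp
    qed
    also have "\<dots> = (\<Sum>g\<in>S - {h}. (l g - t * u g) *\<^sub>R g)"
      using fS h z by (subst sum.remove[of S h]) (auto simp: T_def)
    finally have "x \<in> fcone (S - {h})"
      unfolding fcone_def using nn by (intro CollectI exI[of _ "\<lambda>g. l g - t * u g"]) auto
    then have "card S \<le> card (S - {h})" using min[of "S - {h}"] S by auto
    moreover have "h \<in> S" using h by (auto simp: T_def)
    ultimately show False using fS by (metis card_Diff1_less not_less)
  qed
  with S that show ?thesis by blast
qed

lemma fcone_independent_iff:
  assumes "independent B" "finite B" "x \<in> span B"
  shows "x \<in> fcone B \<longleftrightarrow> (\<forall>b\<in>B. 0 \<le> representation B x b)"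
proof
  assume "x \<in> fcone B"
  then obtain l where l: "x = (\<Sum>g\<in>B. l g *\<^sub>R g)" "\<And>g. g \<in> B \<Longrightarrow> 0 \<le> l g"
    by (auto simp: fcone_def)
  have "representation B x b = l b" if "b \<in> B" for b
  proof -
    have "representation B x b = (\<Sum>g\<in>B. l g * representation B g b)"
      using assms l(1) by (simp add: representation_sum representation_scale span_base span_scale)
    also have "\<dots> = (\<Sum>g\<in>B. if g = b then l b else 0)"
      using assms(1) by (intro sum.cong) (auto simp: representation_basis)
    also have "\<dots> = l b" using assms(2) that by simp
    finally show ?thesis .
  qed
  then show "\<forall>b\<in>B. 0 \<le> representation B x b" using l by simp
next
  assume "\<forall>b\<in>B. 0 \<le> representation B x b"
  moreover have "x = (\<Sum>b\<in>B. representation B x b *\<^sub>R b)"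
    using sum_representation_eq[OF assms(1,3,2)] by simp
  ultimately show "x \<in> fcone B" unfolding fcone_def by blast
qed

subsection \<open>Half-open triangulations\<close>

definition bases :: "'a::real_vector set \<Rightarrow> 'a set set" where
  "bases G = {B. B \<subseteq> G \<and> independent B \<and> G \<subseteq> span B}"

text \<open>On \<open>span B\<close> this is the linear functional that agrees with \<open>c\<close>
  on \<open>B\<close>. In terms of linear programming, \<open>c g - basis_cost c B g\<close> is the
  reduced cost of \<open>g\<close>.\<close>

definition basis_cost :: "('a::real_vector \<Rightarrow> real) \<Rightarrow> 'a set \<Rightarrow> 'a \<Rightarrow> real" where
  "basis_cost c B x = (\<Sum>b\<in>B. representation B x b * c b)"

text \<open>These bases are the maximal cells of the regular triangulation obtained by lifting every
  generator \<open>g\<close> to the height \<open>c g\<close> and taking the lower hull;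
  \<open>c\<close> will be generic.\<close>

definition dual_feasible :: "('a::real_vector \<Rightarrow> real) \<Rightarrow> 'a set \<Rightarrow> 'a set \<Rightarrow> bool" where
  "dual_feasible c G B \<longleftrightarrow> B \<in> bases G \<and> (\<forall>g\<in>G - B. basis_cost c B g < c g)"

lemma basesD:
  assumes "finite G" "B \<in> bases G"
  shows "B \<subseteq> G" "independent B" "finite B" "span B = span G"
  using assms finite_subset span_mono[of B G] span_minimal[of G "span B"]
  by (auto simp: bases_def)

lemma finite_bases: "finite G \<Longrightarrow> finite (bases G)"
  by (rule finite_subset[of _ "Pow G"]) (auto simp: bases_def)

lemma card_bases:
  assumes "finite G" "B \<in> bases G"
  shows "card B = dim (span G)"
  using basesD[OF assms] by (metis dim_span_eq_card_independent)

text \<open>Each condition excludes the kernel of one functional of \<open>c\<close>. This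
  functional is nonzero because, for \<open>g\<close> outside \<open>B\<close>, changing
  \<open>c g\<close> alone leaves \<open>basis_cost c B g\<close> unchanged.\<close>

lemma exists_generic_cost:
  fixes G :: "'a::real_vector set"
  assumes "finite G"
  shows "\<exists>c. \<forall>B\<in>bases G. \<forall>g\<in>G - B. basis_cost c B g \<noteq> c g"
proof -
  define F where "F = (\<lambda>(B, g) c. basis_cost c B g - c g) ` Sigma (bases G) (\<lambda>B. G - B)"
  have "\<exists>c. (\<forall>f\<in>F. f c \<noteq> 0) \<and> (\<forall>f\<in>{}. f c > (0::real))"
  proof (rule exists_generic_point)
    show "finite F" unfolding F_def using assms by (auto intro!: finite_imageI finite_SigmaI finite_bases)
    fix f assume "f \<in> F"
    then obtain B g where f: "f = (\<lambda>c. basis_cost c B g - c g)" "B \<in> bases G" "g \<in> G - B"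
      by (auto simp: F_def)
    have "linear f" unfolding f(1) basis_cost_def
      by (rule linear_funI) (simp_all add: sum.distrib sum_distrib_left algebra_simps)
    moreover have "f (\<lambda>h. of_bool (h = g)) = - 1"
      using f by (auto simp: basis_cost_def intro!: sum.neutral)
    ultimately show "linear f \<and> (\<exists>v. f v \<noteq> 0)"
      by (intro conjI exI[of _ "\<lambda>h. of_bool (h = g)"]) auto
  qed auto
  then obtain c where "\<forall>f\<in>F. f c \<noteq> 0" by blast
  then show ?thesis unfolding F_def by (intro exI[of _ c]) force
qed

text \<open>Genericity is arranged in the space of coefficients \<open>l\<close>, where positivity
  is an open condition satisfied by the constant 1.\<close>

lemma exists_generic_interior:
  fixes G :: "'a::real_vector set"
  assumes "finite G"
  shows "\<exists>w l. w = (\<Sum>g\<in>G. l g *\<^sub>R g) \<and> (\<forall>g\<in>G. 0 < l g) \<and>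
    (\<forall>B\<in>bases G. \<forall>b\<in>B. representation B w b \<noteq> 0)"
proof -
  define F where "F = (\<lambda>(B, b) l. \<Sum>g\<in>G. l g * representation B g b) ` Sigma (bases G) (\<lambda>B. B)"
  define P where "P = (\<lambda>g l. l g :: real) ` G"
  have "\<exists>l. (\<forall>f\<in>F. f l \<noteq> 0) \<and> (\<forall>f\<in>P. f l > 0)"
  proof (rule exists_generic_point[where ?w0.0 = "\<lambda>_. 1"])
    show "finite F" "finite P" unfolding F_def P_def
      using assms basesD(3)[OF assms] by (auto intro!: finite_imageI finite_SigmaI finite_bases)
    fix f assume "f \<in> F"
    then obtain B b where f: "f = (\<lambda>l. \<Sum>g\<in>G. l g * representation B g b)" "B \<in> bases G" "b \<in> B"
      by (auto simp: F_def)
    have B: "B \<subseteq> G" "independent B" using f by (auto simp: bases_def)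
    have "linear f" unfolding f(1)
      by (rule linear_funI) (simp_all add: sum.distrib sum_distrib_left algebra_simps)
    moreover have "f (\<lambda>h. of_bool (h = b)) = (\<Sum>g\<in>G. if g = b then 1 else 0)"
      unfolding f(1) using B f(3) by (intro sum.cong) (auto simp: representation_basis)
    then have "f (\<lambda>h. of_bool (h = b)) = 1" using assms B f(3) by auto
    ultimately show "linear f \<and> (\<exists>v. f v \<noteq> 0)"
      by (intro conjI exI[of _ "\<lambda>h. of_bool (h = b)"]) auto
  next
    fix f assume "f \<in> P"
    then show "linear f \<and> f (\<lambda>_. 1) > 0"
      by (auto simp: P_def intro!: linear_funI)
  qed
  then obtain l where l: "\<forall>f\<in>F. f l \<noteq> 0" "\<forall>f\<in>P. f l > 0" by blast
  have "representation B (\<Sum>g\<in>G. l g *\<^sub>R g) b \<noteq> 0" if B: "B \<in> bases G" "b \<in> B" for B b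
  proof -
    have "representation B (\<Sum>g\<in>G. l g *\<^sub>R g) b = (\<Sum>g\<in>G. l g * representation B g b)"
      using basesD[OF assms B(1)]
      by (subst representation_sum) (auto simp: representation_scale span_base span_scale)
    then show ?thesis using l(1) B by (force simp: F_def)
  qed
  moreover have "\<forall>g\<in>G. 0 < l g" using l(2) by (auto simp: P_def)
  ultimately show ?thesis by blast
qed

lemma basis_cost_add:
  assumes "independent B" "x \<in> span B" "y \<in> span B"
  shows "basis_cost c B (x + y) = basis_cost c B x + basis_cost c B y"
  using assms by (simp add: basis_cost_def representation_add sum.distrib algebra_simps)

lemma basis_cost_scaleR:
  assumes "independent B" "x \<in> span B"
  shows "basis_cost c B (s *\<^sub>R x) = s * basis_cost c B x"
  using assms by (simp add: basis_cost_def representation_scale algebra_simps sum_distrib_left)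

lemma basis_cost_sum:
  assumes "independent B" "\<And>i. i \<in> I \<Longrightarrow> f i \<in> span B"
  shows "basis_cost c B (\<Sum>i\<in>I. s i *\<^sub>R f i) = (\<Sum>i\<in>I. s i * basis_cost c B (f i))"
  using assms
proof (induction I rule: infinite_finite_induct)
  case (insert i I)
  then show ?case by (simp add: basis_cost_add basis_cost_scaleR span_sum span_scale)
qed (auto simp: basis_cost_def representation_zero)

lemma basis_cost_base:
  assumes "independent B" "finite B" "b \<in> B"
  shows "basis_cost c B b = c b"
proof -
  have "basis_cost c B b = (\<Sum>i\<in>B. if i = b then c b else 0)"
    unfolding basis_cost_def using assms by (intro sum.cong) (auto simp: representation_basis)
  then show ?thesis using assms by simp
qed

text \<open>Complementary slackness.\<close>

lemma dual_feasible_unique: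
  assumes "finite G" and df: "dual_feasible c G B" "dual_feasible c G B'" and x: "x \<in> span G"
    and pos: "\<And>b. b \<in> B \<Longrightarrow> 0 < representation B x b" "\<And>b. b \<in> B' \<Longrightarrow> 0 < representation B' x b"
  shows "B = B'"
proof -
  \<comment> \<open>Weak duality: the functional of a dual feasible basis is at most
    \<open>c\<close> on \<open>G\<close>, hence at most the cost of a positive representation of
    \<open>x\<close>, and strictly less if a generator outside \<open>B\<close> occurs. Applied in
    both directions it gives equal costs and therefore both inclusions.\<close>
  have step: "basis_cost c B x \<le> basis_cost c B' x \<and> (\<not> B' \<subseteq> B \<longrightarrow> basis_cost c B x < basis_cost c B' x)"
    if df: "dual_feasible c G B" "dual_feasible c G B'"
      and pos: "\<And>b. b \<in> B' \<Longrightarrow> 0 < representation B' x b" for B B'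
  proof -
    have B: "B \<subseteq> G" "independent B" "finite B" "span B = span G"
      using df(1) basesD[OF assms(1), of B] by (auto simp: dual_feasible_def)
    have B': "B' \<subseteq> G" "independent B'" "finite B'" "span B' = span G"
      using df(2) basesD[OF assms(1), of B'] by (auto simp: dual_feasible_def)
    have le: "basis_cost c B g \<le> c g" if "g \<in> G" for g
      using df(1) basis_cost_base[OF B(2,3), of g c] that by (cases "g \<in> B") (auto simp: dual_feasible_def less_imp_le)
    have "basis_cost c B x = basis_cost c B (\<Sum>b\<in>B'. representation B' x b *\<^sub>R b)"
      using sum_representation_eq[OF B'(2) _ B'(3), of x] x B' by auto
    also have "\<dots> = (\<Sum>b\<in>B'. representation B' x b * basis_cost c B b)"
      using B B' by (intro basis_cost_sum) (auto intro: span_base)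
    finally have eq: "basis_cost c B x = \<dots>" .
    have term_le: "representation B' x b * basis_cost c B b \<le> representation B' x b * c b" if "b \<in> B'" for b
      using le[of b] pos[OF that] that B' by (intro mult_left_mono) auto
    have "basis_cost c B x \<le> basis_cost c B' x"
      unfolding eq basis_cost_def[of c B' x] by (intro sum_mono term_le)
    moreover have "basis_cost c B x < basis_cost c B' x" if ex: "\<not> B' \<subseteq> B"
    proof -
      obtain b where b: "b \<in> B'" "b \<notin> B" using ex by blast
      then have "basis_cost c B b < c b" using df(1) B' by (auto simp: dual_feasible_def)
      then show ?thesis
        unfolding eq basis_cost_def[of c B' x] using B' b pos term_le
        by (intro sum_strict_mono_ex1) (auto intro!: bexI[of _ b] mult_strict_left_mono)
    qed
    ultimately show ?thesis by blast
  qed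
  from step[OF df pos(2)] step[OF df(2,1) pos(1)] show ?thesis by fastforce
qed

text \<open>A feasible basis of minimal cost is dual feasible, since otherwise a pivot step would
  decrease the cost.\<close>

lemma dual_feasible_exists:
  fixes ht :: "'a::real_vector \<Rightarrow> real"
  assumes "finite G" and ht: "linear ht" "\<And>g. g \<in> G \<Longrightarrow> 0 < ht g"
    and c: "\<And>B g. B \<in> bases G \<Longrightarrow> g \<in> G - B \<Longrightarrow> basis_cost c B g \<noteq> c g"
    and x: "x \<in> fcone G" and gen: "\<And>B b. B \<in> bases G \<Longrightarrow> b \<in> B \<Longrightarrow> representation B x b \<noteq> 0"
  shows "\<exists>B. dual_feasible c G B \<and> x \<in> fcone B"
proof -
  have xs: "x \<in> span G" using x fcone_subset_span by blast
  define Q where "Q = {B \<in> bases G. x \<in> fcone B}"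
  have "Q \<noteq> {}"
  proof -
    obtain S where S: "S \<subseteq> G" "independent S" "x \<in> fcone S"
      using caratheodory_fcone[OF assms(1) x] .
    obtain B where B: "S \<subseteq> B" "B \<subseteq> G" "independent B" "G \<subseteq> span B"
      using maximal_independent_subset_extend[OF S(1,2)] .
    then have "x \<in> fcone B" using S fcone_mono[of B S] assms(1) finite_subset[of B G] by blast
    with B show ?thesis by (auto simp: Q_def bases_def)
  qed
  moreover have "finite Q" unfolding Q_def using finite_bases[OF assms(1)] by simp
  ultimately obtain B where B: "B \<in> Q" "\<And>B'. B' \<in> Q \<Longrightarrow> basis_cost c B x \<le> basis_cost c B' x"
    using arg_min_if_finite[of Q "\<lambda>B. basis_cost c B x"] by (metis not_less)
  have Bb: "B \<in> bases G" "x \<in> fcone B" using B by (auto simp: Q_def)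
  note BB = basesD[OF assms(1) Bb(1)]
  have pos: "0 < representation B x b" if "b \<in> B" for b
    using fcone_independent_iff[OF BB(2,3), of x] Bb(2) xs BB(4) gen[OF Bb(1) that] that by force
  have "basis_cost c B g < c g" if g: "g \<in> G - B" for g
  proof (rule ccontr)
    assume "\<not> basis_cost c B g < c g"
    then have gt: "c g < basis_cost c B g" using c[OF Bb(1) g] by simp
    have gs: "g \<in> span B" using g BB by (auto intro: span_base)
    have geq: "g = (\<Sum>b\<in>B. representation B g b *\<^sub>R b)"
      using sum_representation_eq[OF BB(2) gs BB(3)] by (rule sym) simp
    define T where "T = {b \<in> B. 0 < representation B g b}"
    \<comment> \<open>The height excludes an unbounded pivot: without a positive coordinate,
      \<open>ht g\<close> would not be positive.\<close>
    have "T \<noteq> {}"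
    proof
      assume "T = {}"
      then have "(\<Sum>b\<in>B. representation B g b * ht b) \<le> 0"
        using BB ht(2) by (intro sum_nonpos mult_nonpos_nonneg) (force simp: T_def)+
      moreover have "ht g = (\<Sum>b\<in>B. representation B g b * ht b)"
        using arg_cong[OF geq, of ht] by (simp only: linear_sum[OF ht(1)] linear_cmul[OF ht(1)] real_scaleR_def)
      ultimately show False using ht(2) g by force
    qed
    have finT: "finite T" using BB by (simp add: T_def)
    \<comment> \<open>The ratio test: \<open>t\<close> is the largest amount of \<open>g\<close>
      that can enter before a coefficient of \<open>B\<close> becomes negative. It is positive
      because no coordinate of the generic point \<open>x\<close> vanishes.\<close>
    define t where "t = Min ((\<lambda>b. representation B x b / representation B g b) ` T)"
    have "t \<in> (\<lambda>b. representation B x b / representation B g b) ` T"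
      unfolding t_def using finT \<open>T \<noteq> {}\<close> by (intro Min_in) auto
    then obtain h where h: "h \<in> T" "t = representation B x h / representation B g h" by blast
    have hB: "h \<in> B" "0 < representation B g h" using h by (auto simp: T_def)
    have tle: "t \<le> representation B x b / representation B g b" if "b \<in> T" for b
      unfolding t_def using finT that by (intro Min_le) auto
    have t0: "0 < t" using h pos hB by auto
    define B' where "B' = insert g (B - {h})"
    define s where "s b = (if b = g then t else representation B x b - t * representation B g b)" for b
    have fB': "finite B'" "g \<notin> B" using BB g by (auto simp: B'_def)
    have s0: "0 \<le> s b" if "b \<in> B'" for b
    proof (cases "b = g \<or> b \<in> T")
      case True
      then show ?thesis using t0 tle[of b] by (auto simp: s_def T_def field_simps)
    next
      case False
      then have "t * representation B g b \<le> 0" using that t0 by (auto simp: T_def B'_def mult_nonneg_nonpos)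
      moreover have "0 < representation B x b" using that False pos by (auto simp: B'_def)
      ultimately show ?thesis using False by (auto simp: s_def)
    qed
    \<comment> \<open>The summand is kept general because both the vector \<open>x\<close> and its
      cost are summed over the new basis.\<close>
    have sumB': "(\<Sum>b\<in>B'. f b (s b)) = f g t + (\<Sum>b\<in>B. f b (representation B x b - t * representation B g b))"
      if "f h 0 = 0" for f :: "'a \<Rightarrow> real \<Rightarrow> 'c::comm_monoid_add"
    proof -
      have "(\<Sum>b\<in>B'. f b (s b)) = f g t + (\<Sum>b\<in>B - {h}. f b (s b))"
        using fB' BB by (simp add: B'_def s_def)
      also have "(\<Sum>b\<in>B - {h}. f b (s b)) = (\<Sum>b\<in>B - {h}. f b (representation B x b - t * representation B g b))"
        using fB' by (intro sum.cong) (auto simp: s_def)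
      also have "\<dots> = (\<Sum>b\<in>B. f b (representation B x b - t * representation B g b))"
        using BB(3) hB h(2) that by (subst sum.remove[of B h]) auto
      finally show ?thesis .
    qed
    have xeq: "x = (\<Sum>b\<in>B'. s b *\<^sub>R b)"
    proof -
      have "(\<Sum>b\<in>B'. s b *\<^sub>R b) = t *\<^sub>R g + ((\<Sum>b\<in>B. representation B x b *\<^sub>R b) - t *\<^sub>R (\<Sum>b\<in>B. representation B g b *\<^sub>R b))"
        by (subst sumB') (simp_all add: scaleR_diff_left sum_subtractf scaleR_sum_right)
      then show ?thesis using geq[symmetric] sum_representation_eq[OF BB(2) _ BB(3), of x] xs BB(4) by simp
    qed
    have hspan: "h \<in> span B'"
    proof -
      have "g = representation B g h *\<^sub>R h + (\<Sum>b\<in>B - {h}. representation B g b *\<^sub>R b)"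
        by (rule trans[OF geq sum.remove[OF BB(3) hB(1)]])
      then have "representation B g h *\<^sub>R h = g - (\<Sum>b\<in>B - {h}. representation B g b *\<^sub>R b)"
        by (simp only: eq_diff_eq)
      moreover have "\<dots> \<in> span B'"
        unfolding B'_def by (intro span_diff span_sum span_scale span_base) auto
      ultimately have "(1 / representation B g h) *\<^sub>R (representation B g h *\<^sub>R h) \<in> span B'"
        using span_scale[of _ B' "1 / representation B g h"] by simp
      then show ?thesis using hB by simp
    qed
    have Bspan: "B \<subseteq> span B'" using hspan by (auto simp: B'_def intro: span_base)
    then have span': "G \<subseteq> span B'"
      using BB(4) span_minimal[of B "span B'"] by (auto simp: span_base)
    have "independent B'"
    proof
      assume "dependent B'"
      then obtain b where b: "b \<in> B'" "b \<in> span (B' - {b})" by (auto simp: dependent_def)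
      then have "B' \<subseteq> span (B' - {b})" by (auto intro: span_base)
      then have "span B' \<subseteq> span (B' - {b})" by (intro span_minimal) auto
      then have "B \<subseteq> span (B' - {b})" using Bspan by blast
      moreover have "finite (B' - {b})" using fB' by simp
      ultimately have "card B \<le> card (B' - {b})"
        using independent_span_bound[of "B' - {b}" B] BB(2) by auto
      moreover have "card B' = card B"
        using card.remove[OF BB(3) hB(1)] BB(3) fB'(2) by (simp add: B'_def)
      moreover have "card (B' - {b}) < card B'" using b fB' by (intro card_Diff1_less) auto
      ultimately show False by linarith
    qed
    then have B'b: "B' \<in> bases G" using span' g BB by (auto simp: bases_def B'_def)
    have xB': "x \<in> fcone B'" unfolding fcone_def using xeq s0 by blast
    have "representation B' x b = s b" if "b \<in> B'" for b
    proof -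
      have "representation B' x b = (\<Sum>i\<in>B'. s i * representation B' i b)"
        using \<open>independent B'\<close> by (subst xeq) (simp add: representation_sum representation_scale span_base span_scale)
      also have "\<dots> = (\<Sum>i\<in>B'. if i = b then s b else 0)"
        using \<open>independent B'\<close> by (intro sum.cong) (auto simp: representation_basis)
      also have "\<dots> = s b" using fB' that by simp
      finally show ?thesis .
    qed
    then have "basis_cost c B' x = (\<Sum>b\<in>B'. s b * c b)" by (simp add: basis_cost_def)
    also have "\<dots> = t * c g + (basis_cost c B x - t * basis_cost c B g)"
      by (subst sumB') (simp_all add: basis_cost_def sum_subtractf left_diff_distrib sum_distrib_left mult.assoc)
    also have "\<dots> < basis_cost c B x" using gt t0 by simp
    finally show False using B(2)[of B'] B'b xB' by (simp add: Q_def)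
  qed
  then show ?thesis using Bb by (auto simp: dual_feasible_def)
qed

text \<open>If \<open>w\<close> has no zero coordinate, these are the points \<open>x\<close> such that \<open>x + e w\<close> lies in the cone of
  \<open>B\<close> for all small \<open>e > 0\<close>.\<close>

definition half_open :: "'a::real_vector \<Rightarrow> 'a set \<Rightarrow> 'a set" where
  "half_open w B = {x \<in> span B. \<forall>b\<in>B. 0 < representation B x b \<or>
     representation B x b = 0 \<and> 0 < representation B w b}"

text \<open>As \<open>w\<close> has no zero coordinate in any basis, \<open>x + e w\<close> is
  generic for all small e > 0. It then lies in the cone of exactly one dual feasible basis, by
  existence and uniqueness of the optimum. Assigning \<open>x\<close> to that basis resolves the
  overlaps along common faces.\<close>

lemma half_open_decomposition:
  fixes ht :: "'a::real_vector \<Rightarrow> real"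
  assumes "finite G" and ht: "linear ht" "\<And>g. g \<in> G \<Longrightarrow> 0 < ht g"
    and c: "\<And>B g. B \<in> bases G \<Longrightarrow> g \<in> G - B \<Longrightarrow> basis_cost c B g \<noteq> c g"
    and w: "w \<in> span G" "\<And>B b. B \<in> bases G \<Longrightarrow> b \<in> B \<Longrightarrow> representation B w b \<noteq> 0"
  shows "{x \<in> span G. \<forall>\<^sub>F e in at_right 0. x + e *\<^sub>R w \<in> fcone G} =
      (\<Union>B\<in>{B. dual_feasible c G B}. half_open w B)" (is "?L = ?R")
    and "disjoint_family_on (half_open w) {B. dual_feasible c G B}"
proof -
  let ?D = "{B. dual_feasible c G B}"
  have finD: "finite ?D"
    by (rule finite_subset[OF _ finite_bases[OF assms(1)]]) (auto simp: dual_feasible_def)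
  have rep: "representation B (x + e *\<^sub>R w) b = representation B x b + e * representation B w b"
    if "B \<in> bases G" "x \<in> span G" for B x b e
    using basesD[OF assms(1) that(1)] that w(1)
    by (simp add: representation_add representation_scale span_scale)
  have evnz: "\<forall>\<^sub>F e in at_right 0. \<forall>B\<in>bases G. \<forall>b\<in>B. representation B (x + e *\<^sub>R w) b \<noteq> 0" if x: "x \<in> span G" for x
  proof (intro eventually_ball_finite ballI finite_bases assms(1))
    fix B assume B: "B \<in> bases G"
    show "finite B" using basesD[OF assms(1) B] by simp
    fix b assume b: "b \<in> B"
    have "(representation B x b > 0 \<or> representation B x b = 0 \<and> representation B w b > 0) \<or>
        (representation B x b < 0 \<or> representation B x b = 0 \<and> representation B w b < 0)"
      using w(2)[OF B b] by linarith
    then show "\<forall>\<^sub>F e in at_right 0. representation B (x + e *\<^sub>R w) b \<noteq> 0"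
      using eventually_at_right_affine_pos[of "representation B x b" "representation B w b"]
        eventually_at_right_affine_neg[of "representation B x b" "representation B w b"]
      by (auto simp: rep[OF B x] elim!: eventually_mono)
  qed
  have evin: "\<forall>\<^sub>F e in at_right 0. \<forall>b\<in>B. 0 < representation B (x + e *\<^sub>R w) b"
    if xB: "x \<in> half_open w B" "B \<in> bases G" for x B
  proof (intro eventually_ball_finite ballI)
    show "finite B" using basesD[OF assms(1)] xB by simp
    fix b assume "b \<in> B"
    then show "\<forall>\<^sub>F e in at_right 0. 0 < representation B (x + e *\<^sub>R w) b"
      using xB basesD[OF assms(1) xB(2)] by (auto simp: half_open_def rep eventually_at_right_affine_pos)
  qed
  have evout: "\<forall>\<^sub>F e in at_right 0. \<exists>b\<in>B. representation B (x + e *\<^sub>R w) b < 0"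
    if xB: "x \<notin> half_open w B" "B \<in> bases G" "x \<in> span G" for x B
  proof -
    obtain b where b: "b \<in> B" "\<not> (0 < representation B x b \<or> representation B x b = 0 \<and> 0 < representation B w b)"
      using xB basesD[OF assms(1) xB(2)] by (auto simp: half_open_def)
    then have "representation B x b < 0 \<or> representation B x b = 0 \<and> representation B w b < 0"
      using w(2)[OF xB(2) b(1)] by linarith
    then have "\<forall>\<^sub>F e in at_right 0. representation B (x + e *\<^sub>R w) b < 0"
      by (simp add: rep[OF xB(2,3)] eventually_at_right_affine_neg)
    then show ?thesis by eventually_elim (use b in blast)
  qed
  have xw: "x + e *\<^sub>R w \<in> span G" if "x \<in> span G" for x e
    using that w(1) by (simp add: span_add span_scale)
  show "?L = ?R"
  proof (intro equalityI subsetI)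
    fix x assume x: "x \<in> ?L"
    show "x \<in> ?R"
    proof (rule ccontr)
      assume nx: "x \<notin> ?R"
      have xs: "x \<in> span G" and ev1: "\<forall>\<^sub>F e in at_right 0. x + e *\<^sub>R w \<in> fcone G"
        using x by simp_all
      have "\<forall>\<^sub>F e in at_right 0. \<exists>b\<in>B. representation B (x + e *\<^sub>R w) b < 0" if "B \<in> ?D" for B
        using that nx by (intro evout xs) (auto simp: dual_feasible_def)
      then have "\<forall>\<^sub>F e in at_right 0. \<forall>B\<in>?D. \<exists>b\<in>B. representation B (x + e *\<^sub>R w) b < 0"
        by (intro eventually_ball_finite[OF finD]) blast
      from eventually_happens'[OF trivial_limit_at_right_real
          eventually_conj[OF ev1 eventually_conj[OF evnz[OF xs] this]]]
      obtain e where e: "x + e *\<^sub>R w \<in> fcone G"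
          "\<And>B b. B \<in> bases G \<Longrightarrow> b \<in> B \<Longrightarrow> representation B (x + e *\<^sub>R w) b \<noteq> 0"
          "\<And>B. B \<in> ?D \<Longrightarrow> \<exists>b\<in>B. representation B (x + e *\<^sub>R w) b < 0"
        by auto
      obtain B where B: "dual_feasible c G B" "x + e *\<^sub>R w \<in> fcone B"
        using dual_feasible_exists[OF assms(1) ht c e(1,2)] by blast
      have "B \<in> bases G" using B by (simp add: dual_feasible_def)
      note BB = basesD[OF assms(1) this]
      have "\<forall>b\<in>B. 0 \<le> representation B (x + e *\<^sub>R w) b"
        using fcone_independent_iff[OF BB(2,3)] B(2) xw x BB(4) by auto
      then show False using e(3)[of B] B(1) by force
    qed
  next
    fix x assume "x \<in> ?R"
    then obtain B where B: "dual_feasible c G B" "x \<in> half_open w B" by blast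
    have Bb: "B \<in> bases G" using B by (simp add: dual_feasible_def)
    note BB = basesD[OF assms(1) Bb]
    have x: "x \<in> span G" using B BB by (auto simp: half_open_def)
    have "\<forall>\<^sub>F e in at_right 0. x + e *\<^sub>R w \<in> fcone G"
      using evin[OF B(2) Bb]
    proof eventually_elim
      case (elim e)
      then have "x + e *\<^sub>R w \<in> fcone B"
        using fcone_independent_iff[OF BB(2,3)] xw[OF x] BB(4) by (auto intro: less_imp_le)
      then show ?case using fcone_mono[OF assms(1) BB(1)] by blast
    qed
    with x show "x \<in> ?L" by simp
  qed
  show "disjoint_family_on (half_open w) ?D"
  proof (unfold disjoint_family_on_def, intro ballI impI)
    fix B B' assume B: "B \<in> ?D" "B' \<in> ?D" "B \<noteq> B'"
    have Bb: "B \<in> bases G" "B' \<in> bases G" using B by (simp_all add: dual_feasible_def)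
    show "half_open w B \<inter> half_open w B' = {}"
    proof (rule ccontr)
      assume "half_open w B \<inter> half_open w B' \<noteq> {}"
      then obtain x where x: "x \<in> half_open w B" "x \<in> half_open w B'" by blast
      then have xs: "x \<in> span G" using basesD[OF assms(1) Bb(1)] by (auto simp: half_open_def)
      from eventually_happens'[OF trivial_limit_at_right_real
          eventually_conj[OF evin[OF x(1) Bb(1)] evin[OF x(2) Bb(2)]]]
      obtain e where "\<forall>b\<in>B. 0 < representation B (x + e *\<^sub>R w) b"
          "\<forall>b\<in>B'. 0 < representation B' (x + e *\<^sub>R w) b" by auto
      then have "B = B'" using B by (intro dual_feasible_unique[OF assms(1) _ _ xw[OF xs]]) auto
      with B show False by simp
    qed
  qed
qed

subsection \<open>Hilbert series\<close>

text \<open>An infinite level set would count as 0, so finiteness of the level sets is assumed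
  separately wherever counts are added.\<close>

definition hilbert :: "('a \<Rightarrow> real) \<Rightarrow> 'a set \<Rightarrow> real fps" where
  "hilbert ht X = Abs_fps (\<lambda>V. real (card {x \<in> X. ht x = real V}))"

lemma poly_of_finite_fps:
  fixes f :: "'a::comm_ring_1 fps"
  assumes "\<And>n. N < n \<Longrightarrow> fps_nth f n = 0"
  obtains h where "fps_of_poly h = f" "degree h \<le> N"
proof -
  define h where "h = Poly (map (fps_nth f) [0..<Suc N])"
  have c: "coeff h n = fps_nth f n" for n
    using assms[of n] by (cases "n \<le> N") (auto simp: h_def nth_default_def simp del: upt_Suc)
  have "fps_of_poly h = f" by (rule fps_ext) (simp add: c)
  moreover have "degree h \<le> N" by (rule degree_le) (simp add: c assms)
  ultimately show ?thesis by (rule that)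
qed

text \<open>All generators have height \<open>\<mu>\<close>, so multiplying the series by 1 -
  X^\<mu> removes the points that stay in the set when one fixed generator is subtracted. After all
  of \<open>B\<close> has been used, the lattice points of the half-open fundamental parallelepiped
  are left. The numerator counts these by height, which explains its sign and its degree.\<close>

lemma hilbert_half_open:
  fixes ht :: "'a::real_vector \<Rightarrow> real"
  assumes B: "independent B" "finite B" and ht: "linear ht" "\<And>b. b \<in> B \<Longrightarrow> ht b = real \<mu>" and "0 < \<mu>"
    and \<Lambda>: "B \<subseteq> \<Lambda>" "\<And>x y. x \<in> \<Lambda> \<Longrightarrow> y \<in> \<Lambda> \<Longrightarrow> x + y \<in> \<Lambda>" "\<And>x y. x \<in> \<Lambda> \<Longrightarrow> y \<in> \<Lambda> \<Longrightarrow> x - y \<in> \<Lambda>"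
    and fin: "\<And>V::nat. finite {x \<in> \<Lambda> \<inter> fcone B. ht x = real V}"
    and w: "w \<in> span B"
  shows "\<exists>h. fps_of_poly h = hilbert ht (\<Lambda> \<inter> half_open w B) * (1 - fps_X ^ \<mu>) ^ card B \<and>
    (\<forall>i. 0 \<le> coeff h i) \<and> degree h \<le> \<mu> * card B \<and> (0 < ht w \<longrightarrow> degree h < \<mu> * card B)"
proof -
  define pos where "pos b x \<longleftrightarrow> 0 < representation B x b \<or> representation B x b = 0 \<and> 0 < representation B w b" for b x
  \<comment> \<open>From the points of \<open>X T\<close> no generator in \<open>T\<close> can be
    subtracted without leaving the half-open cone. Thus \<open>X {}\<close> consists of the lattice
    points of that cone, and \<open>X B\<close> of those of the parallelepiped.\<close>
  define X where "X T = {x \<in> \<Lambda> \<inter> span B. (\<forall>b\<in>B. pos b x) \<and> (\<forall>b\<in>T. \<not> pos b (x - b))}" for T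
  have hteq: "ht x = (\<Sum>b\<in>B. representation B x b * real \<mu>)" if "x \<in> span B" for x
  proof -
    have "ht x = ht (\<Sum>b\<in>B. representation B x b *\<^sub>R b)"
      using sum_representation_eq[OF B(1) that B(2)] by simp
    then show ?thesis by (simp add: linear_sum[OF ht(1)] linear_cmul[OF ht(1)] ht(2))
  qed
  have pos_ge: "0 \<le> representation B x b" if "pos b x" for b x using that by (auto simp: pos_def)
  have X_ge: "0 \<le> representation B x b" if "x \<in> X T" "b \<in> B" for x b T
    using that pos_ge[of b x] by (simp add: X_def)
  have finX: "finite {x \<in> X T. ht x = real V}" for T V
    by (rule finite_subset[OF _ fin[of V]])
      (use X_ge[of _ T] in \<open>auto simp: fcone_independent_iff[OF B] X_def\<close>)
  have htX: "0 \<le> ht x" if "x \<in> X T" for x T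
    using that X_ge[OF that] hteq[of x] by (auto simp: X_def intro!: sum_nonneg)
  have repb: "representation B (x - b') b = representation B x b - of_bool (b = b')"
    "representation B (x + b') b = representation B x b + of_bool (b = b')"
    if "b' \<in> B" "x \<in> span B" for x b b'
    using that B(1) by (auto simp: representation_diff representation_add span_base representation_basis)
  have step: "hilbert ht (X T) * (1 - fps_X ^ \<mu>) = hilbert ht (X (insert b0 T))"
    if b0: "b0 \<in> B" "b0 \<notin> T" and T: "T \<subseteq> B" for T b0
  proof -
    \<comment> \<open>Split by whether \<open>b0\<close> can be subtracted. Subtraction changes the
      coordinate at \<open>b0\<close> only, so the conditions for the generators in \<open>T\<close>
      persist.\<close>
    have split: "X T = X (insert b0 T) \<union> (\<lambda>y. b0 + y) ` X T"
    proof (intro equalityI subsetI)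
      fix x assume x: "x \<in> X T"
      show "x \<in> X (insert b0 T) \<union> (\<lambda>y. b0 + y) ` X T"
      proof (cases "pos b0 (x - b0)")
        case True
        have "x - b0 \<in> X T"
        proof -
          have xs: "x \<in> span B" using x by (simp add: X_def)
          have "x - b0 \<in> \<Lambda> \<inter> span B" using x b0 \<Lambda> by (auto simp: X_def intro: span_diff span_base)
          moreover have "pos b (x - b0)" if "b \<in> B" for b
            using True x that b0 repb(1)[OF b0(1) xs] by (cases "b = b0") (auto simp: X_def pos_def)
          moreover have "\<not> pos b (x - b0 - b)" if "b \<in> T" for b
          proof -
            have bB: "b \<in> B" "b \<noteq> b0" using that b0 T by auto
            have "representation B (x - b0 - b) b = representation B (x - b) b"
              using repb(1)[OF bB(1), of "x - b0" b] repb(1)[OF b0(1) xs, of b] repb(1)[OF bB(1) xs, of b] bB b0 xs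
              by (simp add: span_diff span_base)
            moreover have "\<not> pos b (x - b)" using x that by (simp add: X_def)
            ultimately show ?thesis by (simp add: pos_def)
          qed
          ultimately show ?thesis by (simp add: X_def)
        qed
        then show ?thesis by (auto intro!: image_eqI[of _ _ "x - b0"])
      next
        case False
        with x show ?thesis by (simp add: X_def)
      qed
    next
      fix x assume "x \<in> X (insert b0 T) \<union> (\<lambda>y. b0 + y) ` X T"
      then show "x \<in> X T"
      proof
        assume "x \<in> (\<lambda>y. b0 + y) ` X T"
        then obtain y where y: "y \<in> X T" "x = b0 + y" by blast
        then have ys: "y \<in> span B" by (simp add: X_def)
        have "b0 + y \<in> \<Lambda> \<inter> span B" using y b0 \<Lambda> by (auto simp: X_def intro: span_add span_base)
        moreover have "pos b (b0 + y)" if "b \<in> B" for b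
          using y that repb(2)[OF b0(1) ys, of b] by (auto simp: X_def pos_def add.commute[of b0])
        moreover have "\<not> pos b (b0 + y - b)" if "b \<in> T" for b
        proof -
          have bB: "b \<in> B" "b \<noteq> b0" using that b0 T by auto
          have "representation B (b0 + y - b) b = representation B (y - b) b"
            using repb(1)[OF bB(1), of "y + b0" b] repb(2)[OF b0(1) ys, of b] repb(1)[OF bB(1) ys, of b] bB b0 ys
            by (simp add: span_add span_base add.commute[of b0])
          moreover have "\<not> pos b (y - b)" using y that by (simp add: X_def)
          ultimately show ?thesis by (simp add: pos_def)
        qed
        ultimately show ?thesis by (simp add: X_def y)
      qed (auto simp: X_def)
    qed
    have disj: "X (insert b0 T) \<inter> (\<lambda>y. b0 + y) ` X T = {}"
      using b0 by (auto simp: X_def)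
    have cnt: "card {x \<in> X T. ht x = real V} = card {x \<in> X (insert b0 T). ht x = real V} +
        (if V < \<mu> then 0 else card {x \<in> X T. ht x = real (V - \<mu>)})" for V
    proof -
      let ?I = "{x \<in> (\<lambda>y. b0 + y) ` X T. ht x = real V}"
      have "{x \<in> X T. ht x = real V} = {x \<in> X (insert b0 T). ht x = real V} \<union> ?I"
        using split by blast
      moreover have "finite ?I" by (rule finite_subset[OF _ finX[of T V]]) (use split in blast)
      ultimately have "card {x \<in> X T. ht x = real V} = card {x \<in> X (insert b0 T). ht x = real V} + card ?I"
        using disj finX by (simp only:) (intro card_Un_disjoint, auto)
      moreover have hb: "ht (b0 + y) = real \<mu> + ht y" for y
        using linear_add[OF ht(1)] ht(2)[OF b0(1)] by simp
      have "card ?I = (if V < \<mu> then 0 else card {x \<in> X T. ht x = real (V - \<mu>)})"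
      proof (cases "V < \<mu>")
        case True
        then have "?I = {}" using htX by (force simp: hb)
        with True show ?thesis by (simp only: card.empty if_True)
      next
        case False
        then have "?I = (\<lambda>y. b0 + y) ` {x \<in> X T. ht x = real (V - \<mu>)}"
          by (auto simp: hb of_nat_diff)
        with False show ?thesis by (simp add: card_image)
      qed
      ultimately show ?thesis by simp
    qed
    show ?thesis
    proof (rule fps_ext)
      fix V
      show "fps_nth (hilbert ht (X T) * (1 - fps_X ^ \<mu>)) V = fps_nth (hilbert ht (X (insert b0 T))) V"
        using cnt[of V] by (simp add: right_diff_distrib hilbert_def fps_X_power_mult_right_nth)
    qed
  qed
  have main: "hilbert ht (X {}) * (1 - fps_X ^ \<mu>) ^ card T = hilbert ht (X T)" if "T \<subseteq> B" for T
    using finite_subset[OF that B(2)] that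
  proof (induction T rule: finite_induct)
    case (insert b T)
    have "hilbert ht (X {}) * (1 - fps_X ^ \<mu>) ^ card (insert b T) =
        hilbert ht (X {}) * (1 - fps_X ^ \<mu>) ^ card T * (1 - fps_X ^ \<mu>)"
      using insert by (simp add: mult_ac)
    also have "\<dots> = hilbert ht (X T) * (1 - fps_X ^ \<mu>)" using insert by simp
    also have "\<dots> = hilbert ht (X (insert b T))" using insert by (intro step) auto
    finally show ?case .
  qed simp
  have X0: "X {} = \<Lambda> \<inter> half_open w B" by (auto simp: X_def half_open_def pos_def)
  \<comment> \<open>Coordinates in the parallelepiped are at most 1, and less than 1 where
    \<open>w\<close> has a positive coordinate. If \<open>w\<close> has positive height, such a
    coordinate exists.\<close>
  have bound: "ht x \<le> real \<mu> * card B \<and> (0 < ht w \<longrightarrow> ht x < real \<mu> * card B)" if "x \<in> X B" for x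
  proof -
    have xs: "x \<in> span B" using that by (simp add: X_def)
    have le: "representation B x b \<le> 1 \<and> (0 < representation B w b \<longrightarrow> representation B x b < 1)" if "b \<in> B" for b
      using \<open>x \<in> X B\<close> that repb(1)[OF that xs, of b] by (auto simp: X_def pos_def)
    have "ht x \<le> (\<Sum>b\<in>B. 1 * real \<mu>)"
      unfolding hteq[OF xs] using le by (intro sum_mono mult_right_mono) auto
    moreover have "ht x < (\<Sum>b\<in>B. 1 * real \<mu>)" if "0 < ht w"
    proof -
      have "\<exists>b\<in>B. 0 < representation B w b"
      proof (rule ccontr)
        assume "\<not> ?thesis"
        then have "ht w \<le> 0" unfolding hteq[OF w] by (intro sum_nonpos) (auto simp: mult_nonpos_nonneg not_less)
        with that show False by simp
      qed
      then show ?thesis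
        unfolding hteq[OF xs] using le B \<open>0 < \<mu>\<close>
        by (intro sum_strict_mono_ex1 ballI mult_right_mono) auto
    qed
    ultimately show ?thesis by (simp add: mult.commute)
  qed
  have zero: "fps_nth (hilbert ht (X B)) n = 0" if "\<And>x. x \<in> X B \<Longrightarrow> ht x < real n" for n
  proof -
    have "{x \<in> X B. ht x = real n} = {}" using that by fastforce
    then show ?thesis by (simp only: hilbert_def fps_nth_Abs_fps card.empty of_nat_0)
  qed
  have "fps_nth (hilbert ht (X B)) n = 0" if "\<mu> * card B < n" for n
    using bound that by (intro zero) (metis le_less_trans of_nat_less_iff of_nat_mult)
  then obtain h where h: "fps_of_poly h = hilbert ht (X B)" "degree h \<le> \<mu> * card B"
    by (rule poly_of_finite_fps)
  have ch: "coeff h i = fps_nth (hilbert ht (X B)) i" for i using h(1) by (metis fps_of_poly_nth)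
  have "degree h < \<mu> * card B" if "0 < ht w"
  proof -
    have "B \<noteq> {}" using that w linear_0[OF ht(1)] by auto
    then have gt: "0 < \<mu> * card B" using B(2) \<open>0 < \<mu>\<close> by (simp add: card_gt_0_iff)
    have "coeff h (\<mu> * card B) = 0" unfolding ch using bound that by (intro zero) auto
    then show ?thesis using h(2) gt
      by (metis degree_0 le_neq_implies_less leading_coeff_0_iff)
  qed
  then show ?thesis
    using h main[of B] ch by (intro exI[of _ h]) (auto simp: X0 hilbert_def)
qed

text \<open>All bases have \<open>dim G\<close> elements of the same height, so the pieces of the
  triangulation share a denominator and their nonnegative numerators can be added. The strict degree
  bound for \<open>0 < ht w\<close> is what later secures the value at 0.\<close>

lemma hilbert_cone:
  fixes ht :: "'a::real_vector \<Rightarrow> real"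
  assumes G: "finite G" and ht: "linear ht" "\<And>g. g \<in> G \<Longrightarrow> ht g = real \<mu>" and "0 < \<mu>"
    and \<Lambda>: "G \<subseteq> \<Lambda>" "\<And>x y. x \<in> \<Lambda> \<Longrightarrow> y \<in> \<Lambda> \<Longrightarrow> x + y \<in> \<Lambda>" "\<And>x y. x \<in> \<Lambda> \<Longrightarrow> y \<in> \<Lambda> \<Longrightarrow> x - y \<in> \<Lambda>"
    and fin: "\<And>V::nat. finite {x \<in> \<Lambda> \<inter> fcone G. ht x = real V}"
    and w: "w \<in> span G" "\<And>B b. B \<in> bases G \<Longrightarrow> b \<in> B \<Longrightarrow> representation B w b \<noteq> 0"
  shows "\<exists>h. fps_of_poly h = hilbert ht {x \<in> \<Lambda> \<inter> span G. \<forall>\<^sub>F e in at_right 0. x + e *\<^sub>R w \<in> fcone G}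
      * (1 - fps_X ^ \<mu>) ^ dim G \<and>
    (\<forall>i. 0 \<le> coeff h i) \<and> degree h \<le> \<mu> * dim G \<and> (0 < ht w \<longrightarrow> degree h < \<mu> * dim G)"
proof -
  let ?n = "dim G"
  obtain c where c: "\<And>B g. B \<in> bases G \<Longrightarrow> g \<in> G - B \<Longrightarrow> basis_cost c B g \<noteq> c g"
    using exists_generic_cost[OF G] by blast
  have htpos: "0 < ht g" if "g \<in> G" for g using ht(2)[OF that] \<open>0 < \<mu>\<close> by simp
  define D where "D = {B. dual_feasible c G B}"
  have Dsub: "D \<subseteq> bases G" by (auto simp: D_def dual_feasible_def)
  have finD: "finite D" by (rule finite_subset[OF Dsub finite_bases[OF G]])
  note dec = half_open_decomposition[OF G ht(1) htpos c w, folded D_def]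
  have "\<exists>h. fps_of_poly h = hilbert ht (\<Lambda> \<inter> half_open w B) * (1 - fps_X ^ \<mu>) ^ ?n \<and>
    (\<forall>i. 0 \<le> coeff h i) \<and> degree h \<le> \<mu> * ?n \<and> (0 < ht w \<longrightarrow> degree h < \<mu> * ?n)" if "B \<in> D" for B
  proof -
    have Bb: "B \<in> bases G" using that Dsub by blast
    note BB = basesD[OF G Bb]
    have "finite {x \<in> \<Lambda> \<inter> fcone B. ht x = real V}" for V
      by (rule finite_subset[OF _ fin[of V]]) (use fcone_mono[OF G BB(1)] in auto)
    then show ?thesis
      using hilbert_half_open[of B ht \<mu> \<Lambda> w] BB ht \<open>0 < \<mu>\<close> \<Lambda> w(1) card_bases[OF G Bb, unfolded dim_span] by (simp add: subset_iff)
  qed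
  then obtain h where h: "\<And>B. B \<in> D \<Longrightarrow> fps_of_poly (h B) = hilbert ht (\<Lambda> \<inter> half_open w B) * (1 - fps_X ^ \<mu>) ^ ?n"
      "\<And>B i. B \<in> D \<Longrightarrow> 0 \<le> coeff (h B) i" "\<And>B. B \<in> D \<Longrightarrow> degree (h B) \<le> \<mu> * ?n"
      "\<And>B. B \<in> D \<Longrightarrow> 0 < ht w \<Longrightarrow> degree (h B) < \<mu> * ?n"
    by metis
  let ?X = "{x \<in> \<Lambda> \<inter> span G. \<forall>\<^sub>F e in at_right 0. x + e *\<^sub>R w \<in> fcone G}"
  have Xeq: "?X = (\<Union>B\<in>D. \<Lambda> \<inter> half_open w B)" using dec(1) by blast
  have sub: "half_open w B \<subseteq> fcone G" if "B \<in> D" for B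
  proof -
    have Bb: "B \<in> bases G" using that Dsub by blast
    note BB = basesD[OF G Bb]
    have "half_open w B \<subseteq> fcone B"
      by (fastforce simp: half_open_def fcone_independent_iff[OF BB(2,3)])
    then show ?thesis using fcone_mono[OF G BB(1)] by blast
  qed
  have hX: "hilbert ht ?X = (\<Sum>B\<in>D. hilbert ht (\<Lambda> \<inter> half_open w B))"
  proof (rule fps_ext)
    fix V
    have "{x \<in> ?X. ht x = real V} = (\<Union>B\<in>D. {x \<in> \<Lambda> \<inter> half_open w B. ht x = real V})"
      unfolding Xeq by blast
    moreover have "card (\<Union>B\<in>D. {x \<in> \<Lambda> \<inter> half_open w B. ht x = real V}) =
        (\<Sum>B\<in>D. card {x \<in> \<Lambda> \<inter> half_open w B. ht x = real V})"
    proof (intro card_UN_disjoint finD ballI impI)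
      fix B assume "B \<in> D"
      show "finite {x \<in> \<Lambda> \<inter> half_open w B. ht x = real V}"
        by (rule finite_subset[OF _ fin[of V]]) (use sub[OF \<open>B \<in> D\<close>] in auto)
    next
      fix B B' assume "B \<in> D" "B' \<in> D" "B \<noteq> B'"
      then show "{x \<in> \<Lambda> \<inter> half_open w B. ht x = real V} \<inter> {x \<in> \<Lambda> \<inter> half_open w B'. ht x = real V} = {}"
        using dec(2) by (auto simp: disjoint_family_on_def)
    qed
    ultimately show "fps_nth (hilbert ht ?X) V = fps_nth (\<Sum>B\<in>D. hilbert ht (\<Lambda> \<inter> half_open w B)) V"
      by (simp add: hilbert_def fps_sum_nth)
  qed
  have "degree (\<Sum>B\<in>D. h B) < \<mu> * ?n" if "0 < ht w"
  proof (cases "D = {}")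
    case True
    have "dim G \<noteq> 0"
    proof
      assume 0: "dim G = 0"
      obtain B where "B \<subseteq> G" "independent B" "G \<subseteq> span B" using maximal_independent_subset[of G] by blast
      then have Bb: "B \<in> bases G" by (simp add: bases_def)
      then have "B = {}" using card_bases[OF G Bb, unfolded dim_span] 0 basesD[OF G Bb] by simp
      then have "w = 0" using basesD(4)[OF G Bb, symmetric] w(1) by simp
      then show False using that linear_0[OF ht(1)] by simp
    qed
    then show ?thesis using True \<open>0 < \<mu>\<close> by simp
  next
    case False
    then show ?thesis using h(4) that finD
      by (metis (no_types, lifting) degree_sum_less le_zero_eq bot_nat_0.not_eq_extremum ex_in_conv not_less0)
  qed
  moreover have "degree (\<Sum>B\<in>D. h B) \<le> \<mu> * ?n"
    by (rule degree_sum_le[OF finD]) (use h(3) in auto)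
  moreover have "fps_of_poly (\<Sum>B\<in>D. h B) = hilbert ht ?X * (1 - fps_X ^ \<mu>) ^ ?n"
    unfolding hX by (simp add: fps_of_poly_sum sum_distrib_right h(1))
  moreover have "\<forall>i. 0 \<le> coeff (\<Sum>B\<in>D. h B) i"
    using h(2) by (auto simp: coeff_sum intro: sum_nonneg)
  ultimately show ?thesis by blast
qed

subsection \<open>From numerators to quasi-polynomials\<close>

text \<open>This is the negative binomial series in X^m; the induction step is Pascal's
  rule.\<close>

lemma fps_inverse_one_minus_X_power:
  assumes "0 < m"
  shows "(1 - fps_X ^ m) ^ Suc D *
    Abs_fps (\<lambda>n. if m dvd n then real ((n div m + D) choose D) else 0) = 1"
proof (induction D)
  case 0
  have "m dvd n - m \<longleftrightarrow> m dvd n" if "m \<le> n" for n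
    using that by (simp add: dvd_minus_self)
  then show ?case using assms
    by (intro fps_ext) (auto simp: left_diff_distrib fps_X_power_mult_nth dest: dvd_imp_le)
next
  case (Suc D)
  let ?A = "\<lambda>D. Abs_fps (\<lambda>n. if m dvd n then real ((n div m + D) choose D) else 0)"
  have "(1 - fps_X ^ m) * ?A (Suc D) = ?A D"
  proof (rule fps_ext)
    fix n
    show "fps_nth ((1 - fps_X ^ m) * ?A (Suc D)) n = fps_nth (?A D) n"
    proof (cases "m dvd n")
      case True
      then obtain k where k: "n = m * k" by blast
      show ?thesis
      proof (cases k)
        case (Suc k')
        then have "n - m = m * k'" "\<not> n < m" using k by auto
        then show ?thesis using assms k Suc
          by (simp add: left_diff_distrib fps_X_power_mult_nth)
      qed (use assms k in \<open>simp add: left_diff_distrib fps_X_power_mult_nth\<close>)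
    next
      case False
      then have "\<not> m dvd n - m" if "\<not> n < m" using that by (simp add: dvd_minus_self)
      with False show ?thesis by (simp add: left_diff_distrib fps_X_power_mult_nth)
    qed
  qed
  then have "(1 - fps_X ^ m) ^ Suc D * ((1 - fps_X ^ m) * ?A (Suc D)) = 1"
    using Suc.IH by (simp only:)
  then show ?case by (simp only: power_Suc mult_ac)
qed

text \<open>The polynomial binomial(x + D, D). Its zeros -1, ..., -D keep the constituents correct
  at arguments smaller than the degree of the numerator.\<close>

definition binomial_poly :: "nat \<Rightarrow> real poly" where
  "binomial_poly D = smult (1 / fact D) (\<Prod>k<D. [:1 + of_nat k, 1:])"

lemma poly_binomial_poly: "poly (binomial_poly D) x = (\<Prod>k<D. x + 1 + real k) / fact D"
  by (simp add: binomial_poly_def poly_prod add_ac)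

lemma poly_binomial_poly_nat: "poly (binomial_poly D) (real k) = real ((k + D) choose D)"
proof -
  have "real ((k + D) choose D) = real (k + D) gchoose D" by (rule binomial_gbinomial)
  also have "\<dots> = pochhammer (real k + 1) D / fact D" by (simp add: gbinomial_pochhammer')
  also have "\<dots> = poly (binomial_poly D) (real k)"
    by (simp add: poly_binomial_poly pochhammer_prod atLeast0LessThan)
  finally show ?thesis by simp
qed

lemma poly_binomial_poly_neg:
  assumes "0 < k" "k \<le> D"
  shows "poly (binomial_poly D) (- real k) = 0"
proof -
  have "(\<Prod>j<D. - real k + 1 + real j) = 0"
    by (rule prod_zero) (use assms in \<open>auto intro!: bexI[of _ "k - 1"] simp: of_nat_diff\<close>)
  then show ?thesis by (simp only: poly_binomial_poly)
qed

lemma degree_binomial_poly: "degree (binomial_poly D) = D"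
proof -
  have "degree (\<Prod>k<D. [:1 + of_nat k, 1::real:]) = (\<Sum>k<D. degree [:1 + of_nat k, 1::real:])"
    by (rule degree_prod_eq_sum_degree) auto
  then show ?thesis by (simp add: binomial_poly_def)
qed

lemma lead_coeff_binomial_poly: "coeff (binomial_poly D) D = 1 / fact D"
proof -
  have "lead_coeff (\<Prod>k<D. [:1 + of_nat k, 1::real:]) = (\<Prod>k<D. 1)"
    by (subst lead_coeff_prod) simp
  moreover have "lead_coeff (binomial_poly D) = 1 / fact D * lead_coeff (\<Prod>k<D. [:1 + of_nat k, 1::real:])"
    unfolding binomial_poly_def by (rule lead_coeff_smult)
  ultimately show ?thesis by (simp add: degree_binomial_poly)
qed

text \<open>The coefficient of \<open>h\<close> at \<open>i\<close> contributes binomial((n - i) / m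
  + D, D) to the residue class of \<open>i\<close>. All these polynomials have the leading
  coefficient 1 / (D! m^D), which gives the formula for \<open>coeff (q r) D\<close>. For n < i the
  contribution has to vanish.\<close>

lemma constituents_of_numerator:
  fixes f :: "nat \<Rightarrow> real"
  assumes "0 < m" and h: "fps_of_poly h = Abs_fps f * (1 - fps_X ^ m) ^ Suc D"
    and deg: "degree h \<le> m * Suc D"
  obtains q where "\<And>n. 1 \<le> n \<or> degree h < m * Suc D \<Longrightarrow> f n = poly (q (n mod m)) (real n)"
    and "\<And>r. degree (q r) \<le> D"
    and "\<And>r. coeff (q r) D = (\<Sum>i | i \<le> degree h \<and> i mod m = r. coeff h i) / (fact D * real m ^ D)"
proof -
  define A where "A = Abs_fps (\<lambda>n. if m dvd n then real ((n div m + D) choose D) else 0)"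
  define g where "g i = pcompose (binomial_poly D) [:- real i / real m, 1 / real m:]" for i
  define q where "q r = (\<Sum>i | i \<le> degree h \<and> i mod m = r. smult (coeff h i) (g i))" for r
  have "Abs_fps f = Abs_fps f * ((1 - fps_X ^ m) ^ Suc D * A)"
    using fps_inverse_one_minus_X_power[OF assms(1), of D] by (simp only: A_def mult_1_right)
  also have "\<dots> = fps_of_poly h * A" unfolding h by (simp only: mult.assoc)
  finally have f: "f n = (\<Sum>i=0..n. coeff h i * fps_nth A (n - i))" for n
    by (metis (no_types, lifting) fps_mult_nth fps_nth_Abs_fps fps_of_poly_nth sum.cong)
  have fq: "f n = poly (q (n mod m)) (real n)" if n: "1 \<le> n \<or> degree h < m * Suc D" for n
  proof -
    have gi: "poly (g i) (real n) = (if i \<le> n then fps_nth A (n - i) else 0)"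
      if i: "i \<le> degree h" "i mod m = n mod m" for i
    proof -
      have pg: "poly (g i) (real n) = poly (binomial_poly D) ((real n - real i) / real m)"
        by (simp add: g_def poly_pcompose diff_divide_distrib)
      show ?thesis
      proof (cases "i \<le> n")
        case True
        then have dv: "m dvd n - i" using i(2) mod_eq_dvd_iff_nat[of i n m] by simp
        then have "(real n - real i) / real m = real ((n - i) div m)"
          using True by (simp add: of_nat_diff real_of_nat_div)
        then show ?thesis using True dv pg by (simp add: A_def poly_binomial_poly_nat)
      next
        case False
        then have dv: "m dvd i - n" using i(2) mod_eq_dvd_iff_nat[of n i m] by simp
        then obtain k where k: "i - n = m * k" by blast
        \<comment> \<open>Only n = 0 together with \<open>i = m * Suc D\<close> could violate this,
          and the assumption on \<open>n\<close> excludes that pair.\<close>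
        have "m * k < m * Suc D" using k n i(1) deg False by linarith
        then have "k < Suc D" by (rule mult_less_cancel1[THEN iffD1, THEN conjunct2])
        then have "k \<le> D" by simp
        moreover have "0 < k" using k False by (cases k) auto
        moreover have "(real n - real i) / real m = - real k"
        proof -
          have "real i - real n = real m * real k" using k False by (metis of_nat_diff of_nat_mult linear)
          then show ?thesis using assms(1) by (simp add: field_simps)
        qed
        ultimately show ?thesis using False pg poly_binomial_poly_neg by simp
      qed
    qed
    have "f n = (\<Sum>i=0..n. coeff h i * fps_nth A (n - i))" by (rule f)
    also have "\<dots> = (\<Sum>i | i \<le> degree h \<and> i mod m = n mod m. coeff h i * (if i \<le> n then fps_nth A (n - i) else 0))"
    proof (rule sum.mono_neutral_cong)
      fix i assume i: "i \<in> {i. i \<le> degree h \<and> i mod m = n mod m} - {0..n}"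
      then show "coeff h i * (if i \<le> n then fps_nth A (n - i) else 0) = 0" by auto
    next
      fix i assume i: "i \<in> {0..n} - {i. i \<le> degree h \<and> i mod m = n mod m}"
      have "coeff h i = 0 \<or> \<not> m dvd n - i"
        using i mod_eq_dvd_iff_nat[of i n m] by (auto simp: coeff_eq_0)
      then show "coeff h i * fps_nth A (n - i) = 0" by (auto simp: A_def)
    qed auto
    also have "\<dots> = poly (q (n mod m)) (real n)"
      using gi by (simp add: q_def poly_sum)
    finally show ?thesis .
  qed
  have dg: "degree (g i) = D" for i
    using assms(1) by (simp add: g_def degree_pcompose degree_binomial_poly)
  have cg: "coeff (g i) D = 1 / (fact D * real m ^ D)" for i
  proof -
    have "lead_coeff (g i) = lead_coeff (binomial_poly D) * (1 / real m) ^ D"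
      unfolding g_def using assms(1) by (subst lead_coeff_comp) (auto simp: degree_binomial_poly)
    then show ?thesis by (simp add: dg degree_binomial_poly lead_coeff_binomial_poly power_divide)
  qed
  have dq: "degree (q r) \<le> D" for r
    unfolding q_def using dg by (intro degree_sum_le) (auto intro: order_trans[OF degree_smult_le])
  have cq: "coeff (q r) D = (\<Sum>i | i \<le> degree h \<and> i mod m = r. coeff h i) / (fact D * real m ^ D)" for r
    by (simp add: q_def coeff_sum cg sum_divide_distrib)
  show ?thesis using that[OF fq dq cq] .
qed

section \<open>Arithmetic of quasi-polynomials of bounded degree\<close>

text \<open>The degree is only bounded and the period existentially quantified, which makes the
  notion stable under the sums and differences of inclusion-exclusion. Exact degrees are recovered
  at the end.\<close>

definition quasi_polynomial_le :: "nat \<Rightarrow> (nat \<Rightarrow> real) \<Rightarrow> bool" where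
  "quasi_polynomial_le D f \<longleftrightarrow> (\<exists>m>0. \<exists>q :: nat \<Rightarrow> real poly.
     (\<forall>n. f n = poly (q (n mod m)) (real n)) \<and> (\<forall>r. degree (q r) \<le> D))"

lemma quasi_polynomial_le_0: "quasi_polynomial_le D (\<lambda>_. 0)"
  unfolding quasi_polynomial_le_def by (intro exI[of _ 1] conjI exI[of _ "\<lambda>_. 0"]) auto

lemma quasi_polynomial_le_add:
  assumes "quasi_polynomial_le D f" "quasi_polynomial_le D g"
  shows "quasi_polynomial_le D (\<lambda>n. f n + g n)"
proof -
  obtain m q where 1: "0 < m" "\<And>n. f n = poly (q (n mod m)) (real n)" "\<And>r. degree (q r) \<le> D"
    using assms(1) by (auto simp: quasi_polynomial_le_def)
  obtain m' q' where 2: "0 < m'" "\<And>n. g n = poly (q' (n mod m')) (real n)" "\<And>r. degree (q' r) \<le> D"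
    using assms(2) by (auto simp: quasi_polynomial_le_def)
  show ?thesis unfolding quasi_polynomial_le_def
    using 1 2 by (intro exI[of _ "m * m'"] conjI exI[of _ "\<lambda>r. q (r mod m) + q' (r mod m')"])
      (auto simp: mod_mod_cancel intro: degree_add_le)
qed

lemma quasi_polynomial_le_cmult:
  assumes "quasi_polynomial_le D f"
  shows "quasi_polynomial_le D (\<lambda>n. c * f n)"
proof -
  obtain m q where 1: "0 < m" "\<And>n. f n = poly (q (n mod m)) (real n)" "\<And>r. degree (q r) \<le> D"
    using assms(1) by (auto simp: quasi_polynomial_le_def)
  then show ?thesis unfolding quasi_polynomial_le_def
    by (intro exI[of _ m] conjI exI[of _ "\<lambda>r. smult c (q r)"]) (auto intro: order_trans[OF degree_smult_le])
qed

lemma quasi_polynomial_le_diff: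
  assumes "quasi_polynomial_le D f" "quasi_polynomial_le D g"
  shows "quasi_polynomial_le D (\<lambda>n. f n - g n)"
  using quasi_polynomial_le_add[OF assms(1) quasi_polynomial_le_cmult[OF assms(2), of "- 1"]] by simp

lemma quasi_polynomial_le_mono:
  assumes "quasi_polynomial_le D f" "D \<le> D'"
  shows "quasi_polynomial_le D' f"
  using assms unfolding quasi_polynomial_le_def by (meson order_trans)

lemma poly_div_power_tendsto:
  fixes q :: "real poly"
  assumes "degree q \<le> D"
  shows "((\<lambda>x. poly q x / x ^ D) \<longlongrightarrow> coeff q D) at_top"
proof -
  have "((\<lambda>x. coeff q i * (x ^ i / x ^ D)) \<longlongrightarrow> (if i = D then coeff q D else 0)) at_top" if "i \<le> D" for i
  proof (cases "i = D")
    case True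
    have "\<forall>\<^sub>F x in at_top. coeff q i * (x ^ i / x ^ D) = coeff q D"
      using eventually_gt_at_top[of 0] by eventually_elim (simp add: True)
    then show ?thesis using True by (simp add: tendsto_eventually)
  next
    case False
    then have lt: "0 < D - i" using that by simp
    have "((\<lambda>x::real. coeff q i * inverse (x ^ (D - i))) \<longlongrightarrow> coeff q i * 0) at_top"
      using lt by (intro tendsto_mult tendsto_const tendsto_inverse_0_at_top filterlim_pow_at_top filterlim_ident)
    then have "((\<lambda>x::real. coeff q i * (x ^ i / x ^ D)) \<longlongrightarrow> coeff q i * 0) at_top"
    proof (rule Lim_transform_eventually)
      show "\<forall>\<^sub>F x in at_top. coeff q i * inverse (x ^ (D - i)) = coeff q i * (x ^ i / x ^ D)"
        using eventually_gt_at_top[of 0]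
        by eventually_elim (use that in \<open>simp add: power_diff field_simps\<close>)
    qed
    then show ?thesis using False by simp
  qed
  then have "((\<lambda>x. \<Sum>i\<le>D. coeff q i * (x ^ i / x ^ D)) \<longlongrightarrow> (\<Sum>i\<le>D. if i = D then coeff q D else 0)) at_top"
    by (intro tendsto_sum) auto
  moreover have "poly q x / x ^ D = (\<Sum>i\<le>D. coeff q i * (x ^ i / x ^ D))" for x
  proof -
    have "poly q x = (\<Sum>i\<le>D. coeff q i * x ^ i)"
      unfolding poly_altdef using assms by (intro sum.mono_neutral_left) (auto simp: coeff_eq_0)
    then show ?thesis by (simp add: sum_divide_distrib)
  qed
  ultimately show ?thesis by simp
qed

subsection \<open>Eventually nonnegative polynomials\<close>

lemma poly_eventually_nonneg_iff:
  fixes q :: "real poly"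
  shows "(\<forall>\<^sub>F t in sequentially. 0 \<le> poly q (real t)) \<longleftrightarrow> 0 \<le> lead_coeff q"
proof -
  have pos: "\<forall>\<^sub>F t in sequentially. 0 < poly r (real t)" if lc: "0 < lead_coeff r" for r :: "real poly"
  proof -
    obtain N where "\<forall>x\<ge>N. lead_coeff r \<le> poly r x"
      using poly_pinfty_gt_lc[OF lc] by blast
    then have "\<forall>\<^sub>F x in at_top. 0 < poly r x"
      using lc by (auto simp: eventually_at_top_linorder intro!: exI[of _ N] intro: less_le_trans)
    then show ?thesis
      using filterlim_real_sequentially by (auto simp: filterlim_iff)
  qed
  show ?thesis
  proof
    assume L: "\<forall>\<^sub>F t in sequentially. 0 \<le> poly q (real t)"
    show "0 \<le> lead_coeff q"
    proof (rule ccontr)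
      assume "\<not> 0 \<le> lead_coeff q"
      then have "\<forall>\<^sub>F t in sequentially. 0 < poly (- q) (real t)" by (intro pos) simp
      with L have "\<forall>\<^sub>F t::nat in sequentially. False" by eventually_elim simp
      then show False by simp
    qed
  next
    assume "0 \<le> lead_coeff q"
    show "\<forall>\<^sub>F t in sequentially. 0 \<le> poly q (real t)"
    proof (cases "q = 0")
      case False
      then have "0 < lead_coeff q" using \<open>0 \<le> lead_coeff q\<close> by (simp add: order_less_le)
      from pos[OF this] show ?thesis by eventually_elim simp
    qed simp
  qed
qed

lemma coeff_nonneg_of_lead_coeff:
  fixes q :: "real poly"
  assumes "0 \<le> lead_coeff q" "degree q \<le> n"
  shows "0 \<le> coeff q n"
  using assms by (cases "degree q = n") (auto simp: coeff_eq_0)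

subsection \<open>The constituents of \<open>L\<close>\<close>

text \<open>The polynomial binomial(t + d - x, d) in t. The parameter is real because the shift from
  t to t + 1 turns x into x - 1, which is -1 for column 0.\<close>

definition Lpoly :: "nat \<Rightarrow> real \<Rightarrow> real poly" where
  "Lpoly d x = smult (1 / fact d) (\<Prod>i<d. [:real d - x - real i, 1:])"

lemma poly_Lpoly_nat:
  assumes "j \<le> d"
  shows "poly (Lpoly d (real j)) (real t) = real ((t + d - j) choose d)"
proof -
  have "real ((t + d - j) choose d) = real (t + d - j) gchoose d" by (rule binomial_gbinomial)
  also have "\<dots> = (\<Prod>i<d. real (t + d - j) - real i) / fact d"
    by (simp add: gbinomial_prod_rev atLeast0LessThan)
  also have "\<dots> = poly (Lpoly d (real j)) (real t)"
    using assms by (simp add: Lpoly_def poly_prod of_nat_diff algebra_simps)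
  finally show ?thesis by simp
qed

lemma degree_Lpoly: "degree (Lpoly d x) = d"
proof -
  have "degree (\<Prod>i<d. [:real d - x - real i, 1:]) = (\<Sum>i<d. degree [:real d - x - real i, 1:])"
    by (rule degree_prod_eq_sum_degree) auto
  then show ?thesis by (simp add: Lpoly_def)
qed

lemma coeff_prod_linear:
  fixes a :: "nat \<Rightarrow> real"
  shows "coeff (\<Prod>i<n. [:a i, 1:]) n = 1 \<and> (0 < n \<longrightarrow> coeff (\<Prod>i<n. [:a i, 1:]) (n - 1) = (\<Sum>i<n. a i))"
proof (induction n)
  case (Suc n)
  have deg: "degree (\<Prod>i<n. [:a i, 1:]) = n"
    by (subst degree_prod_eq_sum_degree) auto
  let ?P = "\<Prod>i<n. [:a i, 1:]"
  have eq: "(\<Prod>i<Suc n. [:a i, 1:]) = smult (a n) ?P + pCons 0 ?P"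
    by (simp add: mult.commute)
  have "coeff ?P (Suc n) = 0" using deg by (simp add: coeff_eq_0)
  moreover have "coeff (pCons 0 ?P) n = (\<Sum>i<n. a i)"
    using Suc by (cases n) auto
  ultimately show ?case unfolding eq using Suc by simp
qed simp

lemma coeff_Lpoly: "coeff (Lpoly d x) d = 1 / fact d"
  "0 < d \<Longrightarrow> coeff (Lpoly d x) (d - 1) = (real d * (real d - x) - real d * (real d - 1) / 2) / fact d"
proof -
  have "(\<Sum>i<n. c - real i) = real n * c - real n * (real n - 1) / 2" for n c
    by (induction n) (auto simp: field_simps)
  from this[of "real d - x" d] have "(\<Sum>i<d. real d - x - real i) = real d * (real d - x) - real d * (real d - 1) / 2"
    by simp
  then show "coeff (Lpoly d x) d = 1 / fact d"
    "0 < d \<Longrightarrow> coeff (Lpoly d x) (d - 1) = (real d * (real d - x) - real d * (real d - 1) / 2) / fact d"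
    using coeff_prod_linear[of "\<lambda>i. real d - x - real i" d] by (auto simp: Lpoly_def)
qed

lemma pcompose_Lpoly: "pcompose (Lpoly d x) [:1, 1:] = Lpoly d (x - 1)"
  by (simp add: Lpoly_def pcompose_smult pcompose_prod pcompose_pCons algebra_simps)

text \<open>The quotient is expanded by the negative binomial series, in which only the indices
  congruent to \<open>r\<close> modulo \<open>p\<close> meet the argument
  \<open>t * p + r\<close>.\<close>

lemma L_eq:
  assumes "r < p"
  shows "L d p h (t * p + r) = (\<Sum>j\<le>d. h (j * p + r) * poly (Lpoly d (real j)) (real t))"
proof -
  have p: "0 < p" using assms by simp
  define U where "U = Abs_fps (\<lambda>n. if p dvd n then real ((n div p + d) choose d) else 0)"
  have inv: "(1 - fps_X ^ p) ^ (d + 1) * U = 1"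
    using fps_inverse_one_minus_X_power[OF p, of d] by (simp add: U_def)
  define P where "P = (\<Sum>i<p * (d + 1). fps_const (h i) * fps_X ^ i)"
  have nz: "(1 - fps_X ^ p :: real fps) ^ (d + 1) \<noteq> 0"
    using inv by (metis mult_zero_left zero_neq_one)
  have "P / (1 - fps_X ^ p) ^ (d + 1) = P * U"
  proof -
    have "P = (P * U) * (1 - fps_X ^ p) ^ (d + 1)" using inv by (metis mult.assoc mult.commute mult_1_right)
    then show ?thesis using nz by (metis nonzero_mult_div_cancel_right)
  qed
  then have "L d p h (t * p + r) = (\<Sum>i<p * (d + 1). h i * fps_nth (fps_X ^ i * U) (t * p + r))"
    by (simp add: L_def P_def sum_distrib_right fps_sum_nth mult.assoc)
  also have "\<dots> = (\<Sum>i<p * (d + 1). if i mod p = r then h i * poly (Lpoly d (real (i div p))) (real t) else 0)"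
  proof (rule sum.cong[OF refl])
    fix i assume "i \<in> {..<p * (d + 1)}"
    then have jd: "i div p \<le> d" using p by (simp add: less_mult_imp_div_less mult.commute less_Suc_eq_le[symmetric] del: mult_Suc mult_Suc_right)
    define j where "j = i div p"
    have i: "i = j * p + i mod p" by (simp add: j_def)
    have "fps_nth (fps_X ^ i * U) (t * p + r) = (if i mod p = r then poly (Lpoly d (real j)) (real t) else 0)"
    proof (cases "i mod p = r")
      case True
      then have ij: "i = j * p + r" using i by simp
      show ?thesis
      proof (cases "j \<le> t")
        case True
        then have "t * p + r - i = (t - j) * p" "i \<le> t * p + r" using ij by (auto simp: diff_mult_distrib)
        then show ?thesis
          using \<open>i mod p = r\<close> p jd True poly_Lpoly_nat[of j d t]
          by (auto simp: fps_X_power_mult_nth U_def j_def)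
      next
        case False
        \<comment> \<open>The series has not started at this index, and the polynomial agrees:
          binomial(t + d - j, d) is 0 as its upper entry is a natural number below
          \<open>d\<close>.\<close>
        then have "t * p + r < i" using ij p by simp
        moreover have "t + d - j < d" using False jd by (simp add: j_def)
        ultimately show ?thesis
          using \<open>i mod p = r\<close> jd poly_Lpoly_nat[of j d t] by (simp add: fps_X_power_mult_nth j_def)
      qed
    next
      case False
      have "\<not> p dvd t * p + r - i" if "i \<le> t * p + r"
      proof
        assume "p dvd t * p + r - i"
        then have "(t * p + r) mod p = i mod p" using mod_eq_dvd_iff_nat[OF that, of p] by blast
        with False assms show False by simp
      qed
      then show ?thesis using False by (simp add: fps_X_power_mult_nth U_def)
    qed
    then show "h i * fps_nth (fps_X ^ i * U) (t * p + r) = (if i mod p = r then h i * poly (Lpoly d (real (i div p))) (real t) else 0)"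
      by (simp add: j_def)
  qed
  also have "\<dots> = (\<Sum>i\<in>(\<lambda>j. j * p + r) ` {..d}. h i * poly (Lpoly d (real (i div p))) (real t))"
  proof (rule sum.mono_neutral_cong_right)
    show "(\<lambda>j. j * p + r) ` {..d} \<subseteq> {..<p * (d + 1)}"
    proof
      fix i assume "i \<in> (\<lambda>j. j * p + r) ` {..d}"
      then obtain j where j: "j \<le> d" "i = j * p + r" by auto
      have "j * p \<le> d * p" using j(1) by (rule mult_le_mono1)
      then have "j * p + r < d * p + p" using assms by linarith
      then show "i \<in> {..<p * (d + 1)}" using j(2) by (simp add: algebra_simps)
    qed
    show "\<forall>i\<in>{..<p * (d + 1)} - (\<lambda>j. j * p + r) ` {..d}.
        (if i mod p = r then h i * poly (Lpoly d (real (i div p))) (real t) else 0) = 0"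
    proof
      fix i assume i: "i \<in> {..<p * (d + 1)} - (\<lambda>j. j * p + r) ` {..d}"
      have "i div p < d + 1" using i by (simp add: less_mult_imp_div_less mult.commute del: mult_Suc mult_Suc_right)
      moreover have "i = (i div p) * p + i mod p" by simp
      ultimately have "i mod p \<noteq> r" using i image_eqI[of i "\<lambda>j. j * p + r" "i div p" "{..d}"] by auto
      then show "(if i mod p = r then h i * poly (Lpoly d (real (i div p))) (real t) else 0) = 0" by simp
    qed
  qed (use assms in auto)
  also have "\<dots> = (\<Sum>j\<le>d. h (j * p + r) * poly (Lpoly d (real j)) (real t))"
  proof -
    have "inj_on (\<lambda>j. j * p + r) {..d}" using p by (auto simp: inj_on_def)
    then show ?thesis using assms p by (simp add: sum.reindex)
  qed
  finally show ?thesis .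
qed

definition row_poly :: "nat \<Rightarrow> nat \<Rightarrow> (nat \<Rightarrow> real) \<Rightarrow> nat \<Rightarrow> real poly" where
  "row_poly d p h r = (\<Sum>j\<le>d. smult (h (j * p + r)) (Lpoly d (real j)))"

text \<open>The increments \<open>L(tp + r + 1) - L(tp + r)\<close> as polynomials in \<open>t\<close>.\<close>

definition diff_poly :: "nat \<Rightarrow> nat \<Rightarrow> (nat \<Rightarrow> real) \<Rightarrow> nat \<Rightarrow> real poly" where
  "diff_poly d p h r = (if r + 1 < p then row_poly d p h (r + 1) - row_poly d p h r
     else pcompose (row_poly d p h 0) [:1, 1:] - row_poly d p h r)"

lemma L_diff:
  assumes "r < p"
  shows "L d p h (t * p + r + 1) - L d p h (t * p + r) = poly (diff_poly d p h r) (real t)"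
proof (cases "r + 1 < p")
  case True
  then show ?thesis
    using L_eq[OF assms, of d h t] L_eq[OF True, of d h t]
    by (simp add: diff_poly_def row_poly_def poly_sum)
next
  case False
  \<comment> \<open>The successor of the last row is row 0 at t + 1.\<close>
  then have r: "t * p + r + 1 = Suc t * p + 0" using assms by simp
  have "0 < p" using assms by simp
  from L_eq[OF this, of d h "Suc t"] have "L d p h (t * p + r + 1) = poly (row_poly d p h 0) (1 + real t)"
    unfolding r by (simp add: row_poly_def poly_sum add.commute)
  moreover have "L d p h (t * p + r) = poly (row_poly d p h r) (real t)"
    using L_eq[OF assms] by (simp add: row_poly_def poly_sum)
  ultimately show ?thesis using False by (simp add: diff_poly_def poly_pcompose)
qed

text \<open>Monotonicity from some point on can be tested in each residue class modulo
  \<open>p\<close>, where the increments are values of a polynomial. A constant stretch is covered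
  because the leading coefficient of the zero polynomial is 0.\<close>

lemma C_END_iff:
  assumes "0 < p"
  shows "h \<in> C_END d p \<longleftrightarrow> (\<forall>i\<ge>p * (d + 1). h i = 0) \<and> (\<forall>r<p. 0 \<le> lead_coeff (diff_poly d p h r))"
proof -
  have "(\<exists>N. \<forall>n\<ge>N. L d p h n \<le> L d p h (n + 1)) \<longleftrightarrow>
      (\<forall>r<p. \<forall>\<^sub>F t in sequentially. 0 \<le> poly (diff_poly d p h r) (real t))"
  proof
    assume "\<exists>N. \<forall>n\<ge>N. L d p h n \<le> L d p h (n + 1)"
    then obtain N where N: "\<And>n. N \<le> n \<Longrightarrow> L d p h n \<le> L d p h (n + 1)" by blast
    show "\<forall>r<p. \<forall>\<^sub>F t in sequentially. 0 \<le> poly (diff_poly d p h r) (real t)"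
    proof (intro allI impI)
      fix r assume r: "r < p"
      show "\<forall>\<^sub>F t in sequentially. 0 \<le> poly (diff_poly d p h r) (real t)"
        using eventually_ge_at_top[of N]
      proof eventually_elim
        case (elim t)
        have "t * 1 \<le> t * p" using assms by (intro mult_le_mono2) simp
        then have "N \<le> t * p + r" using elim by linarith
        then show ?case using N[of "t * p + r"] L_diff[OF r, of d h t] by simp
      qed
    qed
  next
    assume R: "\<forall>r<p. \<forall>\<^sub>F t in sequentially. 0 \<le> poly (diff_poly d p h r) (real t)"
    then have "\<forall>\<^sub>F t in sequentially. \<forall>r\<in>{..<p}. 0 \<le> poly (diff_poly d p h r) (real t)"
      by (intro eventually_ball_finite) auto
    then obtain T where T: "\<And>t r. T \<le> t \<Longrightarrow> r < p \<Longrightarrow> 0 \<le> poly (diff_poly d p h r) (real t)"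
      by (auto simp: eventually_sequentially)
    have "L d p h n \<le> L d p h (n + 1)" if "T * p \<le> n" for n
    proof -
      have "T \<le> n div p" using that assms by (simp add: less_eq_div_iff_mult_less_eq)
      then have "0 \<le> poly (diff_poly d p h (n mod p)) (real (n div p))" using T assms by simp
      then show ?thesis using L_diff[of "n mod p" p d h "n div p"] assms by simp
    qed
    then show "\<exists>N. \<forall>n\<ge>N. L d p h n \<le> L d p h (n + 1)" by blast
  qed
  then show ?thesis
    by (auto simp: C_END_def C_def poly_eventually_nonneg_iff topspace_Euclidean_space)
qed

section \<open>Row sums, first moments and the top two coefficients of the increments\<close>

definition row_sum :: "nat \<Rightarrow> nat \<Rightarrow> nat \<Rightarrow> (nat \<Rightarrow> real) \<Rightarrow> real" where
  "row_sum d p r h = (\<Sum>j\<le>d. h (j * p + r))"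

definition moment :: "nat \<Rightarrow> nat \<Rightarrow> nat \<Rightarrow> (nat \<Rightarrow> real) \<Rightarrow> real" where
  "moment d p r h = (\<Sum>j\<le>d. real j * h (j * p + r))"

text \<open>Right side minus left side of the first-level inequalities. In the last row the weight j
  + 1 produces the additional \<open>row_sum\<close>.\<close>

definition slack :: "nat \<Rightarrow> nat \<Rightarrow> nat \<Rightarrow> (nat \<Rightarrow> real) \<Rightarrow> real" where
  "slack d p r h = (if r + 1 < p then moment d p r h - moment d p (r + 1) h
     else moment d p r h + row_sum d p r h - moment d p 0 h)"

lemma degree_row_poly: "degree (row_poly d p h r) \<le> d"
  unfolding row_poly_def by (intro degree_sum_le) (auto intro: order_trans[OF degree_smult_le] simp: degree_Lpoly)

lemma degree_diff_poly: "degree (diff_poly d p h r) \<le> d"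
  by (auto simp: diff_poly_def degree_pcompose intro!: degree_diff_le degree_row_poly)

lemma coeff_row_poly:
  shows "coeff (row_poly d p h r) d = row_sum d p r h / fact d"
    and "0 < d \<Longrightarrow> coeff (row_poly d p h r) (d - 1) =
      (real d * real d - real d * (real d - 1) / 2) / fact d * row_sum d p r h - real d / fact d * moment d p r h"
proof -
  show "coeff (row_poly d p h r) d = row_sum d p r h / fact d"
    by (simp add: row_poly_def coeff_sum coeff_Lpoly row_sum_def sum_divide_distrib)
  define A where "A = (real d * real d - real d * (real d - 1) / 2) / fact d"
  define B where "B = real d / fact d"
  assume "0 < d"
  from coeff_Lpoly(2)[OF this] have "coeff (Lpoly d x) (d - 1) = A - B * x" for x
    by (simp add: A_def B_def add_divide_distrib diff_divide_distrib right_diff_distrib)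
  then have "coeff (row_poly d p h r) (d - 1) = (\<Sum>j\<le>d. h (j * p + r) * (A - B * real j))"
    by (simp add: row_poly_def coeff_sum)
  then have "coeff (row_poly d p h r) (d - 1) = A * row_sum d p r h - B * moment d p r h"
    by (simp add: row_sum_def moment_def sum_distrib_left sum_subtractf[symmetric] algebra_simps)
  then show "coeff (row_poly d p h r) (d - 1) =
      (real d * real d - real d * (real d - 1) / 2) / fact d * row_sum d p r h - real d / fact d * moment d p r h"
    by (simp only: A_def B_def)
qed

lemma coeff_row_poly_shift:
  assumes "0 < d"
  shows "coeff (pcompose (row_poly d p h r) [:1, 1:]) d = coeff (row_poly d p h r) d"
    and "coeff (pcompose (row_poly d p h r) [:1, 1:]) (d - 1) =
      coeff (row_poly d p h r) (d - 1) + real d / fact d * row_sum d p r h"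
proof -
  have eq: "pcompose (row_poly d p h r) [:1, 1:] = (\<Sum>j\<le>d. smult (h (j * p + r)) (Lpoly d (real j - 1)))"
    by (simp add: row_poly_def pcompose_sum pcompose_smult pcompose_Lpoly)
  show "coeff (pcompose (row_poly d p h r) [:1, 1:]) d = coeff (row_poly d p h r) d"
    unfolding eq by (simp add: row_poly_def coeff_sum coeff_Lpoly)
  have "coeff (Lpoly d (x - 1)) (d - 1) = coeff (Lpoly d x) (d - 1) + real d / fact d" for x
    unfolding coeff_Lpoly(2)[OF assms] by (simp add: add_divide_distrib diff_divide_distrib right_diff_distrib)
  then show "coeff (pcompose (row_poly d p h r) [:1, 1:]) (d - 1) =
      coeff (row_poly d p h r) (d - 1) + real d / fact d * row_sum d p r h"
    unfolding eq by (simp add: row_poly_def row_sum_def coeff_sum distrib_left sum.distrib sum_distrib_left sum_divide_distrib mult.commute)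
qed

text \<open>The origin of the defining conditions: the top coefficient compares cyclically adjacent
  row sums, and once these agree, the next coefficient compares first moments.\<close>

lemma coeff_diff_poly:
  assumes "0 < d" "r < p"
  shows "coeff (diff_poly d p h r) d =
      (row_sum d p (if r + 1 < p then r + 1 else 0) h - row_sum d p r h) / fact d"
    and "(\<forall>r<p. row_sum d p r h = row_sum d p 0 h) \<Longrightarrow>
      coeff (diff_poly d p h r) (d - 1) = real d / fact d * slack d p r h"
proof -
  show "coeff (diff_poly d p h r) d =
      (row_sum d p (if r + 1 < p then r + 1 else 0) h - row_sum d p r h) / fact d"
    using coeff_row_poly_shift(1)[OF assms(1)]
    by (simp add: diff_poly_def coeff_row_poly diff_divide_distrib)
  assume ve: "\<forall>r<p. row_sum d p r h = row_sum d p 0 h"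
  define A where "A = (real d * real d - real d * (real d - 1) / 2) / fact d"
  define B where "B = real d / fact d"
  have c: "coeff (row_poly d p h s) (d - 1) = A * row_sum d p 0 h - B * moment d p s h" if "s < p" for s
  proof -
    have "row_sum d p s h = row_sum d p 0 h" using ve that by blast
    then show ?thesis
      unfolding coeff_row_poly(2)[OF assms(1)] A_def B_def by (rule arg_cong)
  qed
  have r0: "row_sum d p r h = row_sum d p 0 h" using ve assms(2) by blast
  have "coeff (diff_poly d p h r) (d - 1) = B * slack d p r h"
  proof (cases "r + 1 < p")
    case True
    then have "coeff (diff_poly d p h r) (d - 1) = coeff (row_poly d p h (r + 1)) (d - 1) - coeff (row_poly d p h r) (d - 1)"
      by (simp only: diff_poly_def if_True coeff_diff)
    with True show ?thesis
      by (simp only: c[OF True] c[OF assms(2)] slack_def if_True right_diff_distrib)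
  next
    case False
    have "0 < p" using assms(2) by simp
    have "coeff (diff_poly d p h r) (d - 1) =
        (coeff (row_poly d p h 0) (d - 1) + B * row_sum d p 0 h) - coeff (row_poly d p h r) (d - 1)"
      using False by (simp only: diff_poly_def if_False coeff_diff coeff_row_poly_shift(2)[OF assms(1)] B_def)
    with False show ?thesis
      by (simp only: c[OF \<open>0 < p\<close>] c[OF assms(2)] slack_def r0 if_False right_diff_distrib distrib_left)
  qed
  then show "coeff (diff_poly d p h r) (d - 1) = real d / fact d * slack d p r h"
    by (simp only: B_def)
qed

subsection \<open>Polyhedral cones and their extreme rays\<close>

text \<open>The motion from \<open>x\<close> along \<open>y\<close> stops when the first constraint
  becomes tight. Constraints tight at \<open>x\<close> stay tight, so the set of non-tight ones
  strictly shrinks.\<close>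

lemma slide_to_face:
  fixes A :: "('a::real_vector \<Rightarrow> real) set"
  assumes "finite A" and lin: "\<And>a. a \<in> A \<Longrightarrow> linear a"
    and x: "\<And>a. a \<in> A \<Longrightarrow> 0 \<le> a x" and y: "\<And>a. a \<in> A \<Longrightarrow> a x = 0 \<Longrightarrow> a y = 0"
    and neg: "\<exists>a\<in>A. a y < 0"
  shows "\<exists>t>0. (\<forall>a\<in>A. 0 \<le> a (x + t *\<^sub>R y)) \<and> {a \<in> A. a (x + t *\<^sub>R y) \<noteq> 0} \<subset> {a \<in> A. a x \<noteq> 0}"
proof -
  define T where "T = {a \<in> A. a y < 0}"
  define t where "t = Min ((\<lambda>a. a x / - a y) ` T)"
  have T: "finite T" "T \<noteq> {}" using assms(1) neg by (auto simp: T_def)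
  have "t \<in> (\<lambda>a. a x / - a y) ` T" unfolding t_def using T by (intro Min_in) auto
  then obtain b where b: "b \<in> T" "t = b x / - b y" by blast
  have tle: "t \<le> a x / - a y" if "a \<in> T" for a
    unfolding t_def using T that by (intro Min_le) auto
  have eq: "a (x + t *\<^sub>R y) = a x + t * a y" if "a \<in> A" for a
    using lin[OF that] by (simp add: linear_add linear_cmul)
  have bA: "b \<in> A" "b y < 0" using b by (auto simp: T_def)
  have bx: "0 < b x" using x[OF bA(1)] y[OF bA(1)] bA(2) by force
  have t0: "0 < t" unfolding b(2) using bx bA(2) by (intro divide_pos_pos) auto
  have "0 \<le> a (x + t *\<^sub>R y)" if "a \<in> A" for a
  proof (cases "a y < 0")
    case True
    then show ?thesis using tle[of a] that by (simp add: T_def eq field_simps)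
  next
    case False
    then show ?thesis using x[OF that] t0 by (simp add: eq[OF that])
  qed
  moreover have "b (x + t *\<^sub>R y) = 0"
    by (subst eq[OF bA(1)]) (use bA in \<open>simp add: b(2)\<close>)
  moreover have "a (x + t *\<^sub>R y) = 0" if "a \<in> A" "a x = 0" for a
    using y[OF that] that by (simp add: eq)
  ultimately show ?thesis using t0 bA bx by (intro exI[of _ t]) auto
qed

text \<open>Induction on the number of non-tight constraints. A direction that respects the tight
  constraints and leaves the cone both ways exhibits \<open>x\<close> as a convex combination of two
  points with more tight constraints. Extreme rays are thus handled by producing such a direction
  for all other points.\<close>

lemma cone_generated_by_extreme_points:
  fixes A :: "('a::real_vector \<Rightarrow> real) set"
  assumes "finite A" and lin: "\<And>a. a \<in> A \<Longrightarrow> linear a" and W: "subspace W"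
    and ext: "\<And>x. x \<in> W \<Longrightarrow> (\<And>a. a \<in> A \<Longrightarrow> 0 \<le> a x) \<Longrightarrow> x \<in> fcone G \<or>
      (\<exists>y\<in>W. (\<forall>a\<in>A. a x = 0 \<longrightarrow> a y = 0) \<and> (\<exists>a\<in>A. a y < 0) \<and> (\<exists>a\<in>A. 0 < a y))"
    and x: "x \<in> W" "\<And>a. a \<in> A \<Longrightarrow> 0 \<le> a x"
  shows "x \<in> fcone G"
  using x
proof (induction "card {a \<in> A. a x \<noteq> 0}" arbitrary: x rule: less_induct)
  case less
  show ?case
  proof (rule ccontr)
    assume "x \<notin> fcone G"
    then obtain y where y: "y \<in> W" "\<And>a. a \<in> A \<Longrightarrow> a x = 0 \<Longrightarrow> a y = 0" "\<exists>a\<in>A. a y < 0" "\<exists>a\<in>A. 0 < a y"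
      using ext[of x] less.prems by blast
    have step: "\<exists>t>0. x + t *\<^sub>R y \<in> fcone G"
      if y: "y \<in> W" "\<And>a. a \<in> A \<Longrightarrow> a x = 0 \<Longrightarrow> a y = 0" "\<exists>a\<in>A. a y < 0" for y
    proof -
      obtain t where t: "0 < t" "\<forall>a\<in>A. 0 \<le> a (x + t *\<^sub>R y)"
          "{a \<in> A. a (x + t *\<^sub>R y) \<noteq> 0} \<subset> {a \<in> A. a x \<noteq> 0}"
        using slide_to_face[of A x y] assms(1) lin less.prems(2) y(2,3) by blast
      have "card {a \<in> A. a (x + t *\<^sub>R y) \<noteq> 0} < card {a \<in> A. a x \<noteq> 0}"
        using t(3) assms(1) by (intro psubset_card_mono) auto
      moreover have "x + t *\<^sub>R y \<in> W"
        using W less.prems(1) y(1) by (simp add: subspace_add subspace_scale)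
      ultimately show ?thesis using less.hyps t by blast
    qed
    obtain s where s: "0 < s" "x + s *\<^sub>R y \<in> fcone G" using step[of y] y(1-3) by blast
    have "\<exists>t>0. x + t *\<^sub>R (- y) \<in> fcone G"
      using y(2,4) lin by (intro step) (auto simp: subspace_neg[OF W y(1)] linear_neg)
    then obtain t where t: "0 < t" "x + t *\<^sub>R (- y) \<in> fcone G" by blast
    have "(t / (s + t)) *\<^sub>R (x + s *\<^sub>R y) + (s / (s + t)) *\<^sub>R (x + t *\<^sub>R (- y)) = x"
    proof -
      have "(t / (s + t)) *\<^sub>R (x + s *\<^sub>R y) + (s / (s + t)) *\<^sub>R (x + t *\<^sub>R (- y)) = (t / (s + t) + s / (s + t)) *\<^sub>R x"
        by (simp add: algebra_simps)
      also have "t / (s + t) + s / (s + t) = 1" using s(1) t(1) by (simp add: add_divide_distrib[symmetric])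
      finally show ?thesis by simp
    qed
    moreover have "(t / (s + t)) *\<^sub>R (x + s *\<^sub>R y) + (s / (s + t)) *\<^sub>R (x + t *\<^sub>R (- y)) \<in> fcone G"
      by (intro fcone_add[OF fcone_scaleR[OF s(2)] fcone_scaleR[OF t(2)]]) (use s(1) t(1) in auto)
    ultimately show False using \<open>x \<notin> fcone G\<close> by simp
  qed
qed

text \<open>Along \<open>- w\<close> every constraint decreases, so surviving an infinitesimal push
  means having been strict before it.\<close>

lemma strict_iff_eventually:
  fixes A :: "('a::real_vector \<Rightarrow> real) set"
  assumes "finite A" "\<And>a. a \<in> A \<Longrightarrow> linear a" "\<And>a. a \<in> A \<Longrightarrow> 0 < a w"
  shows "(\<forall>\<^sub>F e in at_right 0. \<forall>a\<in>A. 0 \<le> a (x + e *\<^sub>R (- w))) \<longleftrightarrow> (\<forall>a\<in>A. 0 < a x)"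
proof -
  have eq: "a (x + e *\<^sub>R (- w)) = a x + e * (- a w)" if "a \<in> A" for a e
    using assms(2)[OF that] by (simp add: linear_add linear_cmul linear_neg linear_diff)
  show ?thesis
  proof
    assume ev: "\<forall>\<^sub>F e in at_right 0. \<forall>a\<in>A. 0 \<le> a (x + e *\<^sub>R (- w))"
    show "\<forall>a\<in>A. 0 < a x"
    proof (rule ballI, rule ccontr)
      fix a assume a: "a \<in> A" "\<not> 0 < a x"
      then have "\<forall>\<^sub>F e in at_right 0. a x + e * (- a w) < 0"
        using assms(3)[OF a(1)] by (intro eventually_at_right_affine_neg) auto
      with ev have "\<forall>\<^sub>F e in at_right (0::real). False"
        by eventually_elim (use a eq in force)
      then show False by simp
    qed
  next
    assume s: "\<forall>a\<in>A. 0 < a x"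
    show "\<forall>\<^sub>F e in at_right 0. \<forall>a\<in>A. 0 \<le> a (x + e *\<^sub>R (- w))"
    proof (intro eventually_ball_finite assms(1) ballI)
      fix a assume a: "a \<in> A"
      then have "\<forall>\<^sub>F e in at_right 0. 0 < a x + e * (- a w)"
        using s by (intro eventually_at_right_affine_pos) auto
      then show "\<forall>\<^sub>F e in at_right 0. 0 \<le> a (x + e *\<^sub>R (- w))"
        by eventually_elim (simp only: eq[OF a] less_imp_le)
    qed
  qed
qed

subsection \<open>The cone of vectors with weakly satisfied first-level inequalities\<close>

definition unit_vec :: "nat \<Rightarrow> nat \<Rightarrow> nat \<Rightarrow> nat \<Rightarrow> real" where
  "unit_vec p r j = (\<lambda>i. of_bool (i = j * p + r))"

lemma index_eq_iff:
  fixes p :: nat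
  assumes "r < p" "s < p"
  shows "j * p + r = k * p + s \<longleftrightarrow> j = k \<and> r = s"
proof
  assume eq: "j * p + r = k * p + s"
  then have "(j * p + r) mod p = (k * p + s) mod p" "(j * p + r) div p = (k * p + s) div p" by simp_all
  then show "j = k \<and> r = s" using assms by simp
qed simp

lemma index_less:
  fixes p :: nat
  assumes "r < p" "j \<le> d"
  shows "j * p + r < p * (d + 1)"
proof -
  have "j * p \<le> d * p" using assms(2) by (rule mult_le_mono1)
  then have "j * p + r < d * p + p" using assms(1) by linarith
  then show ?thesis by (simp add: algebra_simps)
qed

lemma index_div_le:
  fixes p :: nat
  assumes "i < p * (d + 1)"
  shows "i div p \<le> d"
  using assms by (simp add: less_mult_imp_div_less mult.commute less_Suc_eq_le[symmetric] del: mult_Suc mult_Suc_right)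

lemma linear_row_sum: "linear (row_sum d p r)"
  by (rule linear_funI) (simp_all add: row_sum_def sum.distrib sum_distrib_left)

lemma linear_moment: "linear (moment d p r)"
  by (rule linear_funI) (simp_all add: moment_def sum.distrib sum_distrib_left algebra_simps)

lemma linear_coord: "linear (\<lambda>h :: nat \<Rightarrow> real. h i)"
  by (rule linear_funI) simp_all

lemma linear_slack: "linear (slack d p r)"
proof (cases "r + 1 < p")
  case True
  then have "slack d p r = (\<lambda>h. moment d p r h - moment d p (r + 1) h)"
    by (simp add: slack_def fun_eq_iff)
  then show ?thesis by (simp only: linear_compose_sub linear_moment)
next
  case False
  then have "slack d p r = (\<lambda>h. moment d p r h + row_sum d p r h - moment d p 0 h)"
    by (simp add: slack_def fun_eq_iff)
  then show ?thesis
    by (simp only: linear_compose_sub[OF linear_compose_add] linear_moment linear_row_sum)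
qed

lemma row_sum_unit_vec:
  assumes "r < p" "s < p" "j \<le> d"
  shows "row_sum d p s (unit_vec p r j) = of_bool (s = r)"
    and "moment d p s (unit_vec p r j) = of_bool (s = r) * real j"
proof -
  have "row_sum d p s (unit_vec p r j) = (\<Sum>k\<le>d. if k = j then of_bool (s = r) else 0)"
    unfolding row_sum_def unit_vec_def using assms by (intro sum.cong) (auto simp: index_eq_iff)
  then show "row_sum d p s (unit_vec p r j) = of_bool (s = r)" using assms by simp
  have "moment d p s (unit_vec p r j) = (\<Sum>k\<le>d. if k = j then of_bool (s = r) * real j else 0)"
    unfolding moment_def unit_vec_def using assms by (intro sum.cong) (auto simp: index_eq_iff)
  then show "moment d p s (unit_vec p r j) = of_bool (s = r) * real j" using assms by simp
qed

text \<open>The subspace of the volume equalities, which will turn out to be the linear span of the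
  cone.\<close>

definition balanced :: "nat \<Rightarrow> nat \<Rightarrow> (nat \<Rightarrow> real) set" where
  "balanced d p = {h. (\<forall>i\<ge>p * (d + 1). h i = 0) \<and> (\<forall>r. 0 < r \<and> r < p \<longrightarrow> row_sum d p r h = row_sum d p 0 h)}"

lemma balancedI:
  assumes "\<And>i. p * (d + 1) \<le> i \<Longrightarrow> h i = 0" "\<And>r. r < p \<Longrightarrow> row_sum d p r h = c"
  shows "h \<in> balanced d p"
  unfolding balanced_def
proof (intro CollectI conjI allI impI)
  fix r assume "0 < r \<and> r < p"
  then show "row_sum d p r h = row_sum d p 0 h" using assms(2)[of r] assms(2)[of 0] by linarith
qed (rule assms(1))

lemma balancedD:
  assumes "h \<in> balanced d p"
  shows "p * (d + 1) \<le> i \<Longrightarrow> h i = 0" "r < p \<Longrightarrow> row_sum d p r h = row_sum d p 0 h"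
  using assms by (cases "r = 0"; simp add: balanced_def)+

definition constraints :: "nat \<Rightarrow> nat \<Rightarrow> ((nat \<Rightarrow> real) \<Rightarrow> real) set" where
  "constraints d p = (\<lambda>i h. h i) ` {..<p * (d + 1)} \<union> slack d p ` {..<p}"

text \<open>The cone over \<open>S1\<close>: its slice at volume 1 is identified with
  \<open>S1\<close> below.\<close>

definition weak_cone :: "nat \<Rightarrow> nat \<Rightarrow> (nat \<Rightarrow> real) set" where
  "weak_cone d p = {h \<in> balanced d p. \<forall>a\<in>constraints d p. 0 \<le> a h}"

definition lattice :: "nat \<Rightarrow> nat \<Rightarrow> (nat \<Rightarrow> real) set" where
  "lattice d p = {h. (\<forall>i. h i \<in> \<int>) \<and> (\<forall>i\<ge>p * (d + 1). h i = 0)}"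

lemma finite_constraints: "finite (constraints d p)"
  by (simp add: constraints_def)

lemma linear_constraints: "a \<in> constraints d p \<Longrightarrow> linear a"
  by (auto simp: constraints_def linear_coord linear_slack)

lemma subspace_balanced: "subspace (balanced d p)"
  by (auto simp: subspace_def balanced_def linear_add[OF linear_row_sum] linear_cmul[OF linear_row_sum]
      linear_0[OF linear_row_sum])

lemma vol_eq: "vol d p = row_sum d p 0"
  by (simp add: vol_def row_sum_def hh_def fun_eq_iff)

lemma ball_constraints:
  "(\<forall>a\<in>constraints d p. P a) \<longleftrightarrow> (\<forall>i<p * (d + 1). P (\<lambda>h. h i)) \<and> (\<forall>r<p. P (slack d p r))"
  by (auto simp: constraints_def)

lemma bex_constraints:
  "(\<exists>a\<in>constraints d p. P a) \<longleftrightarrow> (\<exists>i<p * (d + 1). P (\<lambda>h. h i)) \<or> (\<exists>r<p. P (slack d p r))"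
  by (auto simp: constraints_def)

text \<open>An entry is at most its row sum, and all row sums equal the volume. Hence level sets
  contain finitely many lattice points, the slice at volume 1 is bounded, and volume 0 forces the
  zero vector.\<close>

lemma balanced_le_volume:
  assumes "x \<in> balanced d p" "0 < p" "\<And>i. i < p * (d + 1) \<Longrightarrow> 0 \<le> x i"
  shows "0 \<le> x i" "x i \<le> row_sum d p 0 x"
proof -
  show nn: "0 \<le> x i" for i using assms by (cases "i < p * (d + 1)") (auto simp: balanced_def)
  show "x i \<le> row_sum d p 0 x"
  proof (cases "i < p * (d + 1)")
    case True
    have "x i = x ((i div p) * p + i mod p)" by simp
    also have "\<dots> \<le> row_sum d p (i mod p) x"
      unfolding row_sum_def using index_div_le[OF True] nn
      by (intro member_le_sum[where f = "\<lambda>j. x (j * p + i mod p)"]) auto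
    also have "\<dots> = row_sum d p 0 x"
    proof -
      have "i mod p < p" using assms(2) by simp
      then show ?thesis by (rule balancedD(2)[OF assms(1)])
    qed
    finally show ?thesis .
  next
    case False
    then show ?thesis using assms nn by (auto simp: balanced_def row_sum_def intro!: sum_nonneg)
  qed
qed

lemma finite_lattice_points:
  assumes "0 < p"
  shows "finite {x \<in> lattice d p \<inter> balanced d p. (\<forall>i<p * (d + 1). 0 \<le> x i) \<and> row_sum d p 0 x = real V}"
proof (rule finite_subset)
  show "finite {x. \<forall>i. (i \<in> {..<p * (d + 1)} \<longrightarrow> x i \<in> real ` {..V}) \<and> (i \<notin> {..<p * (d + 1)} \<longrightarrow> x i = 0)}"
    by (intro finite_set_of_finite_funs) auto
  show "{x \<in> lattice d p \<inter> balanced d p. (\<forall>i<p * (d + 1). 0 \<le> x i) \<and> row_sum d p 0 x = real V} \<subseteq>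
      {x. \<forall>i. (i \<in> {..<p * (d + 1)} \<longrightarrow> x i \<in> real ` {..V}) \<and> (i \<notin> {..<p * (d + 1)} \<longrightarrow> x i = 0)}"
  proof (intro subsetI CollectI allI conjI impI)
    fix x i assume x: "x \<in> {x \<in> lattice d p \<inter> balanced d p. (\<forall>i<p * (d + 1). 0 \<le> x i) \<and> row_sum d p 0 x = real V}"
    assume i: "i \<in> {..<p * (d + 1)}"
    have "0 \<le> x i" "x i \<le> real V" using balanced_le_volume[of x d p i] x assms by auto
    moreover have "x i \<in> \<int>" using x by (simp add: lattice_def)
    then obtain k where "x i = of_int k" by (rule Ints_cases)
    ultimately have "x i = real (nat k)" "nat k \<le> V" by simp_all
    then show "x i \<in> real ` {..V}" by blast
  qed (auto simp: lattice_def)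
qed

text \<open>Applied to \<open>y\<close> and to \<open>- y\<close>, this shows that a nonzero
  direction of volume 0 leaves the nonnegative orthant both ways.\<close>

lemma balanced_sign_change:
  assumes "y \<in> balanced d p" "row_sum d p 0 y = 0" "y \<noteq> 0" "0 < p"
  shows "\<exists>i<p * (d + 1). y i < 0"
proof (rule ccontr)
  assume "\<not> ?thesis"
  then have nn: "\<And>i. i < p * (d + 1) \<Longrightarrow> 0 \<le> y i" by (meson not_less)
  have "y i = 0" for i
    using balanced_le_volume[OF assms(1,4) nn, of i] assms(2) by linarith
  then have "y = 0" by (simp add: fun_eq_iff)
  with assms(3) show False by simp
qed

lemma unit_vec_outside:
  assumes "r < p" "j \<le> d" "p * (d + 1) \<le> i"
  shows "unit_vec p r j i = 0"
  using index_less[OF assms(1,2)] assms(3) by (auto simp: unit_vec_def)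

lemma slack_eq_0:
  assumes "0 < p" "r < p" "\<And>s. s < p \<Longrightarrow> row_sum d p s y = 0" "\<And>s. s < p \<Longrightarrow> moment d p s y = 0"
  shows "slack d p r y = 0"
  using assms by (simp add: slack_def)

lemma sum_two_nonzero:
  fixes f :: "nat \<Rightarrow> real"
  assumes "a \<le> d" "b \<le> d" "a \<noteq> b" "\<And>c. c \<le> d \<Longrightarrow> c \<noteq> a \<Longrightarrow> c \<noteq> b \<Longrightarrow> f c = 0"
  shows "(\<Sum>j\<le>d. f j) = f a + f b"
proof -
  have "(\<Sum>j\<le>d. f j) = (\<Sum>j\<in>{a, b}. f j)"
    using assms by (intro sum.mono_neutral_right) auto
  then show ?thesis using assms(3) by simp
qed

lemma sum_one_nonzero:
  fixes f :: "nat \<Rightarrow> real"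
  assumes "a \<le> d" "\<And>c. c \<le> d \<Longrightarrow> c \<noteq> a \<Longrightarrow> f c = 0"
  shows "(\<Sum>j\<le>d. f j) = f a"
proof -
  have "(\<Sum>j\<le>d. f j) = (\<Sum>j\<in>{a}. f j)"
    using assms by (intro sum.mono_neutral_right) auto
  then show ?thesis by simp
qed

text \<open>All lattice points of the cone at height lcm(1, ..., d) are taken, not only those on
  extreme rays. The set is finite, contains a multiple of each extreme ray, and has a single height,
  which becomes the period.\<close>

definition generators :: "nat \<Rightarrow> nat \<Rightarrow> (nat \<Rightarrow> real) set" where
  "generators d p = {g \<in> weak_cone d p \<inter> lattice d p. row_sum d p 0 g = real (Lcm {1..d})}"

lemma finite_generators:
  assumes "0 < p"
  shows "finite (generators d p)"
  by (rule finite_subset[OF _ finite_lattice_points[OF assms, where V = "Lcm {1..d}"]])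
    (auto simp: generators_def weak_cone_def ball_constraints)

text \<open>On an extreme ray every row has at most two nonzero entries, and its mean is an integer:
  otherwise all rows whose means differ from it by integers can be shifted simultaneously without
  leaving any tight constraint. A row with mean \<open>k\<close> supported on \<open>{a, b}\<close> has entries with
  denominator dividing \<open>a - b\<close>.\<close>

lemma extreme_rays:
  assumes d: "0 < d" and p: "0 < p" and x: "x \<in> balanced d p" "\<And>a. a \<in> constraints d p \<Longrightarrow> 0 \<le> a x"
  shows "x \<in> fcone (generators d p) \<or>
    (\<exists>y\<in>balanced d p. (\<forall>a\<in>constraints d p. a x = 0 \<longrightarrow> a y = 0) \<and>
      (\<exists>a\<in>constraints d p. a y < 0) \<and> (\<exists>a\<in>constraints d p. 0 < a y))"
    (is "_ \<or> ?Y")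
proof -
  define V where "V = row_sum d p 0 x"
  define m where "m = Lcm {1..d}"
  have m0: "0 < m" unfolding m_def by (intro Nat.gr0I) (simp add: Lcm_0_iff)
  have xc: "0 \<le> x i" if "i < p * (d + 1)" for i
    using x(2)[of "\<lambda>h. h i"] that by (auto simp: constraints_def)
  have nn: "0 \<le> x i" for i using balanced_le_volume(1)[OF x(1) p xc] .
  have sl: "0 \<le> slack d p r x" if "r < p" for r
    using x(2)[of "slack d p r"] that by (auto simp: constraints_def)
  have rs: "row_sum d p r x = V" if "r < p" for r
    unfolding V_def using balancedD(2)[OF x(1) that] .
  have xle: "x i \<le> V" for i unfolding V_def using balanced_le_volume(2)[OF x(1) p xc] .
  have witness: ?Y
    if y: "y \<in> balanced d p" "row_sum d p 0 y = 0" "y \<noteq> 0"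
      and z: "\<And>i. x i = 0 \<Longrightarrow> y i = 0" "\<And>r. r < p \<Longrightarrow> slack d p r x = 0 \<Longrightarrow> slack d p r y = 0" for y
  proof (intro bexI[OF _ y(1)] conjI)
    show "\<forall>a\<in>constraints d p. a x = 0 \<longrightarrow> a y = 0"
      unfolding ball_constraints using z by blast
    show "\<exists>a\<in>constraints d p. a y < 0"
      unfolding bex_constraints using balanced_sign_change[OF y p] by blast
    have "row_sum d p 0 (- y) = 0" using y(2) linear_neg[OF linear_row_sum] by simp
    moreover have "- y \<noteq> 0" using y(3) by (simp only: neg_equal_0_iff_equal not_False_eq_True)
    ultimately have "\<exists>i<p * (d + 1). (- y) i < 0"
      using balanced_sign_change[OF subspace_neg[OF subspace_balanced y(1)] _ _ p] by blast
    then show "\<exists>a\<in>constraints d p. 0 < a y"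
      unfolding bex_constraints by auto
  qed
  consider "V = 0"
    | r a b c where "r < p" "a \<le> d" "b \<le> d" "c \<le> d" "a \<noteq> b" "b \<noteq> c" "a \<noteq> c"
        "0 < x (a * p + r)" "0 < x (b * p + r)" "0 < x (c * p + r)"
    | r where "0 < V" "r < p" "moment d p r x / V \<notin> \<int>"
    | "0 < V" "\<And>r. r < p \<Longrightarrow> moment d p r x / V \<in> \<int>"
        "\<And>r a b c. r < p \<Longrightarrow> a \<le> d \<Longrightarrow> b \<le> d \<Longrightarrow> c \<le> d \<Longrightarrow> a \<noteq> b \<Longrightarrow> b \<noteq> c \<Longrightarrow> a \<noteq> c \<Longrightarrow>
          0 < x (a * p + r) \<Longrightarrow> 0 < x (b * p + r) \<Longrightarrow> x (c * p + r) = 0"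
  proof (cases "V = 0")
    case False
    then have V0: "0 < V" using nn[of 0] xle[of 0] by linarith
    show thesis
    proof (cases "\<exists>r<p. moment d p r x / V \<notin> \<int>")
      case True
      then show thesis using that(3) V0 by blast
    next
      case nint: False
      show thesis
      proof (cases "\<exists>r a b c. r < p \<and> a \<le> d \<and> b \<le> d \<and> c \<le> d \<and> a \<noteq> b \<and> b \<noteq> c \<and> a \<noteq> c \<and>
          0 < x (a * p + r) \<and> 0 < x (b * p + r) \<and> 0 < x (c * p + r)")
        case True
        then show thesis using that(2) by blast
      next
        case False
        have "x i = 0" if "\<not> 0 < x i" for i using nn[of i] that by linarith
        with False V0 nint show thesis using that(4) by blast
      qed
    qed
  qed (rule that(1))
  then show ?thesis
  proof cases
    case 1
    then have "x = 0" using nn xle by (auto simp: fun_eq_iff intro: antisym)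
    then show ?thesis by (simp add: fcone_zero)
  next
    case (2 r a b c)
    \<comment> \<open>The coefficients of the affine dependence between the points (1, a), (1, b)
      and (1, c), so that neither the row sum nor the moment changes.\<close>
    define y where "y = (real c - real b) *\<^sub>R unit_vec p r a + (real a - real c) *\<^sub>R unit_vec p r b +
      (real b - real a) *\<^sub>R unit_vec p r c"
    have ry: "row_sum d p s y = 0" if "s < p" for s
      unfolding y_def using 2 that
      by (simp add: linear_add[OF linear_row_sum] linear_cmul[OF linear_row_sum] row_sum_unit_vec)
    have my: "moment d p s y = 0" if "s < p" for s
      unfolding y_def using 2 that
      by (simp add: linear_add[OF linear_moment] linear_cmul[OF linear_moment] row_sum_unit_vec)
        (simp add: field_simps)
    have ?Y
    proof (rule witness)
      show "y \<in> balanced d p"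
        using ry 2 by (intro balancedI) (simp_all add: y_def unit_vec_outside)
      show "row_sum d p 0 y = 0" using ry p by simp
      have "y (a * p + r) = real c - real b"
        using 2 by (simp add: y_def unit_vec_def)
      then show "y \<noteq> 0" using 2 by auto
      show "y i = 0" if "x i = 0" for i
        using 2 that by (auto simp: y_def unit_vec_def)
      show "slack d p s y = 0" if "s < p" for s
        using p that ry my by (rule slack_eq_0)
    qed
    then show ?thesis ..
  next
    case (3 r0)
    \<comment> \<open>If a slack is 0, the means of the two adjacent rows differ by 0, or by 1 at
      the wraparound. So \<open>R\<close> contains both of these rows or neither, and moving the
      moments of all rows of \<open>R\<close> equally keeps the slack at 0.\<close>
    define R where "R = {s. s < p \<and> (moment d p s x - moment d p r0 x) / V \<in> \<int>}"
    have finR: "finite R" by (simp add: R_def)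
    \<comment> \<open>A row with a single positive entry in column j has the integral mean j, and
      then the mean of \<open>r0\<close> would be integral as well.\<close>
    have "\<exists>i j. i < j \<and> j \<le> d \<and> 0 < x (i * p + s) \<and> 0 < x (j * p + s)" if s: "s \<in> R" for s
    proof (rule ccontr)
      assume no: "\<not> ?thesis"
      have sp: "s < p" using s by (simp add: R_def)
      have "\<exists>j\<le>d. 0 < x (j * p + s)"
      proof (rule ccontr)
        assume "\<not> ?thesis"
        then have "row_sum d p s x \<le> 0" unfolding row_sum_def by (intro sum_nonpos) (auto simp: not_less)
        then show False using rs[OF sp] 3(1) by simp
      qed
      then obtain j where j: "j \<le> d" "0 < x (j * p + s)" by blast
      have z: "x (k * p + s) = 0" if "k \<le> d" "k \<noteq> j" for k
      proof -
        have "\<not> 0 < x (k * p + s)" using no j that by (metis linorder_neqE_nat)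
        then show ?thesis using nn[of "k * p + s"] by simp
      qed
      have "row_sum d p s x = x (j * p + s)"
        unfolding row_sum_def using j z by (intro sum_one_nonzero) auto
      moreover have "moment d p s x = real j * x (j * p + s)"
        unfolding moment_def using j z by (intro sum_one_nonzero) auto
      ultimately have "moment d p s x / V = real j" using rs[OF sp] 3(1) by simp
      moreover have "moment d p s x / V - (moment d p s x - moment d p r0 x) / V = moment d p r0 x / V"
        by (simp add: diff_divide_distrib)
      ultimately have "moment d p r0 x / V \<in> \<int>"
        using s Ints_diff[of "moment d p s x / V" "(moment d p s x - moment d p r0 x) / V"]
        by (simp add: R_def)
      with 3 show False by simp
    qed
    then obtain ii jj where ij: "\<And>s. s \<in> R \<Longrightarrow> ii s < jj s \<and> jj s \<le> d \<and> 0 < x (ii s * p + s) \<and> 0 < x (jj s * p + s)"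
      by metis
    \<comment> \<open>In each row of \<open>R\<close>, mass is moved from column \<open>ii s\<close>
      to column \<open>jj s\<close>. The factor normalises the change of every moment to 1.\<close>
    define y where "y = (\<Sum>s\<in>R. (1 / (real (jj s) - real (ii s))) *\<^sub>R (unit_vec p s (jj s) - unit_vec p s (ii s)))"
    have ry: "row_sum d p t y = 0" if "t < p" for t
      unfolding y_def linear_sum[OF linear_row_sum] linear_cmul[OF linear_row_sum] linear_diff[OF linear_row_sum]
      using ij that by (intro sum.neutral) (fastforce simp: R_def row_sum_unit_vec)
    have my: "moment d p t y = of_bool (t \<in> R)" if "t < p" for t
    proof -
      have "moment d p t y = (\<Sum>s\<in>R. if s = t then 1 else 0)"
        unfolding y_def linear_sum[OF linear_moment] linear_cmul[OF linear_moment] linear_diff[OF linear_moment]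
      proof (rule sum.cong[OF refl])
        fix s assume s: "s \<in> R"
        then have "s < p" "ii s \<le> d" "jj s \<le> d" "ii s < jj s" using ij[OF s] by (auto simp: R_def)
        then show "(1 / (real (jj s) - real (ii s))) *\<^sub>R (moment d p t (unit_vec p s (jj s)) - moment d p t (unit_vec p s (ii s)))
            = (if s = t then 1 else 0)"
          using that by (cases "s = t") (auto simp: row_sum_unit_vec)
      qed
      also have "\<dots> = of_bool (t \<in> R)" using finR by simp
      finally show ?thesis .
    qed
    have r0R: "r0 \<in> R" using 3 by (simp add: R_def)
    have ?Y
    proof (rule witness)
      show "y \<in> balanced d p"
      proof (rule balancedI[OF _ ry])
        fix i assume "p * (d + 1) \<le> i"
        then show "y i = 0"
          unfolding y_def sum_fun_apply using ij
          by (intro sum.neutral) (fastforce simp: R_def unit_vec_outside[where d = d])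
      qed
      show "row_sum d p 0 y = 0" using ry p by simp
      show "y \<noteq> 0"
      proof
        assume "y = 0"
        then have "moment d p r0 y = 0" using linear_0[OF linear_moment] by simp
        then show False using my[OF 3(2)] r0R by simp
      qed
      show "y i = 0" if "x i = 0" for i
        unfolding y_def sum_fun_apply
      proof (intro sum.neutral ballI)
        fix s assume "s \<in> R"
        from ij[OF this] that
        show "((1 / (real (jj s) - real (ii s))) *\<^sub>R (unit_vec p s (jj s) - unit_vec p s (ii s))) i = 0"
          by (auto simp: unit_vec_def)
      qed
      fix t assume t: "t < p" and sl0: "slack d p t x = 0"
      show "slack d p t y = 0"
      proof (cases "t + 1 < p")
        case True
        then have "moment d p t x = moment d p (t + 1) x" using sl0 by (simp add: slack_def)
        then have "t \<in> R \<longleftrightarrow> t + 1 \<in> R" using t True by (simp add: R_def)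
        then show ?thesis using my[OF t] my[OF True] True by (simp add: slack_def)
      next
        case False
        then have "moment d p 0 x = moment d p t x + V" using sl0 rs[OF t] by (simp add: slack_def)
        then have "(moment d p 0 x - moment d p r0 x) / V = (moment d p t x - moment d p r0 x) / V + 1"
          using 3(1) by (simp add: field_simps)
        moreover have "u + 1 \<in> \<int> \<longleftrightarrow> u \<in> \<int>" for u :: real
          using Ints_add[of u 1] Ints_diff[of "u + 1" 1] by auto
        ultimately have "0 \<in> R \<longleftrightarrow> t \<in> R" using t p by (simp add: R_def)
        then show ?thesis using my[OF t] my[OF p] ry[OF t] False by (simp add: slack_def)
      qed
    qed
    then show ?thesis ..
  next
    case 4
    define z where "z = (real m / V) *\<^sub>R x"
    have zi: "z i \<in> \<int>" for i
    proof (cases "x i = 0 \<or> p * (d + 1) \<le> i")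
      case True
      then have "x i = 0" using balancedD(1)[OF x(1)] by blast
      then show ?thesis by (simp add: z_def)
    next
      case False
      define r where "r = i mod p"
      define a where "a = i div p"
      have i: "i = a * p + r" and r: "r < p" using p by (simp_all add: r_def a_def)
      have a: "a \<le> d" using index_div_le[of i p d] False by (simp add: a_def not_le)
      have xa: "0 < x (a * p + r)" using nn[of i] False i by simp
      obtain k where k: "moment d p r x / V = of_int k" using 4(2)[OF r] by (rule Ints_cases)
      then have kV: "moment d p r x = of_int k * V" using 4(1) by (simp add: field_simps)
      show ?thesis
      proof (cases "\<exists>b\<le>d. b \<noteq> a \<and> 0 < x (b * p + r)")
        case True
        then obtain b where b: "b \<le> d" "b \<noteq> a" "0 < x (b * p + r)" by blast
        have zz: "x (c * p + r) = 0" if "c \<le> d" "c \<noteq> a" "c \<noteq> b" for c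
          using 4(3)[OF r a b(1) that(1)] that b xa by simp
        have "row_sum d p r x = x (a * p + r) + x (b * p + r)"
          unfolding row_sum_def using a b zz by (intro sum_two_nonzero) auto
        then have s1: "x (b * p + r) = V - x i" using rs[OF r] i by simp
        have "moment d p r x = real a * x (a * p + r) + real b * x (b * p + r)"
          unfolding moment_def using a b zz by (intro sum_two_nonzero) auto
        then have "of_int k * V = real a * x i + real b * (V - x i)"
          unfolding kV s1 i[symmetric] .
        \<comment> \<open>Row sum and moment determine the entry: x i = V (k - b) / (a - b). The
          factor \<open>m\<close> clears the denominator because |a - b| lies between 1 and
          \<open>d\<close>.\<close>
        then have s2: "x i * (real a - real b) = (of_int k - real b) * V"
          by (simp add: algebra_simps)
        have "\<exists>q::int. real m = of_int q * (real a - real b)"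
        proof (cases "b < a")
          case True
          then have "a - b dvd m" unfolding m_def using a by (intro dvd_Lcm) auto
          then obtain q where q: "m = (a - b) * q" by blast
          have "real m = real q * (real a - real b)" unfolding q using True by (simp add: of_nat_diff)
          then show ?thesis by (intro exI[of _ "int q"]) simp
        next
          case False
          then have ab: "a < b" using b by simp
          then have "b - a dvd m" unfolding m_def using b by (intro dvd_Lcm) auto
          then obtain q where q: "m = (b - a) * q" by blast
          have "real m = - real q * (real a - real b)" unfolding q using ab by (simp add: of_nat_diff algebra_simps)
          then show ?thesis by (intro exI[of _ "- int q"]) simp
        qed
        then obtain q :: int where q: "real m = of_int q * (real a - real b)" by blast
        have "z i = of_int q * (x i * (real a - real b)) / V"
          by (simp add: z_def q)
        also have "\<dots> = of_int (q * (k - int b))" unfolding s2 using 4(1) by simp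
        finally show ?thesis by (simp only: Ints_of_int)
      next
        case False
        then have "x (c * p + r) = 0" if "c \<le> d" "c \<noteq> a" for c
          using nn[of "c * p + r"] that by (metis order_less_le)
        then have "row_sum d p r x = x (a * p + r)"
          unfolding row_sum_def using a by (intro sum_one_nonzero) auto
        then have "z i = real m" using rs[OF r] 4(1) i by (simp add: z_def)
        then show ?thesis by simp
      qed
    qed
    have "z \<in> generators d p"
      unfolding generators_def weak_cone_def
    proof (intro CollectI conjI IntI ballI)
      show "z \<in> balanced d p" unfolding z_def using x(1) by (rule subspace_scale[OF subspace_balanced])
      fix a assume a: "a \<in> constraints d p"
      show "0 \<le> a z"
        unfolding z_def linear_cmul[OF linear_constraints[OF a]] using x(2)[OF a] 4(1) by simp
    next
      show "z \<in> lattice d p" using zi balancedD(1)[OF x(1)] by (auto simp: lattice_def z_def)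
      show "row_sum d p 0 z = real (Lcm {1..d})"
        unfolding z_def linear_cmul[OF linear_row_sum] using 4(1) by (simp add: V_def[symmetric] m_def)
    qed
    then have "(V / real m) *\<^sub>R z \<in> fcone (generators d p)"
      using 4(1) by (intro fcone_scaleR fcone_base finite_generators[OF p]) auto
    moreover have "(V / real m) *\<^sub>R z = x" using 4(1) m0 by (simp add: z_def)
    ultimately show ?thesis by simp
  qed
qed

lemma weak_cone_eq_fcone:
  assumes "0 < d" "0 < p"
  shows "weak_cone d p = fcone (generators d p)"
proof (intro equalityI subsetI)
  fix x assume "x \<in> weak_cone d p"
  then show "x \<in> fcone (generators d p)"
    using cone_generated_by_extreme_points[OF finite_constraints linear_constraints subspace_balanced extreme_rays[OF assms]]
    by (auto simp: weak_cone_def)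
next
  fix x assume x: "x \<in> fcone (generators d p)"
  have "fcone (generators d p) \<subseteq> span (balanced d p)"
    using fcone_subset_span span_mono[of "generators d p" "balanced d p"]
    by (auto simp: generators_def weak_cone_def)
  then have "x \<in> balanced d p" using x span_eq_iff[THEN iffD2, OF subspace_balanced] by blast
  moreover have "0 \<le> a x" if "a \<in> constraints d p" for a
    by (rule fcone_linear_nonneg[OF linear_constraints[OF that] _ x])
      (use that in \<open>auto simp: generators_def weak_cone_def\<close>)
  ultimately show "x \<in> weak_cone d p" by (simp add: weak_cone_def)
qed

subsection \<open>Lattice coordinates on the balanced vectors\<close>

text \<open>One unit is moved in row \<open>l div d\<close> from column 0 to column
  \<open>l mod d + 1\<close>; the index \<open>l\<close> enumerates pairs of a row and a nonzero
  column.\<close>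

definition chart_vec :: "nat \<Rightarrow> nat \<Rightarrow> nat \<Rightarrow> nat \<Rightarrow> real" where
  "chart_vec d p l = unit_vec p (l div d) (l mod d + 1) - unit_vec p (l div d) 0"

definition chart_origin :: "nat \<Rightarrow> nat \<Rightarrow> real" where
  "chart_origin p = (\<Sum>r<p. unit_vec p r 0)"

text \<open>The position at which the coordinate of \<open>chart_vec d p l\<close> is read off: the
  other chart vectors and the origin vanish there.\<close>

definition chart_index :: "nat \<Rightarrow> nat \<Rightarrow> nat \<Rightarrow> nat" where
  "chart_index d p l = (l mod d + 1) * p + l div d"

lemma chart_div_less:
  fixes l p d :: nat
  assumes "l < p * d"
  shows "l div d < p" "l mod d + 1 \<le> d" "0 < d"
proof -
  show d: "0 < d" using assms by (cases d) auto
  show "l div d < p" using assms by (simp add: less_mult_imp_div_less)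
  have "l mod d < d" using d by simp
  then show "l mod d + 1 \<le> d" by simp
qed

lemma chart_index_inj:
  assumes "l < p * d" "l' < p * d"
  shows "chart_index d p l = chart_index d p l' \<longleftrightarrow> l = l'"
proof
  assume "chart_index d p l = chart_index d p l'"
  then have "l mod d = l' mod d" "l div d = l' div d"
    using index_eq_iff[OF chart_div_less(1)[OF assms(1)] chart_div_less(1)[OF assms(2)]]
    by (auto simp: chart_index_def)
  then show "l = l'" by (metis div_mult_mod_eq)
qed simp

lemma index_row0:
  fixes p :: nat
  assumes "0 < j" "s < p"
  shows "j * p + r \<noteq> s"
proof -
  have "1 * p \<le> j * p" using assms(1) by (intro mult_le_mono1) simp
  then show ?thesis using assms(2) by linarith
qed

lemma chart_vec_at_index:
  assumes "l < p * d" "l' < p * d"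
  shows "chart_vec d p l (chart_index d p l') = of_bool (l = l')"
  using index_row0[of "l' mod d + 1", OF _ chart_div_less(1)[OF assms(1)], of "l' div d"]
    chart_index_inj[OF assms(2,1)]
  by (auto simp: chart_vec_def unit_vec_def chart_index_def)

lemma chart_origin_apply: "chart_origin p i = of_bool (i < p)"
  by (simp add: chart_origin_def sum_fun_apply unit_vec_def of_bool_def)

lemma chart_origin_at_index:
  assumes "l < p * d"
  shows "chart_origin p (chart_index d p l) = 0"
  using index_row0[of "l mod d + 1" _ p "l div d"]
  by (auto simp: chart_origin_apply chart_index_def)

lemma row_sum_chart:
  assumes "r < p"
  shows "l < p * d \<Longrightarrow> row_sum d p r (chart_vec d p l) = 0" "row_sum d p r (chart_origin p) = 1"
proof -
  show "row_sum d p r (chart_vec d p l) = 0" if "l < p * d"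
    using assms chart_div_less[OF that]
    by (simp add: chart_vec_def linear_diff[OF linear_row_sum] row_sum_unit_vec)
  have "row_sum d p r (chart_origin p) = (\<Sum>s<p. if s = r then 1 else 0)"
    unfolding chart_origin_def linear_sum[OF linear_row_sum] using assms
    by (intro sum.cong) (auto simp: row_sum_unit_vec)
  then show "row_sum d p r (chart_origin p) = 1" using assms by simp
qed

lemma chart_balanced:
  shows "l < p * d \<Longrightarrow> chart_vec d p l \<in> balanced d p" "chart_origin p \<in> balanced d p"
proof -
  show "chart_vec d p l \<in> balanced d p" if "l < p * d"
  proof (rule balancedI)
    fix i assume "p * (d + 1) \<le> i"
    then show "chart_vec d p l i = 0"
      using chart_div_less[OF that] by (simp add: chart_vec_def unit_vec_outside[where d = d] del: mult_Suc_right)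
  qed (rule row_sum_chart(1)[OF _ that])
  show "chart_origin p \<in> balanced d p"
    by (rule balancedI[OF _ row_sum_chart(2)]) (auto simp: chart_origin_apply)
qed

text \<open>The chart indices run through columns 1 to \<open>d\<close>; the entries in column 0 are
  recovered from the row sums.\<close>

lemma balanced_eqI:
  assumes x: "x \<in> balanced d p" and y: "y \<in> balanced d p" and "row_sum d p 0 x = row_sum d p 0 y"
    and c: "\<And>l. l < p * d \<Longrightarrow> x (chart_index d p l) = y (chart_index d p l)" and p: "0 < p"
  shows "x = y"
proof
  fix i
  have pos: "x (j * p + r) = y (j * p + r)" if "r < p" "1 \<le> j" "j \<le> d" for r j
  proof -
    obtain k where k: "j = Suc k" using \<open>1 \<le> j\<close> by (cases j) auto
    let ?l = "r * d + k"
    have kd: "k < d" using that k by simp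
    have "(r + 1) * d \<le> p * d" using that(1) by (intro mult_le_mono1) simp
    then have "?l < p * d" using kd by simp
    moreover have "chart_index d p ?l = j * p + r"
      using kd k by (simp add: chart_index_def)
    ultimately show ?thesis using c[of ?l] by simp
  qed
  show "x i = y i"
  proof (cases "i < p * (d + 1)")
    case True
    define r where "r = i mod p"
    define j where "j = i div p"
    have i: "i = j * p + r" and r: "r < p" and j: "j \<le> d"
      using p index_div_le[OF True] by (simp_all add: r_def j_def)
    show ?thesis
    proof (cases "j = 0")
      case True
      have split: "row_sum d p r h = h r + (\<Sum>j=1..d. h (j * p + r))" for h
        unfolding row_sum_def by (simp add: atMost_atLeast0 sum.atLeast_Suc_atMost)
      have "row_sum d p r x = row_sum d p r y"
        using balancedD(2)[OF x r] balancedD(2)[OF y r] assms(3) by simp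
      moreover have "(\<Sum>j=1..d. x (j * p + r)) = (\<Sum>j=1..d. y (j * p + r))"
        using pos[OF r] by (intro sum.cong) auto
      ultimately show ?thesis using True i by (simp add: split)
    next
      case False
      then show ?thesis using pos[OF r _ j] i by simp
    qed
  next
    case False
    then show ?thesis using balancedD(1)[OF x, of i] balancedD(1)[OF y, of i] by simp
  qed
qed

lemma chart_combination:
  assumes "0 < p"
  shows "v *\<^sub>R chart_origin p + (\<Sum>l<p * d. c l *\<^sub>R chart_vec d p l) \<in> balanced d p"
    and "r < p \<Longrightarrow> row_sum d p r (v *\<^sub>R chart_origin p + (\<Sum>l<p * d. c l *\<^sub>R chart_vec d p l)) = v"
    and "k < p * d \<Longrightarrow> (v *\<^sub>R chart_origin p + (\<Sum>l<p * d. c l *\<^sub>R chart_vec d p l)) (chart_index d p k) = c k"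
proof -
  show "v *\<^sub>R chart_origin p + (\<Sum>l<p * d. c l *\<^sub>R chart_vec d p l) \<in> balanced d p"
    using chart_balanced by (intro subspace_add subspace_balanced subspace_scale subspace_sum) auto
  show "r < p \<Longrightarrow> row_sum d p r (v *\<^sub>R chart_origin p + (\<Sum>l<p * d. c l *\<^sub>R chart_vec d p l)) = v"
    by (simp add: linear_add[OF linear_row_sum] linear_cmul[OF linear_row_sum] linear_sum[OF linear_row_sum]
        row_sum_chart)
  assume k: "k < p * d"
  have "(\<Sum>l<p * d. c l *\<^sub>R chart_vec d p l) (chart_index d p k) = (\<Sum>l<p * d. if l = k then c k else 0)"
    unfolding sum_fun_apply using k by (intro sum.cong) (auto simp: chart_vec_at_index)
  then show "(v *\<^sub>R chart_origin p + (\<Sum>l<p * d. c l *\<^sub>R chart_vec d p l)) (chart_index d p k) = c k"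
    using k by (simp add: chart_origin_at_index)
qed

lemma chart_expansion:
  assumes "0 < p" "x \<in> balanced d p"
  shows "x = row_sum d p 0 x *\<^sub>R chart_origin p + (\<Sum>l<p * d. x (chart_index d p l) *\<^sub>R chart_vec d p l)"
  using assms by (intro balanced_eqI[of _ d p]) (simp_all only: chart_combination)

lemma dim_balanced:
  assumes p: "0 < p"
  shows "dim (balanced d p) = p * d + 1"
proof -
  define B where "B = insert (chart_origin p) (chart_vec d p ` {..<p * d})"
  have inj: "inj_on (chart_vec d p) {..<p * d}"
  proof (rule inj_onI)
    fix l l' assume "l \<in> {..<p * d}" "l' \<in> {..<p * d}" "chart_vec d p l = chart_vec d p l'"
    then show "l = l'"
      using chart_vec_at_index[of l p d l] chart_vec_at_index[of l' p d l] by (cases "l' = l") auto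
  qed
  have notin: "chart_origin p \<notin> chart_vec d p ` {..<p * d}"
    using row_sum_chart(1)[OF p, of _ d] row_sum_chart(2)[OF p, of d] by force
  have card: "card B = p * d + 1"
    using inj notin by (simp add: B_def card_image)
  have fin: "finite B" by (simp add: B_def)
  have ind: "independent B"
  proof
    assume "dependent B"
    then obtain u where u: "\<exists>v\<in>B. u v \<noteq> 0" "(\<Sum>v\<in>B. u v *\<^sub>R v) = 0"
      using fin by (auto simp: dependent_finite)
    have "(\<Sum>v\<in>B. u v *\<^sub>R v) = u (chart_origin p) *\<^sub>R chart_origin p +
        (\<Sum>l<p * d. u (chart_vec d p l) *\<^sub>R chart_vec d p l)"
      using notin inj by (simp add: B_def sum.reindex)
    then have z: "u (chart_origin p) *\<^sub>R chart_origin p +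
        (\<Sum>l<p * d. u (chart_vec d p l) *\<^sub>R chart_vec d p l) = 0" using u by simp
    have "u (chart_origin p) = 0"
      using chart_combination(2)[OF p p, where v = "u (chart_origin p)" and c = "\<lambda>l. u (chart_vec d p l)" and d = d]
      unfolding z linear_0[OF linear_row_sum] by simp
    moreover have "u (chart_vec d p k) = 0" if "k < p * d" for k
      using chart_combination(3)[OF p that, where v = "u (chart_origin p)" and c = "\<lambda>l. u (chart_vec d p l)"]
      unfolding z by simp
    ultimately show False using u(1) by (auto simp: B_def)
  qed
  have "balanced d p \<subseteq> span B"
  proof
    fix x assume x: "x \<in> balanced d p"
    have "row_sum d p 0 x *\<^sub>R chart_origin p + (\<Sum>l<p * d. x (chart_index d p l) *\<^sub>R chart_vec d p l) \<in> span B"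
      by (intro span_add span_sum span_scale span_base) (auto simp: B_def)
    then show "x \<in> span B" using chart_expansion[OF p x] by simp
  qed
  moreover have "B \<subseteq> balanced d p" using chart_balanced by (auto simp: B_def)
  ultimately show ?thesis using basis_card_eq_dim[OF _ _ ind] card by metis
qed

subsection \<open>A generic vector\<close>

text \<open>Moving p - r units from column 0 to column d raises the moment of row r by d (p - r), so
  the moments strictly decrease from row to row. The constant p + 1 keeps column 0 positive.\<close>

definition generic_point :: "nat \<Rightarrow> nat \<Rightarrow> nat \<Rightarrow> real" where
  "generic_point d p i = (if i < p * (d + 1) then
     real (p + 1) + (if i div p = d then real (p - i mod p) else if i div p = 0 then - real (p - i mod p) else 0)
   else 0)"

lemma generic_point_row:
  assumes "r < p" "j \<le> d" "0 < d"
  shows "generic_point d p (j * p + r) =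
    real (p + 1) + (if j = d then real (p - r) else 0) - (if j = 0 then real (p - r) else 0)"
  using assms index_less[OF assms(1,2)] by (auto simp: generic_point_def)

lemma generic_point_sums:
  assumes d: "0 < d" and r: "r < p"
  shows "row_sum d p r (generic_point d p) = real (p + 1) * real (d + 1)"
    and "moment d p r (generic_point d p) = real (p + 1) * (\<Sum>j\<le>d. real j) + real d * (real p - real r)"
proof -
  have g: "generic_point d p (j * p + r) =
      real (p + 1) + (if j = d then real (p - r) else 0) - (if j = 0 then real (p - r) else 0)" if "j \<le> d" for j
    using generic_point_row[OF r that d] by simp
  have "row_sum d p r (generic_point d p) =
      (\<Sum>j\<le>d. real (p + 1) + (if j = d then real (p - r) else 0) - (if j = 0 then real (p - r) else 0))"
    unfolding row_sum_def using g by (intro sum.cong) auto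
  also have "\<dots> = real (p + 1) * real (d + 1)"
    by (simp add: sum.distrib sum_subtractf algebra_simps)
  finally show "row_sum d p r (generic_point d p) = real (p + 1) * real (d + 1)" .
  have "moment d p r (generic_point d p) =
      (\<Sum>j\<le>d. real (p + 1) * real j + (if j = d then real d * real (p - r) else 0))"
    unfolding moment_def by (intro sum.cong refl) (use g in \<open>auto simp: distrib_left right_diff_distrib mult.commute\<close>)
  also have "\<dots> = real (p + 1) * (\<Sum>j\<le>d. real j) + real d * (real p - real r)"
    using r by (simp add: sum.distrib sum_distrib_left of_nat_diff)
  finally show "moment d p r (generic_point d p) = real (p + 1) * (\<Sum>j\<le>d. real j) + real d * (real p - real r)" .
qed

lemma generic_point:
  assumes d: "0 < d" and p: "0 < p"
  shows "generic_point d p \<in> balanced d p" "generic_point d p \<in> lattice d p"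
    and "a \<in> constraints d p \<Longrightarrow> 0 < a (generic_point d p)"
proof -
  show "generic_point d p \<in> balanced d p"
    using generic_point_sums(1)[OF d] by (intro balancedI) (auto simp: generic_point_def)
  show "generic_point d p \<in> lattice d p"
    by (auto simp: lattice_def generic_point_def)
  have "0 < generic_point d p i" if "i < p * (d + 1)" for i
    using that by (auto simp: generic_point_def)
  moreover have "0 < slack d p r (generic_point d p)" if r: "r < p" for r
  proof (cases "r + 1 < p")
    case True
    then show ?thesis
      using generic_point_sums(2)[OF d r] generic_point_sums(2)[OF d True] d by (simp add: slack_def algebra_simps)
  next
    case False
    then have rp: "real r = real p - 1" using r by (simp add: of_nat_diff)
    have "slack d p r (generic_point d p) = real d * (real p - real r) + real (p + 1) * real (d + 1) - real d * real p"
      using generic_point_sums(2)[OF d r] generic_point_sums(2)[OF d p] generic_point_sums(1)[OF d r] False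
      unfolding slack_def by simp
    also have "\<dots> = real d + real p + real (d + 1)"
      unfolding rp by (simp add: algebra_simps)
    finally show ?thesis by simp
  qed
  ultimately show "a \<in> constraints d p \<Longrightarrow> 0 < a (generic_point d p)"
    by (auto simp: constraints_def)
qed

text \<open>\<open>generic_point\<close> satisfies all constraints strictly, so a small step from it
  in any balanced direction stays in the cone. The direction is then a multiple of a difference of
  two points of the cone.\<close>

lemma span_generators:
  assumes d: "0 < d" and p: "0 < p"
  shows "span (generators d p) = balanced d p"
proof (intro equalityI subsetI)
  fix x assume "x \<in> span (generators d p)"
  moreover have "generators d p \<subseteq> balanced d p" by (auto simp: generators_def weak_cone_def)
  ultimately show "x \<in> balanced d p" using span_minimal[OF _ subspace_balanced] by blast
next
  fix x assume x: "x \<in> balanced d p"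
  note g = generic_point[OF d p]
  have "\<forall>\<^sub>F e in at_right 0. \<forall>a\<in>constraints d p. 0 \<le> a (generic_point d p + e *\<^sub>R x)"
  proof (intro eventually_ball_finite finite_constraints ballI)
    fix a assume a: "a \<in> constraints d p"
    have "\<forall>\<^sub>F e in at_right 0. 0 < a (generic_point d p) + e * a x"
      using g(3)[OF a] by (intro eventually_at_right_affine_pos) auto
    then show "\<forall>\<^sub>F e in at_right 0. 0 \<le> a (generic_point d p + e *\<^sub>R x)"
      by eventually_elim (simp add: linear_add[OF linear_constraints[OF a]] linear_cmul[OF linear_constraints[OF a]])
  qed
  then have "\<forall>\<^sub>F e in at_right 0. 0 < e \<and> (\<forall>a\<in>constraints d p. 0 \<le> a (generic_point d p + e *\<^sub>R x))"
    by (intro eventually_conj eventually_at_right_less)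
  from eventually_happens'[OF trivial_limit_at_right_real this]
  obtain e :: real where e: "0 < e" "\<forall>a\<in>constraints d p. 0 \<le> a (generic_point d p + e *\<^sub>R x)" by blast
  have sub: "weak_cone d p \<subseteq> span (generators d p)"
    unfolding weak_cone_eq_fcone[OF d p] by (rule fcone_subset_span)
  have "generic_point d p + e *\<^sub>R x \<in> weak_cone d p"
    using e g(1) x by (simp add: weak_cone_def subspace_add[OF subspace_balanced] subspace_scale[OF subspace_balanced])
  moreover have "generic_point d p \<in> weak_cone d p"
    using g by (auto simp: weak_cone_def intro: less_imp_le)
  ultimately have "(1 / e) *\<^sub>R ((generic_point d p + e *\<^sub>R x) - generic_point d p) \<in> span (generators d p)"
    using sub by (intro span_scale span_diff) auto
  then show "x \<in> span (generators d p)" using e(1) by simp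
qed

subsection \<open>Membership in \<open>C_END\<close>\<close>

lemma degree_diff_poly_balanced:
  assumes "0 < d" "h \<in> balanced d p" "r < p"
  shows "degree (diff_poly d p h r) \<le> d - 1"
    and "coeff (diff_poly d p h r) (d - 1) = real d / fact d * slack d p r h"
proof -
  have ve: "\<forall>r<p. row_sum d p r h = row_sum d p 0 h" using balancedD(2)[OF assms(2)] by blast
  have "0 < p" using assms(3) by simp
  have "row_sum d p (if r + 1 < p then r + 1 else 0) h = row_sum d p r h"
    using balancedD(2)[OF assms(2), of "r + 1"] balancedD(2)[OF assms(2), of r] assms(3) by (cases "r + 1 < p") (simp_all only: if_True if_False)
  then have c: "coeff (diff_poly d p h r) d = 0"
    unfolding coeff_diff_poly(1)[OF assms(1,3)] by (simp only: diff_self div_0)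
  show "degree (diff_poly d p h r) \<le> d - 1"
  proof (rule degree_le, intro allI impI)
    fix i assume "d - 1 < i"
    then consider "i = d" | "d < i" by linarith
    then show "coeff (diff_poly d p h r) i = 0"
      using c degree_diff_poly[of d p h r] by cases (auto simp: coeff_eq_0)
  qed
  show "coeff (diff_poly d p h r) (d - 1) = real d / fact d * slack d p r h"
    by (rule coeff_diff_poly(2)[OF assms(1,3) ve])
qed

text \<open>The degree-d coefficients make the row sums nondecreasing around the cycle of rows,
  hence all equal. This lowers the degree, and the coefficient at d - 1, a positive multiple of the
  slack, must be nonnegative in turn.\<close>

lemma C_END_imp_weak:
  assumes d: "0 < d" and p: "0 < p" and h: "h \<in> C_END d p"
  shows "h \<in> balanced d p" "r < p \<Longrightarrow> 0 \<le> slack d p r h"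
proof -
  have supp: "\<And>i. p * (d + 1) \<le> i \<Longrightarrow> h i = 0" and lc: "\<And>r. r < p \<Longrightarrow> 0 \<le> lead_coeff (diff_poly d p h r)"
    using h unfolding C_END_iff[OF p] by blast+
  have le_next: "row_sum d p r h \<le> row_sum d p (if r + 1 < p then r + 1 else 0) h" if "r < p" for r
  proof -
    have "0 \<le> coeff (diff_poly d p h r) d"
      by (rule coeff_nonneg_of_lead_coeff[OF lc[OF that] degree_diff_poly])
    then have "0 \<le> (row_sum d p (if r + 1 < p then r + 1 else 0) h - row_sum d p r h) / fact d * fact d"
      unfolding coeff_diff_poly(1)[OF d that] by (rule mult_nonneg_nonneg) simp
    then show ?thesis by simp
  qed
  have mono: "row_sum d p r h \<le> row_sum d p s h" if "r \<le> s" "s < p" for r s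
    using that
  proof (induction s rule: dec_induct)
    case (step s)
    have "row_sum d p s h \<le> row_sum d p (Suc s) h" using le_next[of s] step.prems by simp
    then show ?case using step by simp
  qed simp
  have rs: "row_sum d p r h = row_sum d p 0 h" if "r < p" for r
  proof -
    have "row_sum d p (p - 1) h \<le> row_sum d p 0 h" using le_next[of "p - 1"] p by simp
    moreover have "row_sum d p r h \<le> row_sum d p (p - 1) h" using that by (intro mono) linarith+
    moreover have "row_sum d p 0 h \<le> row_sum d p r h" using that by (intro mono) simp_all
    ultimately show ?thesis by linarith
  qed
  show bal: "h \<in> balanced d p" by (rule balancedI[OF supp rs])
  show "0 \<le> slack d p r h" if "r < p"
  proof -
    have "0 \<le> coeff (diff_poly d p h r) (d - 1)"
      by (rule coeff_nonneg_of_lead_coeff[OF lc[OF that] degree_diff_poly_balanced(1)[OF d bal that]])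
    then have "0 \<le> real d / fact d * slack d p r h"
      by (simp only: degree_diff_poly_balanced(2)[OF d bal that])
    moreover have "0 < real d / fact d" using d by simp
    ultimately show ?thesis by (simp only: zero_le_mult_iff) linarith
  qed
qed

text \<open>On balanced vectors a positive slack makes the coefficient at d - 1 the leading one,
  which settles the sign.\<close>

lemma strict_imp_C_END:
  assumes d: "0 < d" and p: "0 < p" and h: "h \<in> balanced d p" "\<And>r. r < p \<Longrightarrow> 0 < slack d p r h"
  shows "h \<in> C_END d p"
  unfolding C_END_iff[OF p]
proof (intro conjI allI impI)
  fix r assume r: "r < p"
  have pos: "0 < coeff (diff_poly d p h r) (d - 1)"
    unfolding degree_diff_poly_balanced(2)[OF d h(1) r] using h(2)[OF r] d by simp
  then have "d - 1 \<le> degree (diff_poly d p h r)" by (intro le_degree) simp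
  then have "degree (diff_poly d p h r) = d - 1"
    using degree_diff_poly_balanced(1)[OF d h(1) r] by simp
  then show "0 \<le> lead_coeff (diff_poly d p h r)" using pos by simp
qed (use balancedD(1)[OF h(1)] in simp)

lemma volume_equalities_iff:
  assumes "\<forall>i\<ge>p * (d + 1). h i = 0"
  shows "volume_equalities d p h \<longleftrightarrow> h \<in> balanced d p"
proof
  assume v: "volume_equalities d p h"
  show "h \<in> balanced d p"
  proof (rule balancedI)
    fix r assume "r < p"
    then show "row_sum d p r h = row_sum d p 0 h"
    proof (induction r)
      case (Suc r)
      then show ?case using v by (simp add: volume_equalities_def row_sum_def hh_def)
    qed simp
  qed (use assms in simp)
next
  assume b: "h \<in> balanced d p"
  have "row_sum d p (r + 1) h = row_sum d p r h" if "r + 1 < p" for r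
    using balancedD(2)[OF b that] balancedD(2)[OF b, of r] that by simp
  then show "volume_equalities d p h"
    by (simp add: volume_equalities_def row_sum_def hh_def)
qed

lemma strict_first_level_iff:
  assumes "0 < p" "h \<in> balanced d p"
  shows "strict_first_level d p h \<longleftrightarrow> (\<forall>r<p. 0 < slack d p r h)"
proof -
  have "(\<Sum>j\<le>d. real (j + 1) * hh p h (p - 1) j) = moment d p (p - 1) h + row_sum d p (p - 1) h"
    by (simp add: hh_def moment_def row_sum_def sum.distrib[symmetric] algebra_simps)
  then have "strict_first_level d p h \<longleftrightarrow> (\<forall>r. r + 1 < p \<longrightarrow> moment d p (r + 1) h < moment d p r h) \<and>
      moment d p 0 h < moment d p (p - 1) h + row_sum d p (p - 1) h"
    by (simp add: strict_first_level_def hh_def moment_def)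
  also have "\<dots> \<longleftrightarrow> (\<forall>r. r + 1 < p \<longrightarrow> 0 < slack d p r h) \<and> 0 < slack d p (p - 1) h"
    using assms(1) by (simp add: slack_def)
  also have "\<dots> \<longleftrightarrow> (\<forall>r<p. 0 < slack d p r h)"
  proof -
    have "r < p \<longleftrightarrow> r + 1 < p \<or> r = p - 1" for r using assms(1) by linarith
    then show ?thesis by metis
  qed
  finally show ?thesis .
qed

section \<open>Generic lattice points and their generating series\<close>

definition strict_points :: "nat \<Rightarrow> nat \<Rightarrow> (nat \<Rightarrow> real) set" where
  "strict_points d p = {x \<in> lattice d p \<inter> balanced d p. \<forall>a\<in>constraints d p. 0 < a x}"

text \<open>Strict first-level inequalities already imply membership in \<open>C_END\<close>, so
  lexicographic ties do not arise and the generic lattice points are those strictly inside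
  \<open>weak_cone\<close>.\<close>

lemma generic_lattice_points:
  assumes d: "0 < d" and p: "0 < p"
  shows "{h \<in> C_END d p. (\<forall>i. h i \<in> \<nat>) \<and> generic d p h \<and> vol d p h = v} =
    {x \<in> strict_points d p. row_sum d p 0 x = v}"
proof (intro equalityI subsetI)
  fix h assume "h \<in> {h \<in> C_END d p. (\<forall>i. h i \<in> \<nat>) \<and> generic d p h \<and> vol d p h = v}"
  then have h: "h \<in> C_END d p" "\<And>i. h i \<in> \<nat>" "strict_first_level d p h" "\<forall>i<p * (d + 1). 0 < h i"
      "row_sum d p 0 h = v"
    by (auto simp: generic_def vol_eq)
  have b: "h \<in> balanced d p" by (rule C_END_imp_weak(1)[OF d p h(1)])
  have "h i \<in> \<int>" for i using h(2) Nats_subset_Ints by blast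
  then have "h \<in> lattice d p" using balancedD(1)[OF b] by (auto simp: lattice_def)
  then show "h \<in> {x \<in> strict_points d p. row_sum d p 0 x = v}"
    using b h(3,4,5) by (simp add: strict_points_def ball_constraints strict_first_level_iff[OF p b] del: mult_Suc_right)
next
  fix h assume "h \<in> {x \<in> strict_points d p. row_sum d p 0 x = v}"
  then have h: "h \<in> lattice d p" "h \<in> balanced d p" "\<And>i. i < p * (d + 1) \<Longrightarrow> 0 < h i"
      "\<And>r. r < p \<Longrightarrow> 0 < slack d p r h" "row_sum d p 0 h = v"
    by (simp_all add: strict_points_def ball_constraints del: mult_Suc_right)
  have C: "h \<in> C_END d p" by (rule strict_imp_C_END[OF d p h(2,4)])
  have nn: "0 \<le> h i" for i
    using h(3)[of i] balancedD(1)[OF h(2), of i] by (cases "i < p * (d + 1)") (auto simp: not_less intro: less_imp_le)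
  have "h i \<in> \<nat>" for i
  proof -
    have "h i \<in> \<int>" using h(1) by (simp add: lattice_def)
    then show ?thesis using nn[of i] by (metis Nats_altdef2 mem_Collect_eq)
  qed
  moreover have "volume_equalities d p h"
    using volume_equalities_iff balancedD(1)[OF h(2)] h(2) by blast
  moreover have "strict_first_level d p h" using strict_first_level_iff[OF p h(2)] h(4) by blast
  ultimately show "h \<in> {h \<in> C_END d p. (\<forall>i. h i \<in> \<nat>) \<and> generic d p h \<and> vol d p h = v}"
    using C h(3,5) by (simp add: generic_def vol_eq del: mult_Suc_right)
qed

lemma gnd_eq:
  assumes "0 < d" "0 < p"
  shows "gnd d p V = card {x \<in> strict_points d p. row_sum d p 0 x = real V}"
  unfolding gnd_def generic_lattice_points[OF assms] ..

lemma finite_cone_lattice_points: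
  assumes "0 < d" "0 < p"
  shows "finite {x \<in> lattice d p \<inter> fcone (generators d p). row_sum d p 0 x = real V}"
  unfolding weak_cone_eq_fcone[OF assms, symmetric]
  by (rule finite_subset[OF _ finite_lattice_points[OF assms(2), where V = V]])
    (auto simp: weak_cone_def ball_constraints)

lemma lattice_closed:
  assumes "x \<in> lattice d p" "y \<in> lattice d p"
  shows "x + y \<in> lattice d p" "x - y \<in> lattice d p"
  using assms by (auto simp: lattice_def)

lemma Lcm_pos: "0 < Lcm {1..d::nat}"
  by (intro Nat.gr0I) (simp add: Lcm_0_iff)

text \<open>The decomposition is used with the direction \<open>- w\<close> for a generic interior
  \<open>w\<close>: pushing outwards keeps exactly the points at which all constraints are strict.
  The height of \<open>- w\<close> is negative, so only the weak degree bound results.\<close>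

lemma gnd_series:
  assumes d: "0 < d" and p: "0 < p"
  shows "\<exists>h. fps_of_poly h = Abs_fps (\<lambda>V. real (gnd d p V)) * (1 - fps_X ^ Lcm {1..d}) ^ Suc (p * d) \<and>
    (\<forall>i. 0 \<le> coeff h i) \<and> degree h \<le> Lcm {1..d} * Suc (p * d)"
proof -
  let ?G = "generators d p"
  have fin: "finite ?G" by (rule finite_generators[OF p])
  obtain w l where w: "w = (\<Sum>g\<in>?G. l g *\<^sub>R g)" "\<forall>g\<in>?G. 0 < l g"
      "\<forall>B\<in>bases ?G. \<forall>b\<in>B. representation B w b \<noteq> 0"
    using exists_generic_interior[OF fin] by (elim exE conjE)
  have wspan: "w \<in> span ?G" unfolding w(1) by (intro span_sum span_scale span_base)
  have pos: "0 < a w" if a: "a \<in> constraints d p" for a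
  proof -
    have lin: "linear a" by (rule linear_constraints[OF a])
    have nn: "0 \<le> a g" if "g \<in> ?G" for g using that a by (auto simp: generators_def weak_cone_def)
    \<comment> \<open>Otherwise \<open>a\<close> would be nonpositive on the whole cone, in
      particular at \<open>generic_point\<close>.\<close>
    have "\<exists>g\<in>?G. 0 < a g"
    proof (rule ccontr)
      assume "\<not> ?thesis"
      then have np: "0 \<le> - a g" if "g \<in> ?G" for g using that by (simp add: not_less)
      have "generic_point d p \<in> weak_cone d p"
        unfolding weak_cone_def using generic_point(1)[OF d p] generic_point(3)[OF d p, THEN less_imp_le] by blast
      then have "generic_point d p \<in> fcone ?G" by (simp only: weak_cone_eq_fcone[OF d p])
      then have "0 \<le> - a (generic_point d p)"
        using fcone_linear_nonneg[OF linear_compose_neg[OF lin] np] by blast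
      then show False using generic_point(3)[OF d p a] by simp
    qed
    then obtain g where g: "g \<in> ?G" "0 < a g" by blast
    have "a w = (\<Sum>g\<in>?G. l g * a g)" unfolding w(1) by (simp add: linear_sum[OF lin] linear_cmul[OF lin])
    also have "0 < \<dots>"
    proof (rule sum_pos2[OF fin g(1)])
      show "0 < l g * a g" using g w(2) by simp
      show "0 \<le> l i * a i" if "i \<in> ?G" for i using that w(2) nn[OF that] by (simp add: less_imp_le)
    qed
    finally show ?thesis .
  qed
  have gen: "representation B (- w) b \<noteq> 0" if "B \<in> bases ?G" "b \<in> B" for B b
  proof -
    have "representation B (- w) b = - representation B w b"
      using basesD[OF fin that(1)] wspan by (simp add: representation_neg)
    then show ?thesis using w(3) that by simp
  qed
  have series: "\<exists>h. fps_of_poly h = hilbert (row_sum d p 0)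
      {x \<in> lattice d p \<inter> span ?G. \<forall>\<^sub>F e in at_right 0. x + e *\<^sub>R (- w) \<in> fcone ?G} * (1 - fps_X ^ Lcm {1..d}) ^ dim ?G \<and>
    (\<forall>i. 0 \<le> coeff h i) \<and> degree h \<le> Lcm {1..d} * dim ?G \<and>
    (0 < row_sum d p 0 (- w) \<longrightarrow> degree h < Lcm {1..d} * dim ?G)"
  proof (rule hilbert_cone[OF fin linear_row_sum])
    show "0 < Lcm {1..d}" by (rule Lcm_pos)
    show "- w \<in> span ?G" using wspan by (rule span_neg)
    show "?G \<subseteq> lattice d p" by (auto simp: generators_def)
    show "row_sum d p 0 g = real (Lcm {1..d})" if "g \<in> ?G" for g using that by (simp add: generators_def)
    show "finite {x \<in> lattice d p \<inter> fcone ?G. row_sum d p 0 x = real V}" for V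
      by (rule finite_cone_lattice_points[OF d p])
  qed (rule gen lattice_closed; assumption)+
  have dimG: "dim ?G = Suc (p * d)"
    using dim_balanced[OF p, of d] span_generators[OF d p] dim_span[of ?G] by simp
  have hilb: "hilbert (row_sum d p 0) {x \<in> lattice d p \<inter> span ?G. \<forall>\<^sub>F e in at_right 0. x + e *\<^sub>R (- w) \<in> fcone ?G}
      = Abs_fps (\<lambda>V. real (gnd d p V))"
  proof -
    have "(\<forall>\<^sub>F e in at_right 0. x + e *\<^sub>R (- w) \<in> fcone ?G) \<longleftrightarrow> (\<forall>a\<in>constraints d p. 0 < a x)"
      if x: "x \<in> balanced d p" for x
    proof -
      have "x + e *\<^sub>R (- w) \<in> balanced d p" for e
        using x wspan unfolding span_generators[OF d p]
        by (intro subspace_add[OF subspace_balanced] subspace_scale[OF subspace_balanced] subspace_neg[OF subspace_balanced])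
      then have "x + e *\<^sub>R (- w) \<in> fcone ?G \<longleftrightarrow> (\<forall>a\<in>constraints d p. 0 \<le> a (x + e *\<^sub>R (- w)))" for e
        unfolding weak_cone_eq_fcone[OF d p, symmetric] weak_cone_def by blast
      then have "(\<forall>\<^sub>F e in at_right 0. x + e *\<^sub>R (- w) \<in> fcone ?G) \<longleftrightarrow>
          (\<forall>\<^sub>F e in at_right 0. \<forall>a\<in>constraints d p. 0 \<le> a (x + e *\<^sub>R (- w)))"
        by (simp only:)
      also have "\<dots> \<longleftrightarrow> (\<forall>a\<in>constraints d p. 0 < a x)"
        using pos by (intro strict_iff_eventually finite_constraints linear_constraints)
      finally show ?thesis .
    qed
    then have "{x \<in> lattice d p \<inter> span ?G. \<forall>\<^sub>F e in at_right 0. x + e *\<^sub>R (- w) \<in> fcone ?G} = strict_points d p"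
      unfolding span_generators[OF d p] strict_points_def by blast
    then show ?thesis by (simp add: hilbert_def gnd_eq[OF d p])
  qed
  show ?thesis using series unfolding hilb dimG by blast
qed

subsection \<open>The polytope \<open>S1\<close>\<close>

lemma continuous_map_row_sum: "continuous_map (Euclidean_space n) euclideanreal (row_sum d p r)"
  and continuous_map_moment: "continuous_map (Euclidean_space n) euclideanreal (moment d p r)"
proof -
  have c: "continuous_map (Euclidean_space n) euclideanreal (\<lambda>x. x i)" for i
    unfolding Euclidean_space_def
    by (intro continuous_map_from_subtopology continuous_map_product_projection) simp
  show "continuous_map (Euclidean_space n) euclideanreal (row_sum d p r)"
    unfolding row_sum_def by (intro continuous_map_sum c) auto
  show "continuous_map (Euclidean_space n) euclideanreal (moment d p r)"
    unfolding moment_def by (intro continuous_map_sum continuous_map_real_mult c) auto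
qed

lemma continuous_map_slack: "continuous_map (Euclidean_space n) euclideanreal (slack d p r)"
  unfolding slack_def
  by (cases "r + 1 < p")
    (auto intro!: continuous_map_diff continuous_map_add continuous_map_row_sum continuous_map_moment)

lemma closure_of_nonneg:
  assumes f: "continuous_map X euclideanreal f" and S: "S \<subseteq> topspace X" "\<And>y. y \<in> S \<Longrightarrow> 0 \<le> f y"
    and x: "x \<in> X closure_of S"
  shows "0 \<le> f x"
proof -
  have "closedin X {x \<in> topspace X. f x \<in> {0..}}"
    by (rule closedin_continuous_map_preimage[OF f]) simp
  moreover have "S \<subseteq> {x \<in> topspace X. f x \<in> {0..}}" using S by auto
  ultimately have "X closure_of S \<subseteq> {x \<in> topspace X. f x \<in> {0..}}" by (rule closure_of_minimal[rotated])
  then show ?thesis using x by auto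
qed

text \<open>Weak inequalities and equalities of row sums pass to the closure. Conversely, adding a
  small positive multiple of \<open>generic_point\<close> makes every constraint strict, so that
  points of \<open>C_END\<close> converge to \<open>x\<close>.\<close>

lemma S1_eq:
  assumes d: "0 < d" and p: "0 < p"
  shows "S1 d p = {x \<in> weak_cone d p. row_sum d p 0 x = 1}"
proof (intro equalityI subsetI)
  let ?E = "Euclidean_space (p * (d + 1))"
  fix x assume "x \<in> S1 d p"
  then have x: "x \<in> ?E closure_of C_END d p" "\<And>i. 0 \<le> x i" "row_sum d p 0 x = 1"
    by (auto simp: S1_def vol_eq)
  have sub: "C_END d p \<subseteq> topspace ?E"
    using C_END_iff[OF p] by (auto simp: topspace_Euclidean_space)
  have xt: "x \<in> topspace ?E" using x(1) by (simp add: in_closure_of)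
  have rs: "row_sum d p r x = 1" if r: "r < p" for r
  proof -
    have eq: "row_sum d p r y = row_sum d p 0 y" if "y \<in> C_END d p" for y
      using balancedD(2)[OF C_END_imp_weak(1)[OF d p that] r] .
    have "0 \<le> row_sum d p r x - row_sum d p 0 x"
      by (rule closure_of_nonneg[OF continuous_map_diff[OF continuous_map_row_sum continuous_map_row_sum] sub _ x(1)])
        (simp add: eq)
    moreover have "0 \<le> row_sum d p 0 x - row_sum d p r x"
      by (rule closure_of_nonneg[OF continuous_map_diff[OF continuous_map_row_sum continuous_map_row_sum] sub _ x(1)])
        (simp add: eq)
    ultimately show ?thesis using x(3) by simp
  qed
  have "x \<in> balanced d p"
    using xt by (intro balancedI[OF _ rs]) (auto simp: topspace_Euclidean_space)
  moreover have "0 \<le> slack d p r x" if "r < p" for r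
    using C_END_imp_weak(2)[OF d p _ that] by (intro closure_of_nonneg[OF continuous_map_slack sub _ x(1)])
  ultimately show "x \<in> {x \<in> weak_cone d p. row_sum d p 0 x = 1}"
    using x by (simp add: weak_cone_def ball_constraints)
next
  let ?E = "Euclidean_space (p * (d + 1))"
  fix x assume x: "x \<in> {x \<in> weak_cone d p. row_sum d p 0 x = 1}"
  then have xb: "x \<in> balanced d p" and xc: "\<And>a. a \<in> constraints d p \<Longrightarrow> 0 \<le> a x" by (auto simp: weak_cone_def)
  have nn: "0 \<le> x i" for i
    using balanced_le_volume(1)[OF xb p] xc by (auto simp: constraints_def)
  let ?w = "generic_point d p"
  note w = generic_point[OF d p]
  have bal: "x + e *\<^sub>R ?w \<in> balanced d p" for e
    by (intro subspace_add[OF subspace_balanced] subspace_scale[OF subspace_balanced] xb w)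
  have C: "x + e *\<^sub>R ?w \<in> C_END d p" if "0 < e" for e
  proof (rule strict_imp_C_END[OF d p bal])
    fix r assume "r < p"
    then have a: "slack d p r \<in> constraints d p" by (auto simp: constraints_def)
    show "0 < slack d p r (x + e *\<^sub>R ?w)"
      unfolding linear_add[OF linear_slack] linear_cmul[OF linear_slack]
      using xc[OF a] w(3)[OF a] that by (simp add: add_nonneg_pos)
  qed
  have "x \<in> ?E closure_of C_END d p"
    unfolding in_closure_of
  proof (intro conjI allI impI)
    show "x \<in> topspace ?E" using balancedD(1)[OF xb] by (simp add: topspace_Euclidean_space)
    fix T assume T: "x \<in> T \<and> openin ?E T"
    have "continuous_map euclideanreal ?E (\<lambda>e. x + e *\<^sub>R ?w)"
      unfolding Euclidean_space_def continuous_map_in_subtopology continuous_map_componentwise_UNIV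
      using balancedD(1)[OF bal] by (auto intro!: continuous_intros)
    then have "openin euclideanreal {e \<in> topspace euclideanreal. x + e *\<^sub>R ?w \<in> T}"
      using T by (intro openin_continuous_map_preimage) auto
    then have "open {e. x + e *\<^sub>R ?w \<in> T}" by simp
    moreover have "0 \<in> {e. x + e *\<^sub>R ?w \<in> T}" using T by simp
    ultimately obtain \<epsilon> where \<epsilon>: "0 < \<epsilon>" "\<And>e. dist e 0 < \<epsilon> \<Longrightarrow> x + e *\<^sub>R ?w \<in> T"
      unfolding open_dist by blast
    have "x + (\<epsilon> / 2) *\<^sub>R ?w \<in> T" using \<epsilon>(1) by (intro \<epsilon>(2)) simp
    then show "\<exists>y. y \<in> C_END d p \<and> y \<in> T" using C[of "\<epsilon> / 2"] \<epsilon>(1) by auto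
  qed
  then show "x \<in> S1 d p" using nn x by (simp add: S1_def vol_eq)
qed

subsection \<open>Rational closed cones\<close>

lemma common_denominator:
  assumes "finite S" "S \<subseteq> \<rat>"
  shows "\<exists>N::nat. 0 < N \<and> (\<forall>q\<in>S. real N * q \<in> \<int>)"
  using assms
proof (induction S rule: finite_induct)
  case empty
  show ?case by (rule exI[of _ 1]) simp
next
  case (insert q S)
  obtain N :: nat where N: "0 < N" "\<forall>q\<in>S. real N * q \<in> \<int>" using insert by auto
  have "q \<in> \<rat>" using insert by simp
  then obtain a b :: int where ab: "0 < b" "q = of_int a / of_int b" by (rule Rats_cases') (rule that)
  have "real (N * nat b) * q = of_int (int N * a)" using ab by simp
  moreover have "real (N * nat b) * q' \<in> \<int>" if "q' \<in> S" for q'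
  proof -
    have "real (nat b) * (real N * q') \<in> \<int>" by (rule Ints_mult[OF Ints_of_nat bspec[OF N(2) that]])
    then show ?thesis by (simp add: mult_ac)
  qed
  ultimately show ?case using N(1) ab(1)
    by (intro exI[of _ "N * nat b"]) (auto simp del: of_nat_mult)
qed

text \<open>Rationality is expressed by values at rational points: the double description step
  combines generators with exactly such values as coefficients.\<close>

definition rational_functional :: "((nat \<Rightarrow> real) \<Rightarrow> real) \<Rightarrow> bool" where
  "rational_functional f \<longleftrightarrow> linear f \<and> (\<forall>x. (\<forall>i. x i \<in> \<rat>) \<longrightarrow> f x \<in> \<rat>)"

lemma rational_functional_sum:
  assumes "\<And>i. i \<in> I \<Longrightarrow> c i \<in> \<rat>"
  shows "rational_functional (\<lambda>x. \<Sum>i\<in>I. c i * x (g i))"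
  unfolding rational_functional_def
proof (intro conjI allI impI)
  show "linear (\<lambda>x. \<Sum>i\<in>I. c i * x (g i))"
    by (rule linear_funI) (simp_all add: sum.distrib sum_distrib_left algebra_simps)
  fix x :: "nat \<Rightarrow> real" assume "\<forall>i. x i \<in> \<rat>"
  then show "(\<Sum>i\<in>I. c i * x (g i)) \<in> \<rat>"
    using assms by (induction I rule: infinite_finite_induct) auto
qed

lemma rational_functional_diff:
  assumes "rational_functional f" "rational_functional g"
  shows "rational_functional (\<lambda>x. f x - g x)"
  using assms by (auto simp: rational_functional_def intro: linear_compose_sub)

lemma rational_functional_minus:
  assumes "rational_functional f"
  shows "rational_functional (\<lambda>x. - f x)"
  using assms by (auto simp: rational_functional_def intro: linear_compose_neg)

text \<open>The orthant is generated by unit vectors. Intersecting with one half-space at a time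
  keeps the generators rational.\<close>

lemma rational_cone_generators:
  assumes "\<forall>f\<in>set \<Phi>. rational_functional f"
  shows "\<exists>G. finite G \<and> (\<forall>g\<in>G. \<forall>i. g i \<in> \<rat>) \<and>
    fcone G = {x. (\<forall>i\<ge>n. x i = 0) \<and> (\<forall>i<n. 0 \<le> x i) \<and> (\<forall>f\<in>set \<Phi>. 0 \<le> f x)}"
  using assms
proof (induction \<Phi>)
  case Nil
  define e where "e i = (\<lambda>j::nat. of_bool (j = i) :: real)" for i
  have inj: "inj_on e {..<n}"
  proof (rule inj_onI)
    fix i j assume "e i = e j"
    then have "e i i = e j i" by simp
    then show "i = j" by (simp add: e_def)
  qed
  have ap: "(\<Sum>g\<in>e ` {..<n}. l g *\<^sub>R g) j = (if j < n then l (e j) else 0)" for l :: "(nat \<Rightarrow> real) \<Rightarrow> real" and j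
  proof -
    have "(\<Sum>g\<in>e ` {..<n}. l g *\<^sub>R g) j = (\<Sum>i<n. if i = j then l (e j) else 0)"
      unfolding sum.reindex[OF inj] sum_fun_apply by (intro sum.cong) (auto simp: e_def)
    then show ?thesis by simp
  qed
  have "fcone (e ` {..<n}) = {x. (\<forall>i\<ge>n. x i = 0) \<and> (\<forall>i<n. 0 \<le> x i)}"
  proof (intro equalityI subsetI)
    fix x assume "x \<in> fcone (e ` {..<n})"
    then obtain l where "x = (\<Sum>g\<in>e ` {..<n}. l g *\<^sub>R g)" "\<forall>g\<in>e ` {..<n}. 0 \<le> l g"
      unfolding fcone_def by blast
    then show "x \<in> {x. (\<forall>i\<ge>n. x i = 0) \<and> (\<forall>i<n. 0 \<le> x i)}" by (simp add: ap)
  next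
    fix x :: "nat \<Rightarrow> real" assume x: "x \<in> {x. (\<forall>i\<ge>n. x i = 0) \<and> (\<forall>i<n. 0 \<le> x i)}"
    define l where "l g = x (the_inv_into {..<n} e g)" for g
    have l: "l (e i) = x i" if "i < n" for i
      using that inj by (simp add: l_def the_inv_into_f_f)
    have "x = (\<Sum>g\<in>e ` {..<n}. l g *\<^sub>R g)"
    proof
      fix j show "x j = (\<Sum>g\<in>e ` {..<n}. l g *\<^sub>R g) j"
        unfolding ap using x l by auto
    qed
    moreover have "\<forall>g\<in>e ` {..<n}. 0 \<le> l g" using x l by auto
    ultimately show "x \<in> fcone (e ` {..<n})" unfolding fcone_def by blast
  qed
  then show ?case by (intro exI[of _ "e ` {..<n}"]) (auto simp: e_def)
next
  case (Cons a \<Phi>)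
  have "rational_functional a" using Cons.prems by simp
  then have a: "linear a" "\<forall>x. (\<forall>i. x i \<in> \<rat>) \<longrightarrow> a x \<in> \<rat>"
    unfolding rational_functional_def by (rule conjunct1, rule conjunct2)
  have prems: "\<forall>f\<in>set \<Phi>. rational_functional f" using Cons.prems by simp
  obtain G where G: "finite G" "\<forall>g\<in>G. \<forall>i. g i \<in> \<rat>"
    "fcone G = {x. (\<forall>i\<ge>n. x i = 0) \<and> (\<forall>i<n. 0 \<le> x i) \<and> (\<forall>f\<in>set \<Phi>. 0 \<le> f x)}"
    using Cons.IH[OF prems] by (elim exE conjE)
  define H where "H = {g \<in> G. 0 \<le> a g} \<union>
    (\<lambda>(g, h). a g *\<^sub>R h - a h *\<^sub>R g) ` ({g \<in> G. 0 < a g} \<times> {g \<in> G. a g < 0})"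
  have "fcone H = {x \<in> fcone G. 0 \<le> a x}" unfolding H_def by (rule fcone_halfspace[OF G(1) a(1), symmetric])
  then have Hc: "fcone H = {x. (\<forall>i\<ge>n. x i = 0) \<and> (\<forall>i<n. 0 \<le> x i) \<and> (\<forall>f\<in>set (a # \<Phi>). 0 \<le> f x)}"
    unfolding G(3) by auto
  have Hf: "finite H" using G(1) by (simp add: H_def)
  have Hq: "g i \<in> \<rat>" if g: "g \<in> H" for g i
  proof -
    have aG: "a g \<in> \<rat>" if "g \<in> G" for g using a(2) G(2) that by blast
    from g have "g \<in> G \<or> (\<exists>u\<in>G. \<exists>v\<in>G. g = a u *\<^sub>R v - a v *\<^sub>R u)"
      unfolding H_def by auto
    then consider "g \<in> G" | u v where "u \<in> G" "v \<in> G" "g = a u *\<^sub>R v - a v *\<^sub>R u"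
      by (elim disjE bexE)
    then show ?thesis
    proof cases
      case 2
      have "v i \<in> \<rat>" "u i \<in> \<rat>" using G(2) 2(1,2) by blast+
      then show ?thesis using aG[OF 2(1)] aG[OF 2(2)] by (simp add: 2(3))
    qed (use G(2) in blast)
  qed
  show ?case
  proof (intro exI[of _ H] conjI ballI allI)
    show "finite H" by (rule Hf)
    show "g i \<in> \<rat>" if "g \<in> H" for g i using that by (rule Hq)
  qed (rule Hc)
qed

definition closed_cone :: "nat \<Rightarrow> nat \<Rightarrow> ((nat \<Rightarrow> real) \<Rightarrow> real) list \<Rightarrow> (nat \<Rightarrow> real) set" where
  "closed_cone d p \<Phi> = {x \<in> balanced d p. (\<forall>i<p * (d + 1). 0 \<le> x i) \<and> (\<forall>f\<in>set \<Phi>. 0 \<le> f x)}"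

lemma rational_row_sum: "rational_functional (row_sum d p r)"
  using rational_functional_sum[of "{..d}" "\<lambda>_. 1" "\<lambda>j. j * p + r"] by (simp add: row_sum_def[abs_def])

text \<open>The volume equalities enter as pairs of opposite inequalities. Nonzero rational
  generators have positive height and can be rescaled to one common height at which they are
  integral.\<close>

lemma closed_cone_generators:
  assumes p: "0 < p" and \<Phi>: "\<forall>f\<in>set \<Phi>. rational_functional f"
  shows "\<exists>\<mu> G. 0 < \<mu> \<and> finite G \<and> G \<subseteq> lattice d p \<and> (\<forall>g\<in>G. row_sum d p 0 g = real \<mu>) \<and>
    fcone G = closed_cone d p \<Phi>"
proof -
  define E where "E = map (\<lambda>r x. row_sum d p r x - row_sum d p 0 x) [0..<p]"
  define F where "F = map (\<lambda>r x. row_sum d p 0 x - row_sum d p r x) [0..<p]"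
  have "\<forall>f\<in>set (\<Phi> @ E @ F). rational_functional f"
    using \<Phi> rational_functional_diff[OF rational_row_sum rational_row_sum] by (auto simp: E_def F_def)
  from rational_cone_generators[OF this, where n = "p * (d + 1)"]
  obtain G where G: "finite G" "\<forall>g\<in>G. \<forall>i. g i \<in> \<rat>"
      "fcone G = {x. (\<forall>i\<ge>p * (d + 1). x i = 0) \<and> (\<forall>i<p * (d + 1). 0 \<le> x i) \<and> (\<forall>f\<in>set (\<Phi> @ E @ F). 0 \<le> f x)}"
    by (elim exE conjE)
  have bal: "x \<in> balanced d p \<longleftrightarrow> (\<forall>i\<ge>p * (d + 1). x i = 0) \<and> (\<forall>f\<in>set (E @ F). 0 \<le> f x)" for x
  proof -
    have "(\<forall>f\<in>set (E @ F). 0 \<le> f x) \<longleftrightarrow>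
        (\<forall>r<p. 0 \<le> row_sum d p r x - row_sum d p 0 x) \<and> (\<forall>r<p. 0 \<le> row_sum d p 0 x - row_sum d p r x)"
      unfolding E_def F_def by (auto simp: ball_Un)
    also have "\<dots> \<longleftrightarrow> (\<forall>r<p. row_sum d p r x = row_sum d p 0 x)"
      by (metis diff_ge_0_iff_ge order_antisym order_refl)
    finally have 1: "(\<forall>f\<in>set (E @ F). 0 \<le> f x) \<longleftrightarrow> (\<forall>r<p. row_sum d p r x = row_sum d p 0 x)" .
    show ?thesis
      unfolding 1 using balancedD[of x d p] balancedI[of p d x "row_sum d p 0 x"] by blast
  qed
  have cone: "fcone G = closed_cone d p \<Phi>"
    unfolding G(3) closed_cone_def bal set_append ball_Un by blast
  have ht: "0 < row_sum d p 0 g" if "g \<in> G" "g \<noteq> 0" for g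
  proof -
    have g: "g \<in> balanced d p" "\<And>i. i < p * (d + 1) \<Longrightarrow> 0 \<le> g i"
      using fcone_base[OF G(1) that(1)] unfolding cone closed_cone_def by blast+
    note le = balanced_le_volume[OF g(1) p g(2)]
    show ?thesis
    proof (rule ccontr)
      assume "\<not> ?thesis"
      then have "g i = 0" for i using le[of i] by linarith
      then have "g = 0" by (simp add: fun_eq_iff)
      with that show False by simp
    qed
  qed
  \<comment> \<open>The entries of the generators normalised to height 1; a common denominator of
    them serves as the common height.\<close>
  define S where "S = (\<lambda>(g, i). g i / row_sum d p 0 g) ` (G \<times> {..<p * (d + 1)})"
  have finS: "finite S" using G(1) by (simp add: S_def)
  have "S \<subseteq> \<rat>"
  proof
    fix q assume "q \<in> S"
    then obtain g i where q: "g \<in> G" "q = g i / row_sum d p 0 g" by (auto simp: S_def)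
    have "row_sum d p 0 g \<in> \<rat>"
      using rational_row_sum[of d p 0] G(2) q(1) unfolding rational_functional_def by blast
    moreover have "g i \<in> \<rat>" using G(2) q(1) by blast
    ultimately show "q \<in> \<rat>" unfolding q(2) by (intro Rats_divide)
  qed
  from common_denominator[OF finS this]
  obtain \<mu> :: nat where \<mu>: "0 < \<mu>" "\<forall>q\<in>S. real \<mu> * q \<in> \<int>"
    by (elim exE conjE)
  define s where "s g = (real \<mu> / row_sum d p 0 g) *\<^sub>R g" for g
  define G' where "G' = s ` (G - {0})"
  have G'1: "g \<in> lattice d p \<and> row_sum d p 0 g = real \<mu>" if gG: "g \<in> G'" for g
  proof -
    obtain h where h: "h \<in> G" "h \<noteq> 0" "g = s h" using gG unfolding G'_def by blast
    have supp: "h i = 0" if "p * (d + 1) \<le> i" for i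
      using fcone_base[OF G(1) h(1)] that unfolding G(3) by blast
    have "g i \<in> \<int>" for i
    proof (cases "i < p * (d + 1)")
      case True
      then have "h i / row_sum d p 0 h \<in> S"
        unfolding S_def using h(1) by (intro image_eqI[of _ _ "(h, i)"]) simp_all
      from \<mu>(2)[rule_format, OF this] show ?thesis by (simp add: h(3) s_def)
    qed (use supp in \<open>simp add: h(3) s_def\<close>)
    moreover have "row_sum d p 0 g = real \<mu>"
      using ht[OF h(1,2)] by (simp add: h(3) s_def linear_cmul[OF linear_row_sum])
    ultimately show ?thesis using supp by (simp add: lattice_def h(3) s_def)
  qed
  have "fcone G' = fcone G"
  proof (rule antisym)
    show "fcone G' \<subseteq> fcone G"
    proof (rule fcone_minimal)
      fix g assume "g \<in> G'"
      then obtain h where h: "h \<in> G" "h \<noteq> 0" "g = s h" unfolding G'_def by blast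
      then show "g \<in> fcone G"
        using ht[OF h(1,2)] fcone_base[OF G(1) h(1)] by (auto simp: s_def intro!: fcone_scaleR)
    qed
    show "fcone G \<subseteq> fcone G'"
    proof (rule fcone_minimal)
      fix h assume h: "h \<in> G"
      show "h \<in> fcone G'"
      proof (cases "h = 0")
        case False
        have "s h \<in> fcone G'" using G(1) h False by (intro fcone_base) (auto simp: G'_def)
        then have "(row_sum d p 0 h / real \<mu>) *\<^sub>R s h \<in> fcone G'"
          using ht[OF h False] by (intro fcone_scaleR) auto
        moreover have "(row_sum d p 0 h / real \<mu>) *\<^sub>R s h = h"
          using ht[OF h False] \<mu>(1) by (simp add: s_def)
        ultimately show ?thesis by simp
      qed (simp add: fcone_zero)
    qed
  qed
  then have "fcone G' = closed_cone d p \<Phi>" by (simp only: cone)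
  moreover have "finite G'" using G(1) by (simp add: G'_def)
  moreover have "G' \<subseteq> lattice d p" "\<forall>g\<in>G'. row_sum d p 0 g = real \<mu>" using G'1 by blast+
  ultimately show ?thesis using \<mu>(1) by (intro exI[of _ \<mu>] exI[of _ G'] conjI)
qed

text \<open>Here \<open>w\<close> lies in the cone, so the half-open pieces make up the closed cone.
  Its height is positive because the point \<open>z\<close> rules out an empty generating set; this
  yields the strict degree bound and validity at 0. The cone {0} would have count 1 at 0 and 0
  elsewhere.\<close>

lemma closed_cone_count:
  assumes p: "0 < p" and \<Phi>: "\<forall>f\<in>set \<Phi>. rational_functional f"
    and z: "z \<in> closed_cone d p \<Phi>" "z \<noteq> 0"
  shows "quasi_polynomial_le (p * d) (\<lambda>V. real (card {x \<in> lattice d p \<inter> closed_cone d p \<Phi>. row_sum d p 0 x = real V}))"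
proof -
  obtain \<mu> G where \<mu>: "0 < \<mu>" and G': "finite G" "G \<subseteq> lattice d p" "\<forall>g\<in>G. row_sum d p 0 g = real \<mu>"
      and cone: "fcone G = closed_cone d p \<Phi>"
    using closed_cone_generators[OF p \<Phi>, where d = d] by (elim exE conjE)
  note G = G'(1,2) bspec[OF G'(3)]
  have G0: "G \<noteq> {}"
    using z unfolding cone[symmetric] fcone_def by auto
  obtain w l where w: "w = (\<Sum>g\<in>G. l g *\<^sub>R g)" "\<forall>g\<in>G. 0 < l g"
      "\<forall>B\<in>bases G. \<forall>b\<in>B. representation B w b \<noteq> 0"
    using exists_generic_interior[OF G(1)] by (elim exE conjE)
  have wspan: "w \<in> span G" unfolding w(1) by (intro span_sum span_scale span_base)
  have wcone: "w \<in> fcone G" unfolding w(1)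
    by (intro fcone_sum fcone_scaleR fcone_base G(1)) (use w(2) in \<open>auto intro: less_imp_le\<close>)
  have "row_sum d p 0 w = (\<Sum>g\<in>G. l g * real \<mu>)"
    unfolding w(1) by (simp add: linear_sum[OF linear_row_sum] linear_cmul[OF linear_row_sum] G(3))
  also have "0 < \<dots>" using G(1) G0 w(2) \<mu> by (intro sum_pos) auto
  finally have wpos: "0 < row_sum d p 0 w" .
  have Gbal: "G \<subseteq> balanced d p"
    using fcone_base[OF G(1)] unfolding cone closed_cone_def by blast
  have fin: "finite {x \<in> lattice d p \<inter> fcone G. row_sum d p 0 x = real V}" for V
    unfolding cone by (rule finite_subset[OF _ finite_lattice_points[OF p, where V = V]]) (auto simp: closed_cone_def)
  have "\<exists>h. fps_of_poly h = hilbert (row_sum d p 0)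
      {x \<in> lattice d p \<inter> span G. \<forall>\<^sub>F e in at_right 0. x + e *\<^sub>R w \<in> fcone G} * (1 - fps_X ^ \<mu>) ^ dim G \<and>
    (\<forall>i. 0 \<le> coeff h i) \<and> degree h \<le> \<mu> * dim G \<and> (0 < row_sum d p 0 w \<longrightarrow> degree h < \<mu> * dim G)"
    by (rule hilbert_cone[OF G(1) linear_row_sum G(3) \<mu> G(2) lattice_closed fin wspan]) (use w(3) in auto)
  then obtain h where h: "fps_of_poly h = hilbert (row_sum d p 0)
      {x \<in> lattice d p \<inter> span G. \<forall>\<^sub>F e in at_right 0. x + e *\<^sub>R w \<in> fcone G} * (1 - fps_X ^ \<mu>) ^ dim G"
      "degree h < \<mu> * dim G"
    using wpos by (elim exE conjE impE)
  have "{x \<in> lattice d p \<inter> span G. \<forall>\<^sub>F e in at_right 0. x + e *\<^sub>R w \<in> fcone G} = lattice d p \<inter> closed_cone d p \<Phi>"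
  proof (intro equalityI subsetI)
    fix x assume x: "x \<in> {x \<in> lattice d p \<inter> span G. \<forall>\<^sub>F e in at_right 0. x + e *\<^sub>R w \<in> fcone G}"
    then have ev: "\<forall>\<^sub>F e in at_right 0. x + e *\<^sub>R w \<in> closed_cone d p \<Phi>" by (simp add: cone)
    have "x \<in> balanced d p" using x span_minimal[OF Gbal subspace_balanced] by blast
    moreover have nonneg: "0 \<le> f x" if f: "linear f" "\<And>y. y \<in> closed_cone d p \<Phi> \<Longrightarrow> 0 \<le> f y"
      for f :: "(nat \<Rightarrow> real) \<Rightarrow> real"
    proof (rule ccontr)
      assume "\<not> 0 \<le> f x"
      then have "\<forall>\<^sub>F e in at_right 0. f x + e * f w < 0"
        by (intro eventually_at_right_affine_neg) simp
      with ev have "\<forall>\<^sub>F e in at_right (0::real). False"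
      proof eventually_elim
        case (elim e)
        have "0 \<le> f (x + e *\<^sub>R w)" using elim(1) by (rule f(2))
        then show False using elim(2) by (simp add: linear_add[OF f(1)] linear_cmul[OF f(1)])
      qed
      then show False by simp
    qed
    moreover have "0 \<le> x i" if "i < p * (d + 1)" for i
    proof (rule nonneg[OF linear_coord])
      show "0 \<le> y i" if "y \<in> closed_cone d p \<Phi>" for y
        using that \<open>i < p * (d + 1)\<close> unfolding closed_cone_def by blast
    qed
    moreover have "0 \<le> f x" if "f \<in> set \<Phi>" for f
    proof (rule nonneg)
      show "linear f" using \<Phi> that unfolding rational_functional_def by blast
      show "0 \<le> f y" if "y \<in> closed_cone d p \<Phi>" for y
        using that \<open>f \<in> set \<Phi>\<close> unfolding closed_cone_def by blast
    qed
    ultimately show "x \<in> lattice d p \<inter> closed_cone d p \<Phi>" using x unfolding closed_cone_def by blast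
  next
    fix x assume x: "x \<in> lattice d p \<inter> closed_cone d p \<Phi>"
    then have xc: "x \<in> fcone G" by (simp add: cone)
    have "\<forall>\<^sub>F e in at_right (0::real). x + e *\<^sub>R w \<in> fcone G"
      using eventually_at_right_less[of "0::real"]
      by eventually_elim (intro fcone_add fcone_scaleR xc wcone less_imp_le)
    then show "x \<in> {x \<in> lattice d p \<inter> span G. \<forall>\<^sub>F e in at_right 0. x + e *\<^sub>R w \<in> fcone G}"
      using x fcone_subset_span[THEN subsetD, OF xc] by simp
  qed
  then have h1: "fps_of_poly h = Abs_fps (\<lambda>V. real (card {x \<in> lattice d p \<inter> closed_cone d p \<Phi>. row_sum d p 0 x = real V}))
      * (1 - fps_X ^ \<mu>) ^ dim G"
    using h(1) by (simp only: hilbert_def)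
  obtain D where D: "dim G = Suc D" using h(2) by (cases "dim G") auto
  \<comment> \<open>The extra inequalities may cut out a lower-dimensional cone, so the degree is
    only bounded by \<open>p * d\<close>.\<close>
  have "dim G \<le> p * d + 1"
  proof -
    obtain B where B: "B \<subseteq> G" "independent B" "G \<subseteq> span B" using maximal_independent_subset[of G] by blast
    obtain A where A: "A \<subseteq> balanced d p" "independent A" "balanced d p \<subseteq> span A" "card A = dim (balanced d p)"
      using basis_exists[of "balanced d p"] by blast
    have "finite A" using A(4) dim_balanced[OF p, of d] by (intro card_ge_0_finite) simp
    moreover have "B \<subseteq> span A" using B(1) Gbal A(3) by blast
    ultimately have "card B \<le> card A" using independent_span_bound[OF _ B(2), of A] by simp
    moreover have "card B = dim G" by (rule basis_card_eq_dim[OF B(1,3,2)])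
    ultimately show ?thesis using A(4) dim_balanced[OF p, of d] by simp
  qed
  then have D_le: "D \<le> p * d" using D by simp
  have deg: "degree h \<le> \<mu> * Suc D" using h(2)[unfolded D] by (rule less_imp_le)
  have "quasi_polynomial_le D (\<lambda>V. real (card {x \<in> lattice d p \<inter> closed_cone d p \<Phi>. row_sum d p 0 x = real V}))"
  proof (rule constituents_of_numerator[OF \<mu> h1[unfolded D] deg])
    fix q :: "nat \<Rightarrow> real poly"
    assume q: "\<And>n. 1 \<le> n \<or> degree h < \<mu> * Suc D \<Longrightarrow>
        real (card {x \<in> lattice d p \<inter> closed_cone d p \<Phi>. row_sum d p 0 x = real n}) = poly (q (n mod \<mu>)) (real n)"
      and dq: "\<And>r. degree (q r) \<le> D"
    show "quasi_polynomial_le D (\<lambda>V. real (card {x \<in> lattice d p \<inter> closed_cone d p \<Phi>. row_sum d p 0 x = real V}))"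
      unfolding quasi_polynomial_le_def
      by (intro exI[of _ \<mu>] conjI exI[of _ q] allI q dq \<mu> disjI2 h(2)[unfolded D])
  qed
  then show ?thesis using D_le by (rule quasi_polynomial_le_mono)
qed

subsection \<open>Lexicographic conditions\<close>

text \<open>The first nonzero value in the list is negative. For the coefficients of a polynomial,
  listed from the top, this means a negative leading coefficient.\<close>

fun lex_neg :: "('a \<Rightarrow> real) list \<Rightarrow> 'a \<Rightarrow> bool" where
  "lex_neg [] x \<longleftrightarrow> False"
| "lex_neg (f # fs) x \<longleftrightarrow> f x < 0 \<or> f x = 0 \<and> lex_neg fs x"

lemma lex_neg_coeffs:
  fixes q :: "'a \<Rightarrow> real poly"
  assumes "\<And>i. n \<le> i \<Longrightarrow> coeff (q x) i = 0"
  shows "lex_neg (map (\<lambda>k x. coeff (q x) k) (rev [0..<n])) x \<longleftrightarrow> lead_coeff (q x) < 0"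
  using assms
proof (induction n)
  case 0
  then have "q x = 0" by (simp add: poly_eq_iff)
  then show ?case by simp
next
  case (Suc n)
  have eq: "lex_neg (map (\<lambda>k x. coeff (q x) k) (rev [0..<Suc n])) x \<longleftrightarrow>
      coeff (q x) n < 0 \<or> coeff (q x) n = 0 \<and> lex_neg (map (\<lambda>k x. coeff (q x) k) (rev [0..<n])) x"
    by simp
  show ?case
  proof (cases "coeff (q x) n = 0")
    case True
    have "coeff (q x) i = 0" if "n \<le> i" for i
      using that True Suc.prems[of i] by (cases "i = n") simp_all
    from Suc.IH[OF this] show ?thesis unfolding eq using True by simp
  next
    case False
    have "degree (q x) \<le> n"
    proof (rule degree_le, intro allI impI)
      fix i assume "n < i"
      then show "coeff (q x) i = 0" by (intro Suc.prems) simp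
    qed
    moreover have "n \<le> degree (q x)" using False by (rule le_degree)
    ultimately have "degree (q x) = n" by simp
    then show ?thesis unfolding eq using False by simp
  qed
qed

definition cone_points :: "nat \<Rightarrow> nat \<Rightarrow> ((nat \<Rightarrow> real) \<Rightarrow> real) list \<Rightarrow> nat \<Rightarrow> (nat \<Rightarrow> real) set" where
  "cone_points d p \<Phi> V = {x \<in> lattice d p \<inter> closed_cone d p \<Phi>. row_sum d p 0 x = real V}"

lemma finite_cone_points: "0 < p \<Longrightarrow> finite (cone_points d p \<Phi> V)"
  by (rule finite_subset[OF _ finite_lattice_points[where V = V]])
    (auto simp: cone_points_def closed_cone_def)

lemma cone_points_Cons: "cone_points d p (f # \<Phi>) V = {x \<in> cone_points d p \<Phi> V. 0 \<le> f x}"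
  by (auto simp: cone_points_def closed_cone_def)

text \<open>A strict inequality is the difference of two closed cones. All closed cones that arise
  contain the nonzero point \<open>z\<close>, so that their counting functions are quasi-polynomial also at \<open>0\<close>.\<close>

lemma lex_neg_count:
  assumes p: "0 < p" and "\<forall>f\<in>set \<Phi>. rational_functional f" "z \<in> closed_cone d p \<Phi>" and z: "z \<noteq> 0"
    and "\<forall>fs\<in>set Fs. \<forall>f\<in>set fs. rational_functional f \<and> f z = 0"
  shows "quasi_polynomial_le (p * d) (\<lambda>V. real (card {x \<in> cone_points d p \<Phi> V. \<forall>fs\<in>set Fs. lex_neg fs x}))"
  using assms(2,3,5)
proof (induction Fs arbitrary: \<Phi>)
  case Nil
  then show ?case using closed_cone_count[OF p Nil.prems(1,2) z] by (simp add: cone_points_def)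
next
  case (Cons fs Fs)
  have IH: "quasi_polynomial_le (p * d) (\<lambda>V. real (card {x \<in> cone_points d p \<Phi> V. \<forall>fs\<in>set Fs. lex_neg fs x}))"
    if "\<forall>f\<in>set \<Phi>. rational_functional f" "z \<in> closed_cone d p \<Phi>" for \<Phi>
    using Cons.IH[OF that] Cons.prems(3) by simp
  have Fs: "\<forall>f\<in>set fs. rational_functional f \<and> f z = 0" using Cons.prems(3) by simp
  have "quasi_polynomial_le (p * d) (\<lambda>V. real (card {x \<in> cone_points d p \<Phi> V. lex_neg fs x \<and> (\<forall>fs\<in>set Fs. lex_neg fs x)}))"
    using Fs Cons.prems(1,2)
  proof (induction fs arbitrary: \<Phi>)
    case Nil
    then show ?case by (simp add: quasi_polynomial_le_0)
  next
    case (Cons f fs)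
    have f: "rational_functional f" "f z = 0" using Cons.prems(1) by simp_all
    let ?P = "\<lambda>x. \<forall>fs\<in>set Fs. lex_neg fs x"
    let ?A = "\<lambda>V. {x \<in> cone_points d p \<Phi> V. ?P x}"
    let ?B = "\<lambda>V. {x \<in> cone_points d p (f # \<Phi>) V. ?P x}"
    let ?C = "\<lambda>V. {x \<in> cone_points d p ((\<lambda>x. - f x) # f # \<Phi>) V. lex_neg fs x \<and> ?P x}"
    let ?T = "\<lambda>V. {x \<in> cone_points d p \<Phi> V. lex_neg (f # fs) x \<and> ?P x}"
    \<comment> \<open>Since \<open>f z = 0\<close>, the point \<open>z\<close> survives in both
      enlarged cones, whichever sign of \<open>f\<close> is imposed.\<close>
    have zf: "z \<in> closed_cone d p (f # \<Phi>)" "z \<in> closed_cone d p ((\<lambda>x. - f x) # f # \<Phi>)"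
      using Cons.prems(3) f(2) by (simp_all add: closed_cone_def)
    have rf: "\<forall>g\<in>set (f # \<Phi>). rational_functional g" "\<forall>g\<in>set ((\<lambda>x. - f x) # f # \<Phi>). rational_functional g"
      using Cons.prems(2) f(1) rational_functional_minus[OF f(1)] by simp_all
    have qA: "quasi_polynomial_le (p * d) (\<lambda>V. real (card (?A V)))" by (rule IH[OF Cons.prems(2,3)])
    have qB: "quasi_polynomial_le (p * d) (\<lambda>V. real (card (?B V)))" by (rule IH[OF rf(1) zf(1)])
    have fs: "\<forall>f\<in>set fs. rational_functional f \<and> f z = 0" using Cons.prems(1) by simp
    have qC: "quasi_polynomial_le (p * d) (\<lambda>V. real (card (?C V)))" by (rule Cons.IH[OF fs rf(2) zf(2)])
    \<comment> \<open>\<open>?A\<close> without \<open>?B\<close> leaves the points with f x < 0; in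
      \<open>?C\<close> two opposite inequalities express f x = 0.\<close>
    have "real (card (?T V)) = real (card (?A V)) - real (card (?B V)) + real (card (?C V))" for V
    proof -
      have fin: "finite (cone_points d p \<Phi> V)" by (rule finite_cone_points[OF p])
      let ?N = "{x \<in> cone_points d p \<Phi> V. f x < 0 \<and> ?P x}"
      have A: "?A V = ?B V \<union> ?N" "?B V \<inter> ?N = {}" unfolding cone_points_Cons by (auto simp: not_le)
      have T: "?T V = ?C V \<union> ?N" "?C V \<inter> ?N = {}" unfolding cone_points_Cons by auto
      have finB: "finite (?B V)" "finite (?C V)" "finite ?N"
        by (rule finite_subset[OF _ fin]; auto simp: cone_points_Cons)+
      have "card (?A V) = card (?B V) + card ?N" unfolding A(1) by (rule card_Un_disjoint[OF finB(1,3) A(2)])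
      moreover have "card (?T V) = card (?C V) + card ?N" unfolding T(1) by (rule card_Un_disjoint[OF finB(2,3) T(2)])
      ultimately show ?thesis by linarith
    qed
    then show ?case
      using quasi_polynomial_le_add[OF quasi_polynomial_le_diff[OF qA qB] qC] by (simp only:)
  qed
  then show ?case by simp
qed

subsection \<open>All lattice points of \<open>C_END\<close>\<close>

lemma Rats_coeff_mult:
  fixes a b :: "real poly"
  assumes "\<forall>k. coeff a k \<in> \<rat>" "\<forall>k. coeff b k \<in> \<rat>"
  shows "\<forall>k. coeff (a * b) k \<in> \<rat>"
  using assms by (auto simp: coeff_mult intro!: Rats_sum Rats_mult)

lemma Rats_coeff_Lpoly:
  assumes "x \<in> \<rat>"
  shows "coeff (Lpoly d x) k \<in> \<rat>"
proof -
  have "\<forall>k. coeff (\<Prod>i<n. [:real d - x - real i, 1:]) k \<in> \<rat>" for n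
  proof (induction n)
    case 0
    show ?case by (simp add: coeff_pCons split: nat.split)
  next
    case (Suc n)
    have "\<forall>k. coeff [:real d - x - real n, 1:] k \<in> \<rat>"
      using assms by (auto simp: coeff_pCons split: nat.split)
    from Rats_coeff_mult[OF Suc this] show ?case by simp
  qed
  moreover have "(1 :: real) / fact d \<in> \<rat>"
    using Rats_divide[OF Rats_1 Rats_of_nat[of "fact d"]] by (simp only: of_nat_fact)
  ultimately show ?thesis unfolding Lpoly_def coeff_smult by (intro Rats_mult) auto
qed

lemma rational_coeff_row_poly:
  "rational_functional (\<lambda>h. coeff (row_poly d p h r) k)"
  "rational_functional (\<lambda>h. coeff (pcompose (row_poly d p h r) [:1, 1:]) k)"
proof -
  have "(\<lambda>h. coeff (row_poly d p h r) k) = (\<lambda>h. \<Sum>j\<le>d. coeff (Lpoly d (real j)) k * h (j * p + r))"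
    by (simp add: row_poly_def coeff_sum mult.commute)
  then show "rational_functional (\<lambda>h. coeff (row_poly d p h r) k)"
    by (simp only:) (intro rational_functional_sum Rats_coeff_Lpoly Rats_of_nat)
  have "(\<lambda>h. coeff (pcompose (row_poly d p h r) [:1, 1:]) k) =
      (\<lambda>h. \<Sum>j\<le>d. coeff (Lpoly d (real j - 1)) k * h (j * p + r))"
    by (simp add: row_poly_def pcompose_sum pcompose_smult pcompose_Lpoly coeff_sum mult.commute)
  then show "rational_functional (\<lambda>h. coeff (pcompose (row_poly d p h r) [:1, 1:]) k)"
    by (simp only:) (intro rational_functional_sum Rats_coeff_Lpoly Rats_of_nat Rats_diff Rats_1)
qed

lemma rational_coeff_diff_poly: "rational_functional (\<lambda>h. coeff (diff_poly d p h r) k)"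
proof (cases "r + 1 < p")
  case True
  then have "(\<lambda>h. coeff (diff_poly d p h r) k) = (\<lambda>h. coeff (row_poly d p h (r + 1)) k - coeff (row_poly d p h r) k)"
    by (simp add: diff_poly_def)
  then show ?thesis by (simp only:) (rule rational_functional_diff[OF rational_coeff_row_poly(1) rational_coeff_row_poly(1)])
next
  case False
  then have "(\<lambda>h. coeff (diff_poly d p h r) k) =
      (\<lambda>h. coeff (pcompose (row_poly d p h 0) [:1, 1:]) k - coeff (row_poly d p h r) k)"
    by (simp add: diff_poly_def)
  then show ?thesis by (simp only:) (rule rational_functional_diff[OF rational_coeff_row_poly(2) rational_coeff_row_poly(1)])
qed

text \<open>The list starts at degree d - 1, because the coefficient of degree d vanishes on
  balanced vectors.\<close>

definition diff_coeffs :: "nat \<Rightarrow> nat \<Rightarrow> nat \<Rightarrow> ((nat \<Rightarrow> real) \<Rightarrow> real) list" where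
  "diff_coeffs d p r = map (\<lambda>k h. coeff (diff_poly d p h r) k) (rev [0..<d])"

lemma lex_neg_diff_coeffs:
  assumes "0 < d" "h \<in> balanced d p" "r < p"
  shows "lex_neg (diff_coeffs d p r) h \<longleftrightarrow> lead_coeff (diff_poly d p h r) < 0"
  unfolding diff_coeffs_def
proof (rule lex_neg_coeffs)
  fix i assume "d \<le> i"
  then have "degree (diff_poly d p h r) < i"
    using degree_diff_poly_balanced(1)[OF assms] assms(1) by linarith
  then show "coeff (diff_poly d p h r) i = 0" by (rule coeff_eq_0)
qed

text \<open>The function \<open>L\<close> of the following vector jumps only between the rows \<open>s\<close> and \<open>s + 1\<close>.\<close>

definition jump_vec :: "nat \<Rightarrow> nat \<Rightarrow> nat \<Rightarrow> real" where
  "jump_vec p s i = of_bool (i div p = (if i mod p \<le> s then 1 else 0))"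

lemma jump_vec_row:
  assumes "r < p"
  shows "jump_vec p s (j * p + r) = of_bool (j = (if r \<le> s then 1 else 0))"
  using assms by (simp add: jump_vec_def)

text \<open>Rows up to \<open>s\<close> have their single 1 in column 1, later rows in column 0, so
  increments inside each group vanish. At the wraparound to row 0 the shift to t + 1 turns column 1
  into column 0. Only the step after row \<open>s\<close> remains.\<close>

lemma jump_vec:
  assumes d: "0 < d" and p: "0 < p" and s: "s < p"
  shows "jump_vec p s \<in> closed_cone d p []" "jump_vec p s \<noteq> 0"
    and "r < p \<Longrightarrow> r \<noteq> s \<Longrightarrow> diff_poly d p (jump_vec p s) r = 0"
proof -
  have row: "(\<Sum>j\<le>d. c (jump_vec p s (j * p + r)) j) = c 1 (if r \<le> s then 1 else 0)"
    if "r < p" "\<And>j. c 0 j = 0" for r and c :: "real \<Rightarrow> nat \<Rightarrow> 'b::comm_monoid_add"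
  proof -
    let ?e = "if r \<le> s then 1 else (0 :: nat)"
    have e: "?e \<le> d" using d by simp
    have "(\<Sum>j\<le>d. c (jump_vec p s (j * p + r)) j) = (\<Sum>j\<le>d. if j = ?e then c 1 ?e else 0)"
      using that by (intro sum.cong refl) (simp add: jump_vec_row)
    also have "\<dots> = c 1 ?e" using e by (simp add: sum.delta)
    finally show ?thesis .
  qed
  show "jump_vec p s \<in> closed_cone d p []"
    unfolding closed_cone_def
  proof (intro CollectI conjI)
    show "jump_vec p s \<in> balanced d p"
    proof (rule balancedI)
      show "row_sum d p r (jump_vec p s) = 1" if "r < p" for r
        unfolding row_sum_def using row[OF that, of "\<lambda>x j. x"] by simp
      fix i assume i: "p * (d + 1) \<le> i"
      have "p * 2 \<le> p * (d + 1)" using d by (intro mult_le_mono2) simp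
      then have "2 * p \<le> i" using i by linarith
      then have "2 \<le> i div p" using p by (simp add: less_eq_div_iff_mult_less_eq)
      then show "jump_vec p s i = 0" by (simp add: jump_vec_def)
    qed
  qed (simp_all add: jump_vec_def)
  have "jump_vec p s (1 * p + 0) = 1" using jump_vec_row[OF p, of s 1] by simp
  then show "jump_vec p s \<noteq> 0" by (metis zero_fun_apply zero_neq_one)
  have rp: "row_poly d p (jump_vec p s) r = Lpoly d (if r \<le> s then 1 else 0)" if "r < p" for r
    unfolding row_poly_def using row[OF that, of "\<lambda>x j. smult x (Lpoly d (real j))"] by simp
  assume r: "r < p" "r \<noteq> s"
  show "diff_poly d p (jump_vec p s) r = 0"
  proof (cases "r + 1 < p")
    case True
    then show ?thesis using r rp[OF r(1)] rp[OF True] by (simp add: diff_poly_def)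
  next
    case False
    then have "\<not> r \<le> s" using r s by linarith
    then show ?thesis using False rp[OF r(1)] rp[OF p] by (simp add: diff_poly_def pcompose_Lpoly)
  qed
qed

text \<open>Around the cycle of rows the moments cancel and the slacks add up to the volume. If all
  increments were eventually negative, all slacks would be nonpositive, hence the volume and then
  \<open>x\<close> would be 0, and the zero vector has zero increments.\<close>

lemma exists_nonneg_diff:
  assumes d: "0 < d" and p: "0 < p" and x: "x \<in> closed_cone d p []"
  shows "\<exists>r<p. 0 \<le> lead_coeff (diff_poly d p x r)"
proof (rule ccontr)
  assume "\<not> ?thesis"
  then have neg: "lead_coeff (diff_poly d p x r) < 0" if "r < p" for r using that by (simp add: not_le)
  have b: "x \<in> balanced d p" and nn: "\<And>i. i < p * (d + 1) \<Longrightarrow> 0 \<le> x i"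
    using x unfolding closed_cone_def by blast+
  have sl: "slack d p r x \<le> 0" if "r < p" for r
  proof -
    have "0 \<le> lead_coeff (- diff_poly d p x r)" using neg[OF that] by simp
    moreover have "degree (- diff_poly d p x r) \<le> d - 1"
      using degree_diff_poly_balanced(1)[OF d b that] by simp
    ultimately have "0 \<le> coeff (- diff_poly d p x r) (d - 1)" by (rule coeff_nonneg_of_lead_coeff)
    then have "real d / fact d * slack d p r x \<le> 0"
      using degree_diff_poly_balanced(2)[OF d b that] by simp
    moreover have "0 < real d / fact d" using d by simp
    ultimately show ?thesis by (simp only: mult_le_0_iff) linarith
  qed
  have mono: "moment d p 0 x \<le> moment d p r x" if "r < p" for r
    using that
  proof (induction r)
    case (Suc r)
    then show ?case using sl[of r] by (simp add: slack_def)
  qed simp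
  have "row_sum d p (p - 1) x \<le> 0"
    using sl[of "p - 1"] mono[of "p - 1"] p by (simp add: slack_def)
  then have V: "row_sum d p 0 x \<le> 0" using balancedD(2)[OF b, of "p - 1"] p by simp
  have "x i = 0" for i using balanced_le_volume[OF b p nn, of i] V by linarith
  then have "x = 0" by (simp add: fun_eq_iff)
  then have "diff_poly d p x 0 = 0" by (simp add: diff_poly_def row_poly_def)
  then show False using neg[OF p] by simp
qed

lemma nd_eq:
  assumes d: "0 < d" and p: "0 < p"
  shows "nd d p V = card {x \<in> cone_points d p [] V. \<forall>r<p. \<not> lex_neg (diff_coeffs d p r) x}"
proof -
  have "{h \<in> C_END d p. (\<forall>i. h i \<in> \<nat>) \<and> vol d p h = real V} =
      {x \<in> cone_points d p [] V. \<forall>r<p. \<not> lex_neg (diff_coeffs d p r) x}"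
  proof (intro equalityI subsetI)
    fix h assume "h \<in> {h \<in> C_END d p. (\<forall>i. h i \<in> \<nat>) \<and> vol d p h = real V}"
    then have h: "h \<in> C_END d p" "\<And>i. h i \<in> \<nat>" "row_sum d p 0 h = real V" by (simp_all add: vol_eq)
    have b: "h \<in> balanced d p" by (rule C_END_imp_weak(1)[OF d p h(1)])
    have "h i \<in> \<int>" "0 \<le> h i" for i using h(2)[of i] by (auto elim: Nats_cases)
    then have "h \<in> lattice d p \<inter> closed_cone d p []"
      using b balancedD(1)[OF b] by (simp add: lattice_def closed_cone_def)
    moreover have "\<not> lex_neg (diff_coeffs d p r) h" if "r < p" for r
      using h(1) that unfolding C_END_iff[OF p] lex_neg_diff_coeffs[OF d b that] by (simp add: not_less)
    ultimately show "h \<in> {x \<in> cone_points d p [] V. \<forall>r<p. \<not> lex_neg (diff_coeffs d p r) x}"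
      using h(3) by (simp add: cone_points_def)
  next
    fix h assume "h \<in> {x \<in> cone_points d p [] V. \<forall>r<p. \<not> lex_neg (diff_coeffs d p r) x}"
    then have h: "h \<in> lattice d p" "h \<in> closed_cone d p []" "row_sum d p 0 h = real V"
        "\<And>r. r < p \<Longrightarrow> \<not> lex_neg (diff_coeffs d p r) h"
      by (simp_all add: cone_points_def)
    have b: "h \<in> balanced d p" "\<And>i. i < p * (d + 1) \<Longrightarrow> 0 \<le> h i"
      using h(2) unfolding closed_cone_def by blast+
    have "h i \<in> \<nat>" for i
    proof -
      have "h i \<in> \<int>" using h(1) by (simp add: lattice_def)
      moreover have "0 \<le> h i" by (rule balanced_le_volume(1)[OF b(1) p b(2)])
      ultimately show ?thesis by (simp add: Nats_altdef2)
    qed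
    moreover have "0 \<le> lead_coeff (diff_poly d p h r)" if "r < p" for r
      using h(4)[OF that] unfolding lex_neg_diff_coeffs[OF d b(1) that] by (simp add: not_less)
    then have "h \<in> C_END d p" unfolding C_END_iff[OF p] using balancedD(1)[OF b(1)] by blast
    ultimately show "h \<in> {h \<in> C_END d p. (\<forall>i. h i \<in> \<nat>) \<and> vol d p h = real V}"
      using h(3) by (simp add: vol_eq)
  qed
  then show ?thesis by (simp add: nd_def)
qed

text \<open>Inclusion-exclusion over the rows \<open>r\<close> at which \<open>L\<close> eventually decreases. Not all rows can be
  of this kind, so the corresponding cones always contain one of the vectors \<open>jump_vec\<close>.\<close>

lemma nd_quasi_polynomial:
  assumes d: "0 < d" and p: "0 < p"
  shows "quasi_polynomial_le (p * d) (\<lambda>V. real (nd d p V))"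
proof -
  define N where "N r x \<longleftrightarrow> lex_neg (diff_coeffs d p r) x" for r and x :: "nat \<Rightarrow> real"
  \<comment> \<open>Rows in \<open>T\<close> must eventually decrease, rows in \<open>Q\<close> must
    not. Elements of \<open>Q\<close> are moved to \<open>T\<close> one at a time, with alternating
    signs.\<close>
  define cnt where "cnt T Q V = card {x \<in> cone_points d p [] V. (\<forall>r\<in>T. N r x) \<and> (\<forall>r\<in>Q. \<not> N r x)}" for T Q V
  have leaf: "quasi_polynomial_le (p * d) (\<lambda>V. real (cnt T {} V))" if T: "T \<subseteq> {..<p}" for T
  proof (cases "T = {..<p}")
    case True
    have "cnt T {} V = 0" for V
    proof -
      have "\<not> (\<forall>r\<in>T. N r x)" if x: "x \<in> cone_points d p [] V" for x
      proof -
        have xc: "x \<in> closed_cone d p []" using x by (simp add: cone_points_def)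
        then have b: "x \<in> balanced d p" unfolding closed_cone_def by blast
        obtain r where r: "r < p" "0 \<le> lead_coeff (diff_poly d p x r)"
          using exists_nonneg_diff[OF d p xc] by blast
        then have "\<not> N r x" unfolding N_def lex_neg_diff_coeffs[OF d b r(1)] by simp
        then show ?thesis using r(1) True by blast
      qed
      then have "{x \<in> cone_points d p [] V. (\<forall>r\<in>T. N r x) \<and> (\<forall>r\<in>{}. \<not> N r x)} = {}" by blast
      then show ?thesis unfolding cnt_def by (simp only: card.empty)
    qed
    then show ?thesis by (simp add: quasi_polynomial_le_0)
  next
    case False
    \<comment> \<open>For a row \<open>s\<close> outside \<open>T\<close>, the increments of
      \<open>jump_vec p s\<close> vanish in all rows of \<open>T\<close>, so it is the nonzero point
      common to all cones that arise.\<close>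
    then obtain s where s: "s < p" "s \<notin> T" using T by blast
    have finT: "finite T" using finite_subset[OF T] by simp
    define Fs where "Fs = map (diff_coeffs d p) (sorted_list_of_set T)"
    have setFs: "set Fs = diff_coeffs d p ` T" using finT by (simp add: Fs_def)
    have "quasi_polynomial_le (p * d) (\<lambda>V. real (card {x \<in> cone_points d p [] V. \<forall>fs\<in>set Fs. lex_neg fs x}))"
    proof (rule lex_neg_count[OF p _ jump_vec(1,2)[OF d p s(1)]])
      show "\<forall>fs\<in>set Fs. \<forall>f\<in>set fs. rational_functional f \<and> f (jump_vec p s) = 0"
      proof (intro ballI)
        fix fs f assume "fs \<in> set Fs" "f \<in> set fs"
        then obtain r k where rk: "r \<in> T" "f = (\<lambda>h. coeff (diff_poly d p h r) k)"
          unfolding setFs diff_coeffs_def by auto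
        have "diff_poly d p (jump_vec p s) r = 0"
          using jump_vec(3)[OF d p s(1), of r] rk(1) T s(2) by blast
        then show "rational_functional f \<and> f (jump_vec p s) = 0"
          unfolding rk(2) using rational_coeff_diff_poly by simp
      qed
    qed simp
    then show ?thesis by (simp add: cnt_def setFs N_def)
  qed
  have "quasi_polynomial_le (p * d) (\<lambda>V. real (cnt T Q V))" if "finite Q" "Q \<subseteq> {..<p}" "T \<subseteq> {..<p}" for T Q
    using that
  proof (induction Q arbitrary: T rule: finite_induct)
    case empty
    then show ?case by (intro leaf)
  next
    case (insert q Q)
    have "real (cnt T (insert q Q) V) = real (cnt T Q V) - real (cnt (insert q T) Q V)" for V
    proof -
      let ?S = "\<lambda>T Q. {x \<in> cone_points d p [] V. (\<forall>r\<in>T. N r x) \<and> (\<forall>r\<in>Q. \<not> N r x)}"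
      have fin: "finite (?S T Q)" for T Q
        by (rule finite_subset[OF _ finite_cone_points[OF p]]) blast
      have eq: "?S T Q = ?S T (insert q Q) \<union> ?S (insert q T) Q" by auto
      have disj: "?S T (insert q Q) \<inter> ?S (insert q T) Q = {}" by auto
      have "card (?S T Q) = card (?S T (insert q Q)) + card (?S (insert q T) Q)"
        unfolding eq by (rule card_Un_disjoint[OF fin fin disj])
      then show ?thesis unfolding cnt_def by linarith
    qed
    moreover have "quasi_polynomial_le (p * d) (\<lambda>V. real (cnt T Q V) - real (cnt (insert q T) Q V))"
      using insert.prems by (intro quasi_polynomial_le_diff insert.IH) auto
    ultimately show ?case by (simp only:)
  qed
  from this[of "{..<p}" "{}"] show ?thesis by (simp add: cnt_def nd_eq[OF d p] N_def Ball_def)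
qed

subsection \<open>Density of lattice points in dilated polytopes\<close>

lemma borel_measurable_component:
  assumes "l \<in> I"
  shows "(\<lambda>c. c l) \<in> borel_measurable (PiM I (\<lambda>_. lborel :: real measure))"
  using measurable_component_singleton[OF assms, of "\<lambda>_. lborel :: real measure"]
  by (simp only: measurable_cong_sets[OF refl sets_lborel])

lemma borel_measurable_affine:
  "(\<lambda>c. \<alpha> + (\<Sum>l\<in>I. c l * \<beta> l)) \<in> borel_measurable (PiM I (\<lambda>_. lborel :: real measure))"
  by (intro borel_measurable_add borel_measurable_const borel_measurable_sum borel_measurable_times
      borel_measurable_component)

text \<open>Fubini in the coordinate \<open>i\<close>: every line in that direction meets the
  hyperplane in at most one point.\<close>

lemma hyperplane_null:
  fixes \<beta> :: "'i \<Rightarrow> real"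
  assumes "finite I" "i \<in> I" "\<beta> i \<noteq> 0"
  shows "{c \<in> space (PiM I (\<lambda>_. lborel)). \<alpha> + (\<Sum>l\<in>I. c l * \<beta> l) = 0} \<in> null_sets (PiM I (\<lambda>_. lborel))"
proof -
  interpret product_sigma_finite "\<lambda>_::'i. lborel :: real measure" by standard
  let ?M = "\<lambda>I. PiM I (\<lambda>_::'i. lborel :: real measure)"
  let ?H = "{c \<in> space (?M I). \<alpha> + (\<Sum>l\<in>I. c l * \<beta> l) = 0}"
  define J where "J = I - {i}"
  have J: "finite J" "i \<notin> J" "I = insert i J" using assms by (auto simp: J_def)
  have H: "?H \<in> sets (?M I)"
    using borel_measurable_affine[where \<alpha> = \<alpha> and \<beta> = \<beta> and I = I] by measurable
  have "emeasure (?M I) ?H = (\<integral>\<^sup>+ c. indicator ?H c \<partial>?M I)"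
    using H by simp
  also have "\<dots> = (\<integral>\<^sup>+ x. (\<integral>\<^sup>+ y. indicator ?H (x(i := y)) \<partial>lborel) \<partial>?M J)"
  proof -
    have "indicator ?H \<in> borel_measurable (?M (insert i J))"
      using H J(3) by (intro borel_measurable_indicator) simp
    then show ?thesis using product_nn_integral_insert[OF J(1,2), of "indicator ?H"] J(3) by simp
  qed
  also have "\<dots> = (\<integral>\<^sup>+ x. 0 \<partial>?M J)"
  proof (rule nn_integral_cong)
    fix x :: "'i \<Rightarrow> real"
    define s where "s = - (\<alpha> + (\<Sum>l\<in>J. x l * \<beta> l)) / \<beta> i"
    have le: "(indicator ?H (x(i := y)) :: ennreal) \<le> indicator {s} y" for y
    proof (cases "x(i := y) \<in> ?H")
      case True
      have "(\<Sum>l\<in>I. (x(i := y)) l * \<beta> l) = y * \<beta> i + (\<Sum>l\<in>J. (x(i := y)) l * \<beta> l)"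
        unfolding J(3) using J(1,2) by simp
      also have "(\<Sum>l\<in>J. (x(i := y)) l * \<beta> l) = (\<Sum>l\<in>J. x l * \<beta> l)"
        using J(2) by (intro sum.cong) auto
      finally have "\<alpha> + (y * \<beta> i + (\<Sum>l\<in>J. x l * \<beta> l)) = 0" using True by simp
      then have "y = s" using assms(3) by (simp add: s_def field_simps)
      then show ?thesis by (simp add: indicator_def)
    qed simp
    have "(\<integral>\<^sup>+ y. indicator ?H (x(i := y)) \<partial>lborel) \<le> (\<integral>\<^sup>+ y. indicator {s} y \<partial>lborel)"
      by (intro nn_integral_mono le)
    also have "\<dots> = 0" by simp
    finally show "(\<integral>\<^sup>+ y. indicator ?H (x(i := y)) \<partial>lborel) = 0" by simp
  qed
  finally show ?thesis using H by (simp add: null_sets_def)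
qed

lemma floor_div_tendsto:
  fixes x :: real
  shows "(\<lambda>n. of_int \<lfloor>real (Suc n) * x\<rfloor> / real (Suc n)) \<longlonglongrightarrow> x"
proof (rule tendsto_sandwich)
  show "\<forall>\<^sub>F n in sequentially. x - inverse (real (Suc n)) \<le> of_int \<lfloor>real (Suc n) * x\<rfloor> / real (Suc n)"
  proof (intro always_eventually allI)
    fix n
    have "real (Suc n) * x - 1 \<le> of_int \<lfloor>real (Suc n) * x\<rfloor>" by linarith
    then have "(real (Suc n) * x - 1) / real (Suc n) \<le> of_int \<lfloor>real (Suc n) * x\<rfloor> / real (Suc n)"
      by (intro divide_right_mono) simp_all
    then show "x - inverse (real (Suc n)) \<le> of_int \<lfloor>real (Suc n) * x\<rfloor> / real (Suc n)"
      by (simp add: diff_divide_distrib inverse_eq_divide del: of_nat_Suc)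
  qed
  show "\<forall>\<^sub>F n in sequentially. of_int \<lfloor>real (Suc n) * x\<rfloor> / real (Suc n) \<le> x"
  proof (intro always_eventually allI)
    fix n
    have "of_int \<lfloor>real (Suc n) * x\<rfloor> / real (Suc n) \<le> (real (Suc n) * x) / real (Suc n)"
      by (intro divide_right_mono) simp_all
    then show "of_int \<lfloor>real (Suc n) * x\<rfloor> / real (Suc n) \<le> x" by (simp del: of_nat_Suc)
  qed
  show "(\<lambda>n. x - inverse (real (Suc n))) \<longlonglongrightarrow> x"
    using tendsto_diff[OF tendsto_const LIMSEQ_inverse_real_of_nat, of x] by simp
qed simp

text \<open>Cubes of side 1/n with lower corners at the points z/n have total measure card(Z n) /
  n^k. Off the bounding hyperplanes their indicator converges to that of the closed polytope, and
  these hyperplanes are null sets. So strict inequalities may be counted while weak ones are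
  measured; dominated convergence concludes.\<close>

lemma lattice_point_density:
  fixes I :: "'i set" and \<alpha> :: "'i \<Rightarrow> real" and \<beta> :: "'i \<Rightarrow> nat \<Rightarrow> real" and k :: nat
  defines "Z \<equiv> \<lambda>n. {z \<in> {..<k} \<rightarrow>\<^sub>E (UNIV :: int set). \<forall>i\<in>I. 0 < \<alpha> i + (\<Sum>l<k. of_int (z l) / real n * \<beta> i l)}"
  assumes I: "finite I" and nontriv: "\<And>i. i \<in> I \<Longrightarrow> (\<exists>l<k. \<beta> i l \<noteq> 0) \<or> \<alpha> i \<noteq> 0"
    and bounded: "\<And>c l. (\<And>i. i \<in> I \<Longrightarrow> 0 \<le> \<alpha> i + (\<Sum>l<k. c l * \<beta> i l)) \<Longrightarrow> l < k \<Longrightarrow> 0 \<le> c l \<and> c l \<le> 1"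
  shows "(\<lambda>n. real (card (Z n)) / real n ^ k) \<longlonglongrightarrow>
    measure (\<Pi>\<^sub>M l\<in>{..<k}. lborel) {c \<in> {..<k} \<rightarrow>\<^sub>E UNIV. \<forall>i\<in>I. 0 \<le> \<alpha> i + (\<Sum>l<k. c l * \<beta> i l)}"
proof -
  interpret product_sigma_finite "\<lambda>_::nat. lborel :: real measure" by standard
  define M where "M = PiM {..<k} (\<lambda>_. lborel :: real measure)"
  define form where "form i c = \<alpha> i + (\<Sum>l<k. c l * \<beta> i l)" for i and c :: "nat \<Rightarrow> real"
  define K where "K = {c \<in> {..<k} \<rightarrow>\<^sub>E UNIV. \<forall>i\<in>I. 0 \<le> form i c}"
  define fl where "fl n c = (\<lambda>l\<in>{..<k}. \<lfloor>real n * c l\<rfloor>)" for n and c :: "nat \<Rightarrow> real"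
  define U where "U n = {c \<in> {..<k} \<rightarrow>\<^sub>E (UNIV :: real set). fl n c \<in> Z n}" for n
  define Q where "Q n z = (\<Pi>\<^sub>E l\<in>{..<k}. {of_int (z l) / real n..<(of_int (z l) + 1) / real n})"
    for n and z :: "nat \<Rightarrow> int"
  have spaceM: "space M = {..<k} \<rightarrow>\<^sub>E UNIV" by (simp add: M_def space_PiM)
  have form_meas: "form i \<in> borel_measurable M" for i
    unfolding M_def form_def by (rule borel_measurable_affine)
  have Q_iff: "c \<in> Q n z \<longleftrightarrow> c \<in> {..<k} \<rightarrow>\<^sub>E UNIV \<and> fl n c = z" if n: "0 < n" and z: "z \<in> {..<k} \<rightarrow>\<^sub>E UNIV" for n z c
  proof -
    have "y \<in> {of_int a / real n..<(of_int a + 1) / real n} \<longleftrightarrow> \<lfloor>real n * y\<rfloor> = a" for y and a :: int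
    proof -
      have "of_int a / real n \<le> y \<longleftrightarrow> of_int a \<le> real n * y" using n by (simp add: pos_divide_le_eq mult.commute)
      moreover have "y < (of_int a + 1) / real n \<longleftrightarrow> real n * y < of_int a + 1"
        using n by (simp add: pos_less_divide_eq mult.commute)
      ultimately show ?thesis by (simp add: floor_eq_iff)
    qed
    then have "c \<in> Q n z \<longleftrightarrow> c \<in> extensional {..<k} \<and> (\<forall>l<k. \<lfloor>real n * c l\<rfloor> = z l)"
      unfolding Q_def PiE_iff by (simp add: Ball_def conj_commute)
    also have "(\<forall>l<k. \<lfloor>real n * c l\<rfloor> = z l) \<longleftrightarrow> fl n c = z"
    proof
      assume A: "\<forall>l<k. \<lfloor>real n * c l\<rfloor> = z l"
      show "fl n c = z"
      proof (rule extensionalityI[of _ "{..<k}"])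
        show "fl n c \<in> extensional {..<k}" by (simp add: fl_def)
        show "z \<in> extensional {..<k}" using z by (simp add: PiE_iff)
        show "fl n c l = z l" if "l \<in> {..<k}" for l using A that by (simp add: fl_def)
      qed
    next
      assume "fl n c = z"
      then show "\<forall>l<k. \<lfloor>real n * c l\<rfloor> = z l" by (auto simp: fl_def)
    qed
    finally show ?thesis by (simp add: PiE_iff)
  qed
  have Zb: "z l / real n \<in> {0..1}" if n: "0 < n" and z: "z \<in> Z n" and l: "l < k" for n z l
  proof -
    have "0 \<le> \<alpha> i + (\<Sum>l<k. of_int (z l) / real n * \<beta> i l)" if "i \<in> I" for i
      using z that unfolding Z_def by (auto intro: less_imp_le)
    from bounded[OF this l] show ?thesis by simp
  qed
  have finZ: "finite (Z n)" if n: "0 < n" for n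
  proof (rule finite_subset)
    show "Z n \<subseteq> {..<k} \<rightarrow>\<^sub>E {0..int n}"
    proof
      fix z assume z: "z \<in> Z n"
      have "z l \<in> {0..int n}" if "l < k" for l
        using Zb[OF n z that] n by (simp add: zero_le_divide_iff pos_divide_le_eq)
      then show "z \<in> {..<k} \<rightarrow>\<^sub>E {0..int n}" using z unfolding Z_def by (simp add: PiE_iff)
    qed
    show "finite ({..<k} \<rightarrow>\<^sub>E {0..int n})" by (intro finite_PiE) auto
  qed
  have Qsets: "Q n z \<in> sets M" for n z
    unfolding Q_def M_def by (intro sets_PiM_I_finite) auto
  have Qem: "emeasure M (Q n z) = ennreal ((1 / real n) ^ k)" if "0 < n" for n z
  proof -
    have "emeasure M (Q n z) = (\<Prod>l<k. emeasure lborel {of_int (z l) / real n..<(of_int (z l) + 1) / real n})"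
      unfolding M_def Q_def by (rule emeasure_PiM) auto
    also have "\<dots> = (\<Prod>l<k. ennreal (1 / real n))"
      using that by (intro prod.cong refl) (simp add: divide_right_mono add_divide_distrib)
    finally show ?thesis by (simp add: ennreal_power)
  qed
  have Uun: "U n = (\<Union>z\<in>Z n. Q n z)" if n: "0 < n" for n
  proof -
    have zP: "z \<in> {..<k} \<rightarrow>\<^sub>E UNIV" if "z \<in> Z n" for z using that unfolding Z_def by blast
    show ?thesis
    proof (intro equalityI subsetI)
      fix c assume "c \<in> U n"
      then have c: "c \<in> {..<k} \<rightarrow>\<^sub>E UNIV" "fl n c \<in> Z n" by (simp_all add: U_def)
      then have "c \<in> Q n (fl n c)" using Q_iff[OF n zP[OF c(2)]] by simp
      then show "c \<in> (\<Union>z\<in>Z n. Q n z)" using c(2) by blast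
    next
      fix c assume "c \<in> (\<Union>z\<in>Z n. Q n z)"
      then obtain z where z: "z \<in> Z n" "c \<in> Q n z" by blast
      then show "c \<in> U n" using Q_iff[OF n zP[OF z(1)]] by (simp add: U_def)
    qed
  qed
  have Usets: "U n \<in> sets M" if "0 < n" for n
    unfolding Uun[OF that] using finZ[OF that] Qsets by (intro sets.finite_UN) auto
  have Umeas: "measure M (U n) = real (card (Z n)) / real n ^ k" if n: "0 < n" for n
  proof -
    have "measure M (U n) = (\<Sum>z\<in>Z n. measure M (Q n z))"
      unfolding Uun[OF n]
    proof (rule measure_finite_Union[OF finZ[OF n]])
      show "Q n ` Z n \<subseteq> sets M" using Qsets by blast
      show "disjoint_family_on (Q n) (Z n)"
        unfolding disjoint_family_on_def
      proof (intro ballI impI)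
        fix z z' assume zz: "z \<in> Z n" "z' \<in> Z n" "z \<noteq> z'"
        have "z \<in> {..<k} \<rightarrow>\<^sub>E UNIV" "z' \<in> {..<k} \<rightarrow>\<^sub>E UNIV" using zz(1,2) unfolding Z_def by blast+
        from Q_iff[OF n this(1)] Q_iff[OF n this(2)] show "Q n z \<inter> Q n z' = {}" using zz(3) by auto
      qed
      show "emeasure M (Q n z) \<noteq> \<infinity>" for z by (simp add: Qem[OF n])
    qed
    also have "\<dots> = (\<Sum>z\<in>Z n. (1 / real n) ^ k)"
      by (intro sum.cong refl) (simp add: measure_def Qem[OF n])
    finally show ?thesis by (simp add: power_divide)
  qed
  \<comment> \<open>A dominating box: the lower corners lie in the unit cube and the side 1/n is at
    most 1.\<close>
  define Bx where "Bx = (\<Pi>\<^sub>E l\<in>{..<k}. {0..2 :: real})"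
  have Bx: "Bx \<in> sets M" "emeasure M Bx < \<infinity>"
  proof -
    show "Bx \<in> sets M" unfolding Bx_def M_def by (intro sets_PiM_I_finite) auto
    have "emeasure M Bx = (\<Prod>l<k. emeasure lborel {0..2 :: real})"
      unfolding Bx_def M_def by (rule emeasure_PiM) auto
    also have "\<dots> = (\<Prod>l<k. ennreal 2)" by simp
    also have "\<dots> = ennreal (2 ^ k)"
      by (simp only: prod_constant card_lessThan) (rule ennreal_power, simp)
    finally show "emeasure M Bx < \<infinity>" by simp
  qed
  have UBx: "U n \<subseteq> Bx" if n: "0 < n" for n
  proof
    fix c assume c: "c \<in> U n"
    have "c l \<in> {0..2}" if l: "l < k" for l
    proof -
      have "of_int \<lfloor>real n * c l\<rfloor> / real n \<in> {0..1}"
        using Zb[OF n _ l, of "fl n c"] c l by (simp add: U_def fl_def)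
      then have "0 \<le> of_int \<lfloor>real n * c l\<rfloor> / real n" "of_int \<lfloor>real n * c l\<rfloor> / real n \<le> 1" by auto
      then have "0 \<le> \<lfloor>real n * c l\<rfloor>" "\<lfloor>real n * c l\<rfloor> \<le> int n"
        using n by (simp_all add: zero_le_divide_iff pos_divide_le_eq)
      then have "0 \<le> real n * c l" "real n * c l < real n + 1" by linarith+
      then have "0 \<le> real n * c l" "real n * c l \<le> real n * 2" using n by linarith+
      then show ?thesis using n by (simp add: zero_le_mult_iff)
    qed
    then show "c \<in> Bx" using c by (simp add: U_def Bx_def PiE_iff)
  qed
  have Ksets: "K \<in> sets M"
  proof -
    have "{c \<in> space M. \<forall>i\<in>I. 0 \<le> form i c} \<in> sets M"
    proof (rule sets.sets_Collect_finite_All[OF _ I])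
      show "{c \<in> space M. 0 \<le> form i c} \<in> sets M" if "i \<in> I" for i
        using form_meas[of i] by measurable
    qed
    then show ?thesis by (simp add: K_def spaceM)
  qed
  define N where "N = (\<Union>i\<in>I. {c \<in> space M. form i c = 0})"
  have Nnull: "N \<in> null_sets M"
    unfolding N_def
  proof (rule null_sets_UN'[OF countable_finite[OF I]])
    fix i assume i: "i \<in> I"
    show "{c \<in> space M. form i c = 0} \<in> null_sets M"
    proof (cases "\<exists>l<k. \<beta> i l \<noteq> 0")
      case True
      then obtain l where "l < k" "\<beta> i l \<noteq> 0" by blast
      then show ?thesis unfolding M_def form_def by (intro hyperplane_null[of _ l]) auto
    next
      case False
      then have "form i c = \<alpha> i" for c by (simp add: form_def)
      moreover have "\<alpha> i \<noteq> 0" using nontriv[OF i] False by blast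
      ultimately have "{c \<in> space M. form i c = 0} = {}" by simp
      then show ?thesis by (simp only: null_sets.empty_sets)
    qed
  qed
  \<comment> \<open>Off \<open>N\<close> no form vanishes at \<open>c\<close>, so for large n its
    sign at the rounded-down point is its sign at \<open>c\<close>.\<close>
  have lim: "(\<lambda>n. indicator (U (Suc n)) c :: real) \<longlonglongrightarrow> indicator K c" if c: "c \<in> space M" "c \<notin> N" for c
  proof -
    have cP: "c \<in> {..<k} \<rightarrow>\<^sub>E UNIV" using c(1) spaceM by simp
    define g where "g i n = \<alpha> i + (\<Sum>l<k. of_int \<lfloor>real (Suc n) * c l\<rfloor> / real (Suc n) * \<beta> i l)" for i n
    have g: "g i \<longlonglongrightarrow> form i c" for i
      unfolding g_def form_def by (intro tendsto_add tendsto_const tendsto_sum tendsto_mult floor_div_tendsto)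
    have mem: "c \<in> U (Suc n) \<longleftrightarrow> (\<forall>i\<in>I. 0 < g i n)" for n
    proof -
      have "fl (Suc n) c \<in> {..<k} \<rightarrow>\<^sub>E UNIV" by (simp add: fl_def)
      moreover have "(\<Sum>l<k. of_int (fl (Suc n) c l) / real (Suc n) * \<beta> i l) =
          (\<Sum>l<k. of_int \<lfloor>real (Suc n) * c l\<rfloor> / real (Suc n) * \<beta> i l)" for i
        by (intro sum.cong refl) (simp add: fl_def)
      ultimately show ?thesis using cP by (simp add: U_def Z_def g_def)
    qed
    have nz: "form i c \<noteq> 0" if "i \<in> I" for i using c that by (simp add: N_def)
    show ?thesis
    proof (cases "c \<in> K")
      case True
      have "\<forall>\<^sub>F n in sequentially. 0 < g i n" if "i \<in> I" for i
      proof -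
        have "0 < form i c" using True nz[OF that] that by (force simp: K_def)
        then show ?thesis using order_tendstoD(1)[OF g] by blast
      qed
      then have "\<forall>\<^sub>F n in sequentially. \<forall>i\<in>I. 0 < g i n" by (intro eventually_ball_finite[OF I]) blast
      then have "\<forall>\<^sub>F n in sequentially. (indicator (U (Suc n)) c :: real) = indicator K c"
        by eventually_elim (simp add: mem True)
      then show ?thesis by (rule tendsto_eventually)
    next
      case False
      then obtain i where i: "i \<in> I" "form i c < 0" using cP by (auto simp: K_def not_le)
      have "\<forall>\<^sub>F n in sequentially. g i n < 0" by (rule order_tendstoD(2)[OF g i(2)])
      then have "\<forall>\<^sub>F n in sequentially. (indicator (U (Suc n)) c :: real) = indicator K c"
      proof eventually_elim
        case (elim n)
        then have "c \<notin> U (Suc n)" using i(1) mem[of n] by (meson not_less_iff_gr_or_eq)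
        then show ?case using False by simp
      qed
      then show ?thesis by (rule tendsto_eventually)
    qed
  qed
  have "(\<lambda>n. integral\<^sup>L M (indicator (U (Suc n)) :: _ \<Rightarrow> real)) \<longlonglongrightarrow> integral\<^sup>L M (indicator K)"
  proof (rule integral_dominated_convergence[where w = "indicator Bx"])
    show "(indicator K :: _ \<Rightarrow> real) \<in> borel_measurable M" using Ksets by simp
    show "(indicator (U (Suc n)) :: _ \<Rightarrow> real) \<in> borel_measurable M" for n using Usets[of "Suc n"] by simp
    show "integrable M (indicator Bx :: _ \<Rightarrow> real)" using Bx by (intro integrable_real_indicator)
    have "AE c in M. c \<notin> N" by (rule AE_not_in[OF Nnull])
    then show "AE c in M. (\<lambda>n. indicator (U (Suc n)) c :: real) \<longlonglongrightarrow> indicator K c"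
      using AE_space by eventually_elim (rule lim)
    show "AE c in M. norm (indicator (U (Suc n)) c :: real) \<le> indicator Bx c" for n
      using UBx[of "Suc n"] by (intro AE_I2) (auto simp: indicator_def)
  qed
  moreover have "U n \<inter> space M = U n" "K \<inter> space M = K" for n
    by (auto simp: U_def K_def spaceM)
  ultimately have "(\<lambda>n. measure M (U (Suc n))) \<longlonglongrightarrow> measure M K" by simp
  then have "(\<lambda>n. real (card (Z (Suc n))) / real (Suc n) ^ k) \<longlonglongrightarrow> measure M K"
    by (simp only: Umeas zero_less_Suc)
  then have "(\<lambda>n. real (card (Z n)) / real n ^ k) \<longlonglongrightarrow> measure M K"
    by (rule LIMSEQ_imp_Suc)
  then show ?thesis by (simp only: M_def K_def form_def)
qed

subsection \<open>The volume of \<open>S1\<close>\<close>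

definition chart_point :: "nat \<Rightarrow> nat \<Rightarrow> (nat \<Rightarrow> real) \<Rightarrow> nat \<Rightarrow> real" where
  "chart_point d p c = (\<lambda>i. chart_origin p i + (\<Sum>l<p * d. c l * chart_vec d p l i))"

lemma chart_point_eq:
  "chart_point d p c = 1 *\<^sub>R chart_origin p + (\<Sum>l<p * d. c l *\<^sub>R chart_vec d p l)"
  by (rule ext) (simp add: chart_point_def sum_fun_apply)

lemma chart_point:
  assumes "0 < p"
  shows "chart_point d p c \<in> balanced d p" "row_sum d p 0 (chart_point d p c) = 1"
    and "l < p * d \<Longrightarrow> chart_point d p c (chart_index d p l) = c l"
  unfolding chart_point_eq
  by (rule chart_combination(1)[OF assms]) (rule chart_combination(2)[OF assms assms], rule chart_combination(3)[OF assms])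

lemma chart_point_scaleR:
  assumes "0 < p" "x \<in> balanced d p" "row_sum d p 0 x = v" "v \<noteq> 0"
    and "\<And>l. l < p * d \<Longrightarrow> x (chart_index d p l) = v * c l"
  shows "x = v *\<^sub>R chart_point d p c"
proof (rule balanced_eqI[OF assms(2) _ _ _ assms(1)])
  show "v *\<^sub>R chart_point d p c \<in> balanced d p"
    by (intro subspace_scale[OF subspace_balanced] chart_point assms(1))
  show "row_sum d p 0 x = row_sum d p 0 (v *\<^sub>R chart_point d p c)"
    unfolding linear_cmul[OF linear_row_sum] chart_point(2)[OF assms(1)] assms(3) by simp
  show "x (chart_index d p l) = (v *\<^sub>R chart_point d p c) (chart_index d p l)" if "l < p * d" for l
    using assms(5)[OF that] chart_point(3)[OF assms(1) that, of c] by simp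
qed

lemma chart_affine:
  assumes "linear a"
  shows "a (chart_point d p c) = a (chart_origin p) + (\<Sum>l<p * d. c l * a (chart_vec d p l))"
  unfolding chart_point_eq by (simp add: linear_add[OF assms] linear_sum[OF assms] linear_cmul[OF assms])

lemma S1_chart_iff:
  assumes d: "0 < d" and p: "0 < p"
  shows "chart_point d p c \<in> S1 d p \<longleftrightarrow> (\<forall>a\<in>constraints d p. 0 \<le> a (chart_point d p c))"
  unfolding S1_eq[OF d p] weak_cone_def using chart_point(1,2)[OF p] by blast

text \<open>Entries in column 0 are 1 at the origin, other entries are detected by their own chart
  vector. Moving a unit from column 0 to column 1 in row r changes the slack of row r by 1, unless p
  = 1: then the two moments cancel and the slack is the volume.\<close>

lemma constraint_nontrivial:
  assumes d: "0 < d" and p: "0 < p" and a: "a \<in> constraints d p"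
  shows "(\<exists>l<p * d. a (chart_vec d p l) \<noteq> 0) \<or> a (chart_origin p) \<noteq> 0"
proof -
  have ld: "r * d < p * d" if "r < p" for r using that d by simp
  have vec: "chart_vec d p (r * d) = unit_vec p r 1 - unit_vec p r 0" for r
    using d by (simp add: chart_vec_def)
  from a consider i where "i < p * (d + 1)" "a = (\<lambda>h. h i)" | r where "r < p" "a = slack d p r"
    by (auto simp: constraints_def)
  then show ?thesis
  proof cases
    case (1 i)
    show ?thesis
    proof (cases "i < p")
      case True
      then show ?thesis using 1 by (simp add: chart_origin_apply)
    next
      case False
      define r where "r = i mod p"
      define j where "j = i div p"
      have i: "i = j * p + r" and r: "r < p" and j: "j \<le> d"
        using p index_div_le[OF 1(1)] by (simp_all add: r_def j_def)
      have "j \<noteq> 0" using False i r by (intro notI) simp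
      then obtain k where k: "j = Suc k" using not0_implies_Suc by blast
      have kd: "k < d" using j k by simp
      have "(r + 1) * d \<le> p * d" using r by (intro mult_le_mono1) simp
      then have l: "r * d + k < p * d" using kd by simp
      have "chart_index d p (r * d + k) = i" using kd by (simp add: chart_index_def i k)
      then have "a (chart_vec d p (r * d + k)) = 1"
        using chart_vec_at_index[OF l l] 1(2) by simp
      then show ?thesis using l by (intro disjI1 exI[of _ "r * d + k"]) simp
    qed
  next
    case (2 r)
    show ?thesis
    proof (cases "p = 1")
      case True
      then have "a (chart_origin p) = row_sum d p 0 (chart_origin p)" using 2 by (simp add: slack_def)
      then show ?thesis using row_sum_chart(2)[OF p, of d] by simp
    next
      case False
      have one: "1 \<le> d" using d by simp
      have m: "moment d p s (chart_vec d p (r * d)) = of_bool (s = r)" if "s < p" for s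
        unfolding vec linear_diff[OF linear_moment] using row_sum_unit_vec(2)[OF 2(1) that one]
          row_sum_unit_vec(2)[OF 2(1) that, of 0] by simp
      have "slack d p r (chart_vec d p (r * d)) = 1"
      proof (cases "r + 1 < p")
        case True
        then show ?thesis using m[OF 2(1)] m[OF True] by (simp add: slack_def)
      next
        case r: False
        then have "0 \<noteq> r" using False 2(1) by linarith
        then show ?thesis using m[OF 2(1)] m[OF p] row_sum_chart(1)[OF 2(1) ld[OF 2(1)]] r by (simp add: slack_def)
      qed
      then show ?thesis using 2 ld[OF 2(1)] by (intro disjI1 exI[of _ "r * d"]) simp
    qed
  qed
qed

text \<open>The vectors of volume n are n times the chart points, and integral ones correspond to
  integral coordinates because these are entries of the vector.\<close>

lemma gnd_eq_chart:
  assumes d: "0 < d" and p: "0 < p" and n: "0 < n"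
  shows "gnd d p n = card {z \<in> {..<p * d} \<rightarrow>\<^sub>E (UNIV :: int set). \<forall>a\<in>constraints d p.
    0 < a (chart_origin p) + (\<Sum>l<p * d. of_int (z l) / real n * a (chart_vec d p l))}"
    (is "_ = card ?Z")
proof -
  define \<phi> where "\<phi> z = real n *\<^sub>R chart_point d p (\<lambda>l. of_int (z l) / real n)" for z :: "nat \<Rightarrow> int"
  have Z: "z \<in> ?Z \<longleftrightarrow> z \<in> {..<p * d} \<rightarrow>\<^sub>E UNIV \<and>
      (\<forall>a\<in>constraints d p. 0 < a (chart_point d p (\<lambda>l. of_int (z l) / real n)))" for z
    by (simp add: chart_affine[OF linear_constraints])
  have pos: "0 < a (\<phi> z) \<longleftrightarrow> 0 < a (chart_point d p (\<lambda>l. of_int (z l) / real n))"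
    if "a \<in> constraints d p" for a z
    unfolding \<phi>_def linear_cmul[OF linear_constraints[OF that]] using n by (simp add: zero_less_mult_iff)
  have \<phi>: "\<phi> z \<in> balanced d p" "row_sum d p 0 (\<phi> z) = real n" "l < p * d \<Longrightarrow> \<phi> z (chart_index d p l) = of_int (z l)" for z l
  proof -
    show "\<phi> z \<in> balanced d p"
      unfolding \<phi>_def by (intro subspace_scale[OF subspace_balanced] chart_point p)
    show "row_sum d p 0 (\<phi> z) = real n"
      unfolding \<phi>_def linear_cmul[OF linear_row_sum] chart_point(2)[OF p] by simp
    show "\<phi> z (chart_index d p l) = of_int (z l)" if "l < p * d"
      using chart_point(3)[OF p that] n by (simp add: \<phi>_def)
  qed
  have lat: "\<phi> z \<in> lattice d p" for z
  proof -
    have "\<phi> z = row_sum d p 0 (\<phi> z) *\<^sub>R chart_origin p +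
        (\<Sum>l<p * d. \<phi> z (chart_index d p l) *\<^sub>R chart_vec d p l)"
      by (rule chart_expansion[OF p \<phi>(1)])
    also have "\<dots> = real n *\<^sub>R chart_origin p + (\<Sum>l<p * d. of_int (z l) *\<^sub>R chart_vec d p l)"
      using \<phi>(2,3) by (intro arg_cong2[of _ _ _ _ "(+)"] sum.cong) simp_all
    finally have eq: "\<phi> z = real n *\<^sub>R chart_origin p + (\<Sum>l<p * d. of_int (z l) *\<^sub>R chart_vec d p l)" .
    have "\<phi> z i \<in> \<int>" for i
      unfolding eq plus_fun_apply sum_fun_apply scaleR_fun_apply real_scaleR_def
      by (intro Ints_add Ints_mult Ints_sum Ints_of_nat Ints_of_int)
        (simp_all add: chart_origin_apply chart_vec_def unit_vec_def)
    then show ?thesis using balancedD(1)[OF \<phi>(1)] unfolding lattice_def by blast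
  qed
  have "bij_betw \<phi> ?Z {x \<in> strict_points d p. row_sum d p 0 x = real n}"
    unfolding bij_betw_def
  proof
    show "inj_on \<phi> ?Z"
    proof (rule inj_onI)
      fix z z' assume zz: "z \<in> ?Z" "z' \<in> ?Z" "\<phi> z = \<phi> z'"
      have E: "z \<in> {..<p * d} \<rightarrow>\<^sub>E UNIV" "z' \<in> {..<p * d} \<rightarrow>\<^sub>E UNIV" using zz(1,2) by blast+
      show "z = z'"
      proof (rule PiE_ext[OF E])
        fix l assume "l \<in> {..<p * d}"
        then show "z l = z' l" using \<phi>(3)[of l z] \<phi>(3)[of l z'] zz(3) by simp
      qed
    qed
    show "\<phi> ` ?Z = {x \<in> strict_points d p. row_sum d p 0 x = real n}"
    proof (intro equalityI subsetI)
      fix x assume "x \<in> \<phi> ` ?Z"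
      then obtain z where z: "z \<in> ?Z" "x = \<phi> z" by blast
      have "\<forall>a\<in>constraints d p. 0 < a (\<phi> z)" using z(1) pos unfolding Z by blast
      then show "x \<in> {x \<in> strict_points d p. row_sum d p 0 x = real n}"
        unfolding z(2) strict_points_def using \<phi>(1,2) lat by simp
    next
      fix x assume x: "x \<in> {x \<in> strict_points d p. row_sum d p 0 x = real n}"
      then have xl: "\<And>i. x i \<in> \<int>" and xb: "x \<in> balanced d p" and xs: "\<forall>a\<in>constraints d p. 0 < a x"
          and xn: "row_sum d p 0 x = real n"
        unfolding strict_points_def lattice_def by blast+
      define z where "z = (\<lambda>l\<in>{..<p * d}. \<lfloor>x (chart_index d p l)\<rfloor>)"
      have zl: "of_int (z l) = x (chart_index d p l)" if "l < p * d" for l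
        using xl[of "chart_index d p l"] that by (simp add: z_def)
      have "x = \<phi> z"
        unfolding \<phi>_def using zl n by (intro chart_point_scaleR p xb xn) simp_all
      moreover have "z \<in> ?Z"
        unfolding Z
      proof
        show "z \<in> {..<p * d} \<rightarrow>\<^sub>E UNIV" by (simp add: z_def)
        show "\<forall>a\<in>constraints d p. 0 < a (chart_point d p (\<lambda>l. of_int (z l) / real n))"
          using xs pos unfolding \<open>x = \<phi> z\<close> by blast
      qed
      ultimately show "x \<in> \<phi> ` ?Z" by blast
    qed
  qed
  then show ?thesis unfolding gnd_eq[OF d p] by (rule bij_betw_same_card[symmetric])
qed

definition S1_volume :: "nat \<Rightarrow> nat \<Rightarrow> real" where
  "S1_volume d p = measure (\<Pi>\<^sub>M l\<in>{..<p * d}. lborel)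
     {c \<in> {..<p * d} \<rightarrow>\<^sub>E UNIV. (\<lambda>i. chart_origin p i + (\<Sum>l<p * d. c l * chart_vec d p l i)) \<in> S1 d p}"

text \<open>The chart coordinates of a point of \<open>S1\<close> are entries of that vector, so
  they lie between 0 and 1, as the density argument requires.\<close>

lemma gnd_density:
  assumes d: "0 < d" and p: "0 < p"
  shows "(\<lambda>n. real (gnd d p n) / real n ^ (p * d)) \<longlonglongrightarrow> S1_volume d p"
proof -
  let ?K = "{c \<in> {..<p * d} \<rightarrow>\<^sub>E (UNIV :: real set). \<forall>a\<in>constraints d p.
    0 \<le> a (chart_origin p) + (\<Sum>l<p * d. c l * a (chart_vec d p l))}"
  let ?Z = "\<lambda>n. {z \<in> {..<p * d} \<rightarrow>\<^sub>E (UNIV :: int set). \<forall>a\<in>constraints d p.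
    0 < a (chart_origin p) + (\<Sum>l<p * d. of_int (z l) / real n * a (chart_vec d p l))}"
  have "(\<lambda>n. real (card (?Z n)) / real n ^ (p * d)) \<longlonglongrightarrow> measure (\<Pi>\<^sub>M l\<in>{..<p * d}. lborel) ?K"
  proof (rule lattice_point_density[OF finite_constraints])
    show "(\<exists>l<p * d. a (chart_vec d p l) \<noteq> 0) \<or> a (chart_origin p) \<noteq> 0" if "a \<in> constraints d p" for a
      by (rule constraint_nontrivial[OF d p that])
    fix c :: "nat \<Rightarrow> real" and l
    assume c: "\<And>a. a \<in> constraints d p \<Longrightarrow> 0 \<le> a (chart_origin p) + (\<Sum>l<p * d. c l * a (chart_vec d p l))"
      and l: "l < p * d"
    have nn: "0 \<le> chart_point d p c i" if "i < p * (d + 1)" for i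
    proof -
      have i: "(\<lambda>h. h i) \<in> constraints d p" using that unfolding constraints_def by blast
      show ?thesis using c[OF i] unfolding chart_affine[OF linear_coord] .
    qed
    show "0 \<le> c l \<and> c l \<le> 1"
      using balanced_le_volume[OF chart_point(1)[OF p] p nn, of "chart_index d p l"]
      unfolding chart_point(2)[OF p] chart_point(3)[OF p l] by blast
  qed
  moreover have "?K = {c \<in> {..<p * d} \<rightarrow>\<^sub>E UNIV. (\<lambda>i. chart_origin p i + (\<Sum>l<p * d. c l * chart_vec d p l i)) \<in> S1 d p}"
    using S1_chart_iff[OF d p] chart_affine[OF linear_constraints] unfolding chart_point_def[symmetric] by auto
  ultimately have lim: "(\<lambda>n. real (card (?Z n)) / real n ^ (p * d)) \<longlonglongrightarrow> S1_volume d p"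
    by (simp only: S1_volume_def)
  show ?thesis
  proof (rule Lim_transform_eventually[OF lim])
    show "\<forall>\<^sub>F n in sequentially. real (card (?Z n)) / real n ^ (p * d) = real (gnd d p n) / real n ^ (p * d)"
      using eventually_gt_at_top[of 0] by eventually_elim (simp only: gnd_eq_chart[OF d p])
  qed
qed

text \<open>The normalised \<open>generic_point\<close> s satisfies all constraints strictly, so s +
  e (x - s) lies in \<open>S1\<close> for small e > 0. Then x is the affine combination of this
  point and s with weights 1/e and 1 - 1/e.\<close>

lemma aff_hull_S1:
  assumes d: "0 < d" and p: "0 < p"
  shows "aff_hull (S1 d p) = {x \<in> balanced d p. row_sum d p 0 x = 1}"
proof (intro equalityI subsetI)
  fix x assume "x \<in> aff_hull (S1 d p)"
  then obtain m :: nat and u y where x: "x = (\<lambda>i. \<Sum>l<m. u l * y l i)" and y: "\<forall>l<m. y l \<in> S1 d p" and u: "(\<Sum>l<m. u l) = 1"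
    unfolding aff_hull_def by blast
  have yb: "y l \<in> balanced d p" "row_sum d p 0 (y l) = 1" if "l < m" for l
    using y that unfolding S1_eq[OF d p] weak_cone_def by blast+
  have xs: "x = (\<Sum>l<m. u l *\<^sub>R y l)" unfolding x by (rule ext) (simp add: sum_fun_apply)
  have "x \<in> balanced d p"
    unfolding xs using yb(1) by (intro subspace_sum[OF subspace_balanced] subspace_scale[OF subspace_balanced]) simp
  moreover have "row_sum d p 0 x = (\<Sum>l<m. u l)"
    unfolding xs linear_sum[OF linear_row_sum] linear_cmul[OF linear_row_sum]
    using yb(2) by (intro sum.cong refl) simp
  ultimately show "x \<in> {x \<in> balanced d p. row_sum d p 0 x = 1}" using u by simp
next
  fix x assume "x \<in> {x \<in> balanced d p. row_sum d p 0 x = 1}"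
  then have x: "x \<in> balanced d p" "row_sum d p 0 x = 1" by blast+
  note g = generic_point[OF d p]
  define v where "v = row_sum d p 0 (generic_point d p)"
  have v: "0 < v" unfolding v_def generic_point_sums(1)[OF d p] by (intro mult_pos_pos) simp_all
  define s where "s = (1 / v) *\<^sub>R generic_point d p"
  have s: "s \<in> balanced d p" "row_sum d p 0 s = 1"
    unfolding s_def linear_cmul[OF linear_row_sum]
    by (rule subspace_scale[OF subspace_balanced g(1)]) (use v in \<open>simp add: v_def\<close>)
  have spos: "0 < a s" if "a \<in> constraints d p" for a
    unfolding s_def linear_cmul[OF linear_constraints[OF that]] using g(3)[OF that] v by simp
  have "\<forall>\<^sub>F e in at_right 0. \<forall>a\<in>constraints d p. 0 \<le> a (s + e *\<^sub>R (x - s))"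
  proof (intro eventually_ball_finite finite_constraints ballI)
    fix a assume a: "a \<in> constraints d p"
    have "\<forall>\<^sub>F e in at_right 0. 0 < a s + e * a (x - s)"
      using spos[OF a] by (intro eventually_at_right_affine_pos disjI1)
    then show "\<forall>\<^sub>F e in at_right 0. 0 \<le> a (s + e *\<^sub>R (x - s))"
      by eventually_elim (simp only: linear_add[OF linear_constraints[OF a]] linear_cmul[OF linear_constraints[OF a]]
        real_scaleR_def less_imp_le)
  qed
  from eventually_happens'[OF trivial_limit_at_right_real eventually_conj[OF eventually_at_right_less this]]
  obtain e :: real where e: "0 < e" "\<forall>a\<in>constraints d p. 0 \<le> a (s + e *\<^sub>R (x - s))" by blast
  have t: "s + e *\<^sub>R (x - s) \<in> S1 d p"
    unfolding S1_eq[OF d p] weak_cone_def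
  proof (intro CollectI conjI e(2))
    show "s + e *\<^sub>R (x - s) \<in> balanced d p"
      by (intro subspace_add[OF subspace_balanced] subspace_scale[OF subspace_balanced] subspace_diff[OF subspace_balanced] s x)
    show "row_sum d p 0 (s + e *\<^sub>R (x - s)) = 1"
      unfolding linear_add[OF linear_row_sum] linear_cmul[OF linear_row_sum] linear_diff[OF linear_row_sum] s(2) x(2) by simp
  qed
  have sS: "s \<in> S1 d p"
    unfolding S1_eq[OF d p] weak_cone_def using s spos by (simp add: less_imp_le)
  define u where "u l = (if l = 0 then 1 / e else 1 - 1 / e)" for l :: nat
  define y where "y l = (if l = 0 then s + e *\<^sub>R (x - s) else s)" for l :: nat
  have two: "{..<2 :: nat} = {0, 1}" by auto
  have "x = (\<lambda>i. \<Sum>l<2. u l * y l i)"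
  proof
    fix i
    have "(\<Sum>l<2. u l * y l i) = 1 / e * (s i + e * (x i - s i)) + (1 - 1 / e) * s i"
      unfolding two by (simp add: u_def y_def)
    also have "\<dots> = x i" using e(1) by (simp add: field_simps)
    finally show "x i = (\<Sum>l<2. u l * y l i)" by (rule sym)
  qed
  moreover have "\<forall>l<2. y l \<in> S1 d p" using t sS by (simp add: y_def)
  moreover have "(\<Sum>l<2. u l) = 1" unfolding two by (simp add: u_def)
  ultimately show "x \<in> aff_hull (S1 d p)" unfolding aff_hull_def by blast
qed

text \<open>Coordinates are entries in columns 1 to \<open>d\<close>, and column 0 is an integral
  combination of these once the volume is fixed. Integral coordinates therefore describe exactly the
  integral differences.\<close>

lemma lattice_chart_S1:
  assumes d: "0 < d" and p: "0 < p"
  shows "lattice_chart (p * d) (S1 d p) (chart_origin p) (chart_vec d p)"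
  unfolding lattice_chart_def
proof
  show "bij_betw (\<lambda>c i. chart_origin p i + (\<Sum>l<p * d. c l * chart_vec d p l i)) ({..<p * d} \<rightarrow>\<^sub>E UNIV) (aff_hull (S1 d p))"
    unfolding chart_point_def[symmetric] bij_betw_def
  proof
    show "inj_on (chart_point d p) ({..<p * d} \<rightarrow>\<^sub>E UNIV)"
    proof (rule inj_onI)
      fix c c' :: "nat \<Rightarrow> real" assume c: "c \<in> {..<p * d} \<rightarrow>\<^sub>E UNIV" "c' \<in> {..<p * d} \<rightarrow>\<^sub>E UNIV"
        "chart_point d p c = chart_point d p c'"
      show "c = c'"
      proof (rule PiE_ext[OF c(1,2)])
        fix l assume "l \<in> {..<p * d}"
        then show "c l = c' l" using chart_point(3)[OF p, of l d c] chart_point(3)[OF p, of l d c'] c(3) by simp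
      qed
    qed
    show "chart_point d p ` ({..<p * d} \<rightarrow>\<^sub>E UNIV) = aff_hull (S1 d p)"
      unfolding aff_hull_S1[OF d p]
    proof (intro equalityI subsetI)
      fix x assume "x \<in> chart_point d p ` ({..<p * d} \<rightarrow>\<^sub>E UNIV)"
      then show "x \<in> {x \<in> balanced d p. row_sum d p 0 x = 1}" using chart_point(1,2)[OF p] by blast
    next
      fix x assume x: "x \<in> {x \<in> balanced d p. row_sum d p 0 x = 1}"
      define c where "c = (\<lambda>l\<in>{..<p * d}. x (chart_index d p l))"
      have "x = 1 *\<^sub>R chart_point d p c"
        using x by (intro chart_point_scaleR[OF p]) (simp_all add: c_def)
      then have "x = chart_point d p c" by simp
      moreover have "c \<in> {..<p * d} \<rightarrow>\<^sub>E UNIV" by (simp add: c_def)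
      ultimately show "x \<in> chart_point d p ` ({..<p * d} \<rightarrow>\<^sub>E UNIV)" by blast
    qed
  qed
  show "(\<lambda>c i. \<Sum>l<p * d. c l * chart_vec d p l i) ` ({..<p * d} \<rightarrow>\<^sub>E \<int>) = parallel_lattice (S1 d p)"
  proof (intro equalityI subsetI)
    fix v assume "v \<in> (\<lambda>c i. \<Sum>l<p * d. c l * chart_vec d p l i) ` ({..<p * d} \<rightarrow>\<^sub>E \<int>)"
    then obtain c where c: "c \<in> {..<p * d} \<rightarrow>\<^sub>E \<int>" and v: "v = (\<lambda>i. \<Sum>l<p * d. c l * chart_vec d p l i)" by blast
    have "chart_origin p \<in> aff_hull (S1 d p)"
      unfolding aff_hull_S1[OF d p] using chart_balanced(2) row_sum_chart(2)[OF p] by blast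
    moreover have "chart_point d p c \<in> aff_hull (S1 d p)"
      unfolding aff_hull_S1[OF d p] using chart_point(1,2)[OF p] by blast
    moreover have "v = (\<lambda>i. chart_point d p c i - chart_origin p i)"
      by (simp add: v chart_point_def)
    moreover have "\<forall>i. v i \<in> \<int>"
    proof
      fix i
      have "c l \<in> \<int>" if "l < p * d" for l using c that by (simp add: PiE_iff)
      then show "v i \<in> \<int>"
        unfolding v by (intro Ints_sum Ints_mult) (simp_all add: chart_vec_def unit_vec_def)
    qed
    ultimately show "v \<in> parallel_lattice (S1 d p)" unfolding parallel_lattice_def by blast
  next
    fix v assume "v \<in> parallel_lattice (S1 d p)"
    then obtain x y where xy: "x \<in> aff_hull (S1 d p)" "y \<in> aff_hull (S1 d p)" "v = (\<lambda>i. x i - y i)"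
        and vi: "\<forall>i. v i \<in> \<int>"
      unfolding parallel_lattice_def by blast
    have v: "v = x - y" unfolding xy(3) by (rule ext) simp
    have xb: "x \<in> balanced d p" "row_sum d p 0 x = 1" and yb: "y \<in> balanced d p" "row_sum d p 0 y = 1"
      using xy(1,2) unfolding aff_hull_S1[OF d p] by blast+
    have vb: "v \<in> balanced d p" unfolding v by (rule subspace_diff[OF subspace_balanced xb(1) yb(1)])
    have v0: "row_sum d p 0 v = 0" unfolding v linear_diff[OF linear_row_sum] xb(2) yb(2) by simp
    define c where "c = (\<lambda>l\<in>{..<p * d}. v (chart_index d p l))"
    have cZ: "c \<in> {..<p * d} \<rightarrow>\<^sub>E \<int>" using vi by (simp add: c_def PiE_iff)
    have "v = (\<lambda>i. \<Sum>l<p * d. c l * chart_vec d p l i)"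
    proof
      fix i
      have "v i = (row_sum d p 0 v *\<^sub>R chart_origin p + (\<Sum>l<p * d. v (chart_index d p l) *\<^sub>R chart_vec d p l)) i"
        using chart_expansion[OF p vb] by (rule fun_cong)
      also have "\<dots> = (\<Sum>l<p * d. c l * chart_vec d p l i)"
        unfolding v0 plus_fun_apply sum_fun_apply by (simp add: c_def)
      finally show "v i = (\<Sum>l<p * d. c l * chart_vec d p l i)" .
    qed
    then show "v \<in> (\<lambda>c i. \<Sum>l<p * d. c l * chart_vec d p l i) ` ({..<p * d} \<rightarrow>\<^sub>E \<int>)" using cZ by blast
  qed
qed

section \<open>Leading coefficients and exact degrees\<close>

text \<open>The subsequence starts at \<open>r + m\<close>, so the possibly exceptional argument 0
  is avoided.\<close>

lemma constituent_limit:
  fixes f :: "nat \<Rightarrow> real"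
  assumes "0 < m" "\<And>n. 1 \<le> n \<Longrightarrow> n mod m = r \<Longrightarrow> f n = poly q (real n)" "degree q \<le> D" "r < m"
  shows "(\<lambda>t. f (r + m * Suc t) / real (r + m * Suc t) ^ D) \<longlonglongrightarrow> coeff q D"
proof -
  have "filterlim (\<lambda>t. real (r + m * Suc t)) at_top sequentially"
  proof (rule filterlim_compose[OF filterlim_real_sequentially])
    have "strict_mono (\<lambda>t. r + m * Suc t)" using assms(1) by (intro strict_monoI) simp
    then show "filterlim (\<lambda>t. r + m * Suc t) at_top sequentially" by (rule filterlim_subseq)
  qed
  from filterlim_compose[OF poly_div_power_tendsto[OF assms(3)] this]
  have "(\<lambda>t. poly q (real (r + m * Suc t)) / real (r + m * Suc t) ^ D) \<longlonglongrightarrow> coeff q D" .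
  moreover have "f (r + m * Suc t) = poly q (real (r + m * Suc t))" for t
  proof (rule assms(2))
    show "1 \<le> r + m * Suc t" using assms(1) by simp
    show "(r + m * Suc t) mod m = r" using assms(4) by (simp only: mod_mult_self2 mod_less)
  qed
  ultimately show ?thesis by (simp only:)
qed

text \<open>This bounds the degree of \<open>nd\<close> from below. Finiteness of the larger set has
  to be checked, as an infinite set has cardinality 0.\<close>

lemma gnd_le_nd:
  assumes "0 < d" "0 < p"
  shows "gnd d p V \<le> nd d p V"
proof -
  have "finite {h \<in> C_END d p. (\<forall>i. h i \<in> \<nat>) \<and> vol d p h = real V}"
  proof (rule finite_subset[OF _ finite_lattice_points[OF assms(2), where V = V and d = d]], rule subsetI)
    fix h assume "h \<in> {h \<in> C_END d p. (\<forall>i. h i \<in> \<nat>) \<and> vol d p h = real V}"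
    then have h: "h \<in> C_END d p" "\<And>i. h i \<in> \<nat>" "row_sum d p 0 h = real V" unfolding vol_eq by blast+
    have b: "h \<in> balanced d p" by (rule C_END_imp_weak(1)[OF assms h(1)])
    have "h i \<in> \<int>" "0 \<le> h i" for i using h(2)[of i] by (auto elim: Nats_cases)
    then show "h \<in> {x \<in> lattice d p \<inter> balanced d p. (\<forall>i<p * (d + 1). 0 \<le> x i) \<and> row_sum d p 0 x = real V}"
      using b balancedD(1)[OF b] h(3) by (simp add: lattice_def)
  qed
  then show ?thesis unfolding gnd_def nd_def by (rule card_mono) blast
qed

lemma Max_degree_eq:
  fixes q :: "nat \<Rightarrow> real poly"
  assumes "\<And>r. degree (q r) \<le> D" "r < m" "coeff (q r) D \<noteq> 0"
  shows "Max ((\<lambda>r. degree (q r)) ` {..<m}) = D"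
proof (rule Max_eqI)
  have "degree (q r) = D" using assms(1)[of r] le_degree[OF assms(3)] by simp
  then show "D \<in> (\<lambda>r. degree (q r)) ` {..<m}" using assms(2) by blast
qed (use assms(1) in auto)

text \<open>The leading coefficient in residue class 0 equals the density of lattice points, and by
  the numerator formula also the volume of the h-vector divided by D! m^D. The exact degree is
  witnessed by a possibly different class \<open>r\<close>.\<close>

lemma gnd_constituents:
  assumes d: "0 < d" and p: "0 < p"
  defines "m \<equiv> Lcm {1..d}"
  shows "\<exists>h q r. has_h_vector (\<lambda>V. real (gnd d p V)) m (p * d) h \<and> (\<forall>i. 0 \<le> coeff h i) \<and>
    h_vector_volume m h = real m ^ (p * d) * (fact (p * d) * S1_volume d p) \<and>
    (\<forall>n\<ge>1. real (gnd d p n) = poly (q (n mod m)) (real n)) \<and>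
    (\<forall>r. degree (q r) \<le> p * d) \<and> r < m \<and> 0 < coeff (q r) (p * d)"
proof -
  let ?D = "p * d"
  let ?f = "\<lambda>V. real (gnd d p V)"
  let ?u = "(1 - fps_X ^ m) ^ Suc ?D :: real fps"
  have m: "0 < m" unfolding m_def by (rule Lcm_pos)
  obtain h where h: "fps_of_poly h = Abs_fps ?f * ?u" and h0: "\<forall>i. 0 \<le> coeff h i" and hd: "degree h \<le> m * Suc ?D"
    using gnd_series[OF d p] unfolding m_def by (elim exE conjE)
  have u0: "?u \<noteq> 0"
    using fps_inverse_one_minus_X_power[OF m, of ?D] by (metis mult_zero_left zero_neq_one)
  have hv: "has_h_vector ?f m ?D h"
    unfolding has_h_vector_def h Suc_eq_plus1[symmetric] by (rule nonzero_mult_div_cancel_right[OF u0, symmetric])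
  have "h \<noteq> 0"
  proof
    assume "h = 0"
    then have "Abs_fps ?f * ?u = 0" unfolding h[symmetric] by simp
    then have "Abs_fps ?f = 0" using u0 by simp
    then have z: "gnd d p V = 0" for V by (metis fps_nth_Abs_fps fps_zero_nth of_nat_eq_0_iff)
    \<comment> \<open>The volume of \<open>generic_point\<close>, itself a generic lattice point, so
      the series does not vanish.\<close>
    let ?V = "(p + 1) * (d + 1)"
    have "generic_point d p \<in> {x \<in> strict_points d p. row_sum d p 0 x = real ?V}"
      unfolding strict_points_def using generic_point[OF d p] generic_point_sums(1)[OF d p]
      by (simp only: mem_Collect_eq Int_iff of_nat_mult) blast
    moreover have "finite {x \<in> strict_points d p. row_sum d p 0 x = real ?V}"
      by (rule finite_subset[OF _ finite_lattice_points[OF p, where V = ?V and d = d]])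
        (auto simp: strict_points_def ball_constraints less_imp_le)
    ultimately have "card {x \<in> strict_points d p. row_sum d p 0 x = real ?V} \<noteq> 0" by auto
    then show False using z[of ?V] gnd_eq[OF d p, of ?V] by simp
  qed
  then obtain i where i: "coeff h i \<noteq> 0" using leading_coeff_0_iff by blast
  show ?thesis
  proof (rule constituents_of_numerator[OF m h hd])
    fix q :: "nat \<Rightarrow> real poly"
    assume fq: "\<And>n. 1 \<le> n \<or> degree h < m * Suc ?D \<Longrightarrow> ?f n = poly (q (n mod m)) (real n)"
      and dq: "\<And>r. degree (q r) \<le> ?D"
      and cq: "\<And>r. coeff (q r) ?D = (\<Sum>i | i \<le> degree h \<and> i mod m = r. coeff h i) / (fact ?D * real m ^ ?D)"
    have den: "0 < fact ?D * real m ^ ?D" using m by simp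
    \<comment> \<open>Nonnegative numerator entries cannot cancel, so the residue class of one
      nonzero entry has a positive leading coefficient.\<close>
    have pos: "0 < coeff (q (i mod m)) ?D"
      unfolding cq
    proof (rule divide_pos_pos[OF _ den], rule sum_pos2[where i = i])
      show "0 < coeff h i" using i h0 by (simp add: order_less_le)
      show "i \<in> {j. j \<le> degree h \<and> j mod m = i mod m}" using le_degree[OF i] by simp
    qed (use h0 in auto)
    have "(\<lambda>t. ?f (0 + m * Suc t) / real (0 + m * Suc t) ^ ?D) \<longlonglongrightarrow> coeff (q 0) ?D"
    proof (rule constituent_limit[OF m _ dq m])
      show "?f n = poly (q 0) (real n)" if "1 \<le> n" "n mod m = 0" for n
        using fq[of n] that by simp
    qed
    moreover have "(\<lambda>t. ?f (0 + m * Suc t) / real (0 + m * Suc t) ^ ?D) \<longlonglongrightarrow> S1_volume d p"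
    proof -
      have "strict_mono (\<lambda>t. 0 + m * Suc t)" using m by (intro strict_monoI) simp
      from LIMSEQ_subseq_LIMSEQ[OF gnd_density[OF d p] this] show ?thesis by (simp only: o_def)
    qed
    ultimately have "coeff (q 0) ?D = S1_volume d p" by (rule LIMSEQ_unique)
    then have "(\<Sum>i | i \<le> degree h \<and> i mod m = 0. coeff h i) = S1_volume d p * (fact ?D * real m ^ ?D)"
      unfolding cq using den by (simp only: divide_eq_eq)
    then have "h_vector_volume m h = real m ^ ?D * (fact ?D * S1_volume d p)"
      unfolding h_vector_volume_def by (simp add: dvd_eq_mod_eq_0 mult_ac)
    moreover have "\<forall>n\<ge>1. ?f n = poly (q (n mod m)) (real n)" using fq by blast
    moreover have "i mod m < m" using m by simp
    ultimately show ?thesis using hv h0 dq pos by blast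
  qed
qed

theorem theorem7p2:
  fixes d p :: nat
  assumes "0 < d" and "0 < p"
  shows "quasi_polynomial_on {1..} (Lcm {1..d}) (p * d) (\<lambda>V. real (gnd d p V))
    \<and> (\<exists>h NV. has_h_vector (\<lambda>V. real (gnd d p V)) (Lcm {1..d}) (p * d) h
          \<and> (\<forall>i. 0 \<le> coeff h i)
          \<and> has_normalized_volume (p * d) (S1 d p) NV
          \<and> h_vector_volume (Lcm {1..d}) h = real (Lcm {1..d}) ^ (p * d) * NV)
    \<and> (\<exists>m. quasi_polynomial_on UNIV m (p * d) (\<lambda>V. real (nd d p V)))"
proof -
  let ?D = "p * d"
  let ?m = "Lcm {1..d}"
  obtain h q r where h: "has_h_vector (\<lambda>V. real (gnd d p V)) ?m ?D h" "\<forall>i. 0 \<le> coeff h i"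
      "h_vector_volume ?m h = real ?m ^ ?D * (fact ?D * S1_volume d p)"
    and q: "\<forall>n\<ge>1. real (gnd d p n) = poly (q (n mod ?m)) (real n)" "\<forall>r. degree (q r) \<le> ?D"
    and r: "r < ?m" "0 < coeff (q r) ?D"
    using gnd_constituents[OF assms] by (elim exE conjE)
  have A: "quasi_polynomial_on {1..} ?m ?D (\<lambda>V. real (gnd d p V))"
    unfolding quasi_polynomial_on_def
  proof (intro conjI exI[of _ q] ballI)
    show "0 < ?m" by (rule Lcm_pos)
    show "real (gnd d p n) = poly (q (n mod ?m)) (real n)" if "n \<in> {1..}" for n
      using q(1) that by simp
    show "Max ((\<lambda>r. degree (q r)) ` {..<?m}) = ?D"
      using q(2) r by (intro Max_degree_eq[of q ?D r]) auto
  qed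
  have B: "has_normalized_volume ?D (S1 d p) (fact ?D * S1_volume d p)"
    unfolding has_normalized_volume_def S1_volume_def
    using lattice_chart_S1[OF assms] by blast
  have C: "\<exists>m. quasi_polynomial_on UNIV m ?D (\<lambda>V. real (nd d p V))"
  proof -
    obtain m' q' where m': "0 < m'" and q': "\<forall>n. real (nd d p n) = poly (q' (n mod m')) (real n)" "\<forall>r. degree (q' r) \<le> ?D"
      using nd_quasi_polynomial[OF assms] unfolding quasi_polynomial_le_def by (elim exE conjE)
    \<comment> \<open>A common period, so that both functions are polynomial along the progression r
      + M, r + 2M, ...\<close>
    define M where "M = ?m * m'"
    have M: "0 < M" "r < M" unfolding M_def using m' r(1) Lcm_pos[of d] by (simp_all add: less_le_trans[OF r(1)])
    define s where "s = r mod m'"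
    have "(\<lambda>t. real (gnd d p (r + M * Suc t)) / real (r + M * Suc t) ^ ?D) \<longlonglongrightarrow> coeff (q r) ?D"
    proof (rule constituent_limit[OF M(1) _ _ M(2)])
      fix n assume n: "1 \<le> n" "n mod M = r"
      have "n mod ?m = n mod M mod ?m" unfolding M_def by (simp add: mod_mod_cancel)
      then have "n mod ?m = r" using n(2) r(1) by simp
      then show "real (gnd d p n) = poly (q r) (real n)" using q(1) n(1) by simp
    qed (use q(2) in blast)
    moreover have "(\<lambda>t. real (nd d p (r + M * Suc t)) / real (r + M * Suc t) ^ ?D) \<longlonglongrightarrow> coeff (q' s) ?D"
    proof (rule constituent_limit[OF M(1) _ _ M(2)])
      fix n assume n: "1 \<le> n" "n mod M = r"
      have "n mod m' = n mod M mod m'" unfolding M_def by (simp add: mod_mod_cancel)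
      then have "n mod m' = s" using n(2) by (simp add: s_def)
      then show "real (nd d p n) = poly (q' s) (real n)" using q'(1) by simp
    qed (use q'(2) in blast)
    \<comment> \<open>Comparison of limits by \<open>gnd_le_nd\<close>: a constituent of
      \<open>nd\<close> inherits a positive coefficient of degree pd.\<close>
    ultimately have "coeff (q r) ?D \<le> coeff (q' s) ?D"
      by (rule LIMSEQ_le) (intro exI allI impI divide_right_mono of_nat_mono gnd_le_nd assms zero_le_power of_nat_0_le_iff)
    then have "coeff (q' s) ?D \<noteq> 0" using r(2) by linarith
    moreover have "s < m'" using m' by (simp add: s_def)
    ultimately have "Max ((\<lambda>r. degree (q' r)) ` {..<m'}) = ?D"
      using q'(2) by (intro Max_degree_eq[of q' ?D s]) auto
    then show ?thesis
      unfolding quasi_polynomial_on_def using m' q'(1) by blast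
  qed
  show ?thesis using A B C h by blast
qed

end
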